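(* Let $p\ge 1$. Consider the semi-discrete finite difference scheme, for all grid indices $\bm i$, $$\frac{\mathrm d}{\mathrm dt}(J_{\bm i}\bm U_{\bm i})=-\sum_{k=1}^3\frac{1}{\Delta\xi_k}\Big((\widetilde{\mathcal F}_k)^{2p}_{\bm i,k,+\frac12}-(\widetilde{\mathcal F}_k)^{2p}_{\bm i,k,-\frac12}\Big)-\Phi'(\bm V_{\bm i})^{\mathrm T}\sum_{k=1}^3\frac{1}{\Delta\xi_k}\Big((\widetilde{\mathcal B}_k)^{2p}_{\bm i,k,+\frac12}-(\widetilde{\mathcal B}_k)^{2p}_{\bm i,k,-\frac12}\Big),$$ $$\frac{\mathrm d}{\mathrm dt}J_{\bm i}=-\sum_{k=1}^3\frac{1}{\Delta\xi_k}\Big((\widetilde{M}_{k,t})^{2p}_{\bm i,k,+\frac12}-(\widetilde{M}_{k,t})^{2p}_{\bm i,k,-\frac12}\Big),$$ with the $2p$th-order fluxes and the discrete metrics $(M_{k,\zeta})_{\bm i}$ ($\zeta\in\{t,x_1,x_2,x_3\}$) defined in the context. Then: (1) The scheme is $2p$th-order accurate in space: if $\bm x(\tau,\bm\xi)$ (with $J>0$) and $\bm U(\tau,\bm\xi)$ are smooth, and the exact point values of $\bm x$, $\partial_\tau\bm x$, $\bm U$ are inserted in the right-hand sides, then these equal $-\sum_k\partial_{\xi_k}\mathcal F_k-\Phi'(\bm V)^{\mathrm T}\sum_k\partial_{\xi_k}\mathcal B_k$ and $-\sum_k\partial_{\xi_k}(J\partial_t\xi_k)$ at $\bm i$, respectively,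 up to $\mathcal O\big((\max_k\Delta\xi_k)^{2p}\big)$. (2) The scheme is entropy conservative: its solutions satisfy, at every $\bm i$, $$\frac{\mathrm d}{\mathrm dt}\big(J_{\bm i}\,\eta(\bm U_{\bm i}(t))\big)+\sum_{k=1}^3\frac1{\Delta\xi_k}\Big((\widetilde{\mathfrak q}_k)^{2p}_{\bm i,k,+\frac12}-(\widetilde{\mathfrak q}_k)^{2p}_{\bm i,k,-\frac12}\Big)=0,$$ where $$(\widetilde{\mathfrak q}_k)^{2p}_{\bm i,k,+\frac12}=\sum_{n=1}^p\alpha_{p,n}\sum_{s=0}^{n-1}\widetilde{\mathfrak q}_k(\bm i,k,-s\,;\ \bm i,k,-s+n),$$ $$\begin{aligned}\widetilde{\mathfrak q}_k(l;r)=&\ \tfrac12(\bm V_l+\bm V_r)^{\mathrm T}\widetilde{\mathcal F}_k(l;r)-\tfrac14\big((M_{k,t})_l+(M_{k,t})_r\big)(\phi_l+\phi_r)\\&-\sum_{j=1}^3\tfrac14\big((M_{k,x_j})_l+(M_{k,x_j})_r\big)\big((\psi_j)_l+(\psi_j)_r\big)\\&+\sum_{j=1}^3\tfrac18\big((M_{k,x_j})_l+(M_{k,x_j})_r\big)\big((B_j)_l+(B_j)_r\big)(\Phi_l+\Phi_r),\end{aligned}$$ and these numerical entropy fluxes are consistent with $\mathfrak q_k=J\partial_t\xi_k\,\eta+\sum_{j=1}^3J\partial_{x_j}\xi_k\,q_j$.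
   Context: **Physical system (3D special relativistic MHD, speed of light 1).** States have rest-mass density $\rho>0$, pressure $p_{\rm gas}>0$, velocity $\bm v\in\mathbb R^3$ with $|\bm v|<1$, magnetic field $\bm B\in\mathbb R^3$. Put $W=(1-|\bm v|^2)^{-1/2}$, adiabatic index $\Gamma\in(1,2]$, specific enthalpy $h=1+\frac{\Gamma}{\Gamma-1}\frac{p_{\rm gas}}{\rho}$, $|b|^2=|\bm B|^2/W^2+(\bm v\cdot\bm B)^2$, $p_{\rm tot}=p_{\rm gas}+\frac12|b|^2$. The conservative vector is $\bm U=(D,\bm m,E,\bm B)^{\mathrm T}\in\mathbb R^8$, with $D=\rho W$, $\bm m=(\rho hW^2+|\bm B|^2)\bm v-(\bm v\cdot\bm B)\bm B$, $E=DhW-p_{\rm tot}+|\bm B|^2$; primitive variables are functions of $\bm U$. For $k=1,2,3$, $$\bm F_k=\big(Dv_k,\ \bm m v_k-B_k(\bm B/W^2+(\bm v\cdot\bm B)\bm v)+p_{\rm tot}\bm e_k,\ m_k,\ v_k\bm B-B_k\bm v\big)^{\mathrm T},$$ $\bm e_k$ the $k$-th unit vector. **Entropy quantities.** $s=\ln(p_{\rm gas}/\rho^\Gamma)$, $\eta(\bm U)=-\frac{\rho Ws}{\Gamma-1}$, $q_k=\eta v_k$, $\bm V=\eta'(\bm U)^{\mathrm T}=\Big(\frac{\Gamma-s}{\Gamma-1}+\frac{\rho}{p_{\rm gas}},\ \frac{\rho W\bm v^{\mathrm T}}{p_{\rm gas}},\ -\frac{\rho W}{p_{\rm gas}},\ \frac{\rho(\bm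 B+W^2\bm v(\bm v\cdot\bm B))}{p_{\rm gas}W}\Big)^{\mathrm T}$. $\Phi=\frac{\rho W(\bm v\cdot\bm B)}{p_{\rm gas}}$, viewed as a function of $\bm V$, is homogeneous of degree one with $\Phi'(\bm V)=(0,\ \bm B/W^2+\bm v(\bm v\cdot\bm B),\ \bm v\cdot\bm B,\ \bm v)$, so $\Phi=\Phi'(\bm V)\bm V$. Potentials: $\phi=\bm V^{\mathrm T}\bm U-\eta$, $\psi_k=\bm V^{\mathrm T}\bm F_k+\Phi B_k-q_k$. **Curvilinear form.** A smooth time-dependent one-to-one map $t=\tau$, $\bm x=\bm x(\tau,\bm\xi)$ has Jacobian determinant $J$. Put $\mathcal F_k=J\partial_t\xi_k\,\bm U+\sum_jJ\partial_{x_j}\xi_k\,\bm F_j$, $\mathcal B_k=\sum_jJ\partial_{x_j}\xi_k\,B_j$. The underlying system is $\partial_\tau(J\bm U)+\sum_k\partial_{\xi_k}\mathcal F_k=-\Phi'(\bm V)^{\mathrm T}\sum_k\partial_{\xi_k}\mathcal B_k$, and $J$ obeys the volume conservation law $\partial_\tau J+\sum_k\partial_{\xi_k}(J\partial_t\xi_k)=0$. **Grid notation.** Uniform Cartesian grid in $\bm\xi$ with steps $\Delta\xi_k$, indices $\bm i=(i_1,i_2,i_3)$ (boundaries are ignored). The subscript $\bm i,k,n$ means $i_k$ is increased by $n$; half-integer shifts denote interfaces, and the flux at $\bm i,k,-\frac12$ is the one at $\bm i',k,+\frac12$ with $\bm i'=(\bm i,k,-1)$. $\bm U_{\bm i}=(J\bm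 U)_{\bm i}/J_{\bm i}$, with $J_{\bm i}>0$, is assumed admissible; other quantities with subscript $\bm i$ are evaluated at $\bm U_{\bm i}$. The grid points $\bm x_{\bm i}(t)$ move with velocity $\dot{\bm x}_{\bm i}$. **Coefficients.** $\alpha_{p,1},\dots,\alpha_{p,p}$ satisfy $\sum_{n=1}^pn\alpha_{p,n}=1$ and $\sum_{n=1}^pn^{2s-1}\alpha_{p,n}=0$ for $s=2,\dots,p$. **Discrete metrics.** Write $M_{k,x_j}$ for $J\partial_{x_j}\xi_k$ and $M_{k,t}$ for $J\partial_t\xi_k$. With $\delta_k[a]_{\bm i}=\frac12\sum_{n=1}^p\alpha_{p,n}(a_{\bm i,k,+n}-a_{\bm i,k,-n})$, for $(k,k',k'')$ and $(j,j',j'')$ cyclic permutations of $(1,2,3)$, $$(M_{k,x_j})_{\bm i}=\frac{1}{\Delta\xi_{k'}\Delta\xi_{k''}}\Big(\delta_{k''}\big[\delta_{k'}[x_{j'}]\,x_{j''}\big]-\delta_{k'}\big[\delta_{k''}[x_{j'}]\,x_{j''}\big]\Big)_{\bm i},$$ $$(M_{k,t})_{\bm i}=-\sum_{j=1}^3(\dot x_j)_{\bm i}(M_{k,x_j})_{\bm i}.$$ **Two-point fluxes.** $\widetilde{\bm U}(\bm U_l,\bm U_r)$ and $\widetilde{\bm F}_j(\bm U_l,\bm U_r)$ are smooth, symmetric in the two arguments, consistent ($\widetilde{\bm U}(\bm U,\bm U)=\bm U$, $\widetilde{\bm F}_j(\bm U,\bm U)=\bm F_j(\bm U)$) and satisfy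 $(\bm V_r-\bm V_l)^{\mathrm T}\widetilde{\bm U}=\phi_r-\phi_l$ and $(\bm V_r-\bm V_l)^{\mathrm T}\widetilde{\bm F}_j=(\psi_j)_r-(\psi_j)_l-\frac12\big((B_j)_l+(B_j)_r\big)(\Phi_r-\Phi_l)$. For grid points $l,r$: $$\widetilde{\mathcal F}_k(l;r)=\tfrac12\big((M_{k,t})_l+(M_{k,t})_r\big)\widetilde{\bm U}(\bm U_l,\bm U_r)+\sum_{j=1}^3\tfrac12\big((M_{k,x_j})_l+(M_{k,x_j})_r\big)\widetilde{\bm F}_j(\bm U_l,\bm U_r),$$ $$\widetilde{\mathcal B}_k(l;r)=\sum_{j=1}^3\tfrac14\big((M_{k,x_j})_l+(M_{k,x_j})_r\big)\big((B_j)_l+(B_j)_r\big),\qquad \widetilde M_{k,\zeta}(l;r)=\tfrac12\big((M_{k,\zeta})_l+(M_{k,\zeta})_r\big).$$ **$2p$th-order fluxes.** For $\widetilde G\in\{\widetilde{\mathcal F}_k,\widetilde{\mathcal B}_k,\widetilde M_{k,\zeta}\}$: $\displaystyle(\widetilde G)^{2p}_{\bm i,k,+\frac12}=\sum_{n=1}^p\alpha_{p,n}\sum_{s=0}^{n-1}\widetilde G(\bm i,k,-s\,;\ \bm i,k,-s+n).$ Consistency of a numerical entropy flux means it reduces to $\mathfrak q_k$ when all its state and metric arguments coincide. *)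

theory Defs
  imports "HOL-Analysis.Analysis"
begin

section \<open>Smooth maps and directional derivatives\<close>

text \<open>\<open>Ck_on n S f\<close>: \<open>f\<close> is \<open>n\<close> times continuously differentiable on the set \<open>S\<close>, which is
  meant to be open.\<close>

primrec Ck_on ::
  "nat \<Rightarrow> 'a::real_normed_vector set \<Rightarrow> ('a \<Rightarrow> 'b::real_normed_vector) \<Rightarrow> bool"
where
  "Ck_on 0 S f \<longleftrightarrow> continuous_on S f"
| "Ck_on (Suc n) S f \<longleftrightarrow>
     (\<forall>x\<in>S. f differentiable (at x)) \<and> (\<forall>v. Ck_on n S (\<lambda>x. frechet_derivative f (at x) v))"

definition smooth_on ::
  "'a::real_normed_vector set \<Rightarrow> ('a \<Rightarrow> 'b::real_normed_vector) \<Rightarrow> bool"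
where
  "smooth_on S f \<longleftrightarrow> (\<forall>n. Ck_on n S f)"

definition dir_deriv ::
  "('a::real_normed_vector \<Rightarrow> 'b::real_normed_vector) \<Rightarrow> 'a \<Rightarrow> 'a \<Rightarrow> 'b"
where
  "dir_deriv f v z = vector_derivative (\<lambda>h. f (z + h *\<^sub>R v)) (at 0)"

section \<open>States\<close>

text \<open>A conservative vector is \<open>(D, m, E, B)\<close>, a primitive vector is \<open>(\<rho>, v, p, B)\<close> with gas
  pressure \<open>p\<close>. The product type stands for the 8-dimensional Euclidean space, and its inner
  product is the standard one. \<open>\<Gamma>\<close> is always the adiabatic index.\<close>

type_synonym state = "real \<times> (real^3) \<times> real \<times> (real^3)"
type_synonym primitive = "real \<times> (real^3) \<times> real \<times> (real^3)"

definition lorentz :: "real^3 \<Rightarrow> real" where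
  "lorentz v = 1 / sqrt (1 - (norm v)\<^sup>2)"

definition enthalpy :: "real \<Rightarrow> real \<Rightarrow> real \<Rightarrow> real" where
  "enthalpy \<Gamma> \<rho> p = 1 + \<Gamma> / (\<Gamma> - 1) * (p / \<rho>)"

definition b_sq :: "real^3 \<Rightarrow> real^3 \<Rightarrow> real" where
  "b_sq v B = (norm B)\<^sup>2 / (lorentz v)\<^sup>2 + (v \<bullet> B)\<^sup>2"

definition p_tot :: "real^3 \<Rightarrow> real \<Rightarrow> real^3 \<Rightarrow> real" where
  "p_tot v p B = p + b_sq v B / 2"

definition prim_states :: "primitive set" where
  "prim_states = {(\<rho>, v, p, B). \<rho> > 0 \<and> p > 0 \<and> norm v < 1}"

fun cons_of :: "real \<Rightarrow> primitive \<Rightarrow> state" where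
  "cons_of \<Gamma> (\<rho>, v, p, B) =
    (let W = lorentz v; h = enthalpy \<Gamma> \<rho> p; D = \<rho> * W in
     (D,
      (\<rho> * h * W\<^sup>2 + (norm B)\<^sup>2) *\<^sub>R v - (v \<bullet> B) *\<^sub>R B,
      D * h * W - p_tot v p B + (norm B)\<^sup>2,
      B))"

definition admissible :: "real \<Rightarrow> state set" where
  "admissible \<Gamma> = cons_of \<Gamma> ` prim_states"

text \<open>For \<open>1 < \<Gamma> \<le> 2\<close> the map \<open>cons_of \<Gamma>\<close> is injective on \<open>prim_states\<close>, so the description below
  is proper on \<open>admissible \<Gamma>\<close>.\<close>

definition prim_of :: "real \<Rightarrow> state \<Rightarrow> primitive" where
  "prim_of \<Gamma> U = (THE w. w \<in> prim_states \<and> cons_of \<Gamma> w = U)"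

definition dens :: "real \<Rightarrow> state \<Rightarrow> real" where
  "dens \<Gamma> U = fst (prim_of \<Gamma> U)"

definition vel :: "real \<Rightarrow> state \<Rightarrow> real^3" where
  "vel \<Gamma> U = fst (snd (prim_of \<Gamma> U))"

definition p_gas :: "real \<Rightarrow> state \<Rightarrow> real" where
  "p_gas \<Gamma> U = fst (snd (snd (prim_of \<Gamma> U)))"

definition mom :: "state \<Rightarrow> real^3" where
  "mom U = fst (snd U)"

definition mag :: "state \<Rightarrow> real^3" where
  "mag U = snd (snd (snd U))"

definition phys_flux :: "real \<Rightarrow> 3 \<Rightarrow> state \<Rightarrow> state" where
  "phys_flux \<Gamma> k U =
    (let v = vel \<Gamma> U; B = mag U; W = lorentz v in
     (fst U * v $ k,
      (v $ k) *\<^sub>R mom U - (B $ k) *\<^sub>R ((1 / W\<^sup>2) *\<^sub>R B + (v \<bullet> B) *\<^sub>R v)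
        + p_tot v (p_gas \<Gamma> U) B *\<^sub>R axis k 1,
      mom U $ k,
      (v $ k) *\<^sub>R B - (B $ k) *\<^sub>R v))"

section \<open>Entropy quantities\<close>

definition spec_entropy :: "real \<Rightarrow> state \<Rightarrow> real" where
  "spec_entropy \<Gamma> U = ln (p_gas \<Gamma> U / dens \<Gamma> U powr \<Gamma>)"

definition eta :: "real \<Rightarrow> state \<Rightarrow> real" where
  "eta \<Gamma> U = - (dens \<Gamma> U * lorentz (vel \<Gamma> U) * spec_entropy \<Gamma> U) / (\<Gamma> - 1)"

definition ent_flux :: "real \<Rightarrow> 3 \<Rightarrow> state \<Rightarrow> real" where
  "ent_flux \<Gamma> k U = eta \<Gamma> U * vel \<Gamma> U $ k"

text \<open>The entropy variables: the gradient of \<open>eta \<Gamma>\<close> with respect to \<open>U\<close>, in closed form.\<close>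

definition ent_var :: "real \<Rightarrow> state \<Rightarrow> state" where
  "ent_var \<Gamma> U =
    (let \<rho> = dens \<Gamma> U; v = vel \<Gamma> U; p = p_gas \<Gamma> U; B = mag U; W = lorentz v in
     ((\<Gamma> - spec_entropy \<Gamma> U) / (\<Gamma> - 1) + \<rho> / p,
      (\<rho> * W / p) *\<^sub>R v,
      - (\<rho> * W / p),
      (\<rho> / (p * W)) *\<^sub>R (B + (W\<^sup>2 * (v \<bullet> B)) *\<^sub>R v)))"

definition Phi :: "real \<Rightarrow> state \<Rightarrow> real" where
  "Phi \<Gamma> U = dens \<Gamma> U * lorentz (vel \<Gamma> U) * (vel \<Gamma> U \<bullet> mag U) / p_gas \<Gamma> U"

text \<open>The gradient of \<open>\<Phi>\<close> with respect to the entropy variables, in closed form and evaluated at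
  \<open>ent_var \<Gamma> U\<close>.\<close>

definition grad_Phi :: "real \<Rightarrow> state \<Rightarrow> state" where
  "grad_Phi \<Gamma> U =
    (let v = vel \<Gamma> U; B = mag U in
     (0, (1 / (lorentz v)\<^sup>2) *\<^sub>R B + (v \<bullet> B) *\<^sub>R v, v \<bullet> B, v))"

definition phi_pot :: "real \<Rightarrow> state \<Rightarrow> real" where
  "phi_pot \<Gamma> U = ent_var \<Gamma> U \<bullet> U - eta \<Gamma> U"

definition psi_pot :: "real \<Rightarrow> 3 \<Rightarrow> state \<Rightarrow> real" where
  "psi_pot \<Gamma> k U =
     ent_var \<Gamma> U \<bullet> phys_flux \<Gamma> k U + Phi \<Gamma> U * mag U $ k - ent_flux \<Gamma> k U"

section \<open>Curvilinear coordinates\<close>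

text \<open>Points of space-time are pairs \<open>(\<tau>, \<xi>)\<close>. The coordinate map \<open>X\<close> on the domain \<open>S\<close> gives
  \<open>x = X (\<tau>, \<xi>)\<close>, and \<open>time_map X\<close> is \<open>(\<tau>, \<xi>) \<mapsto> (t, x)\<close>.\<close>

definition time_map :: "(real \<times> (real^3) \<Rightarrow> real^3) \<Rightarrow> real \<times> (real^3) \<Rightarrow> real \<times> (real^3)" where
  "time_map X z = (fst z, X z)"

definition d_tau :: "(real \<times> (real^3) \<Rightarrow> 'b::real_normed_vector) \<Rightarrow> real \<times> (real^3) \<Rightarrow> 'b" where
  "d_tau f = dir_deriv f (1, 0)"

definition d_xi :: "3 \<Rightarrow> (real \<times> (real^3) \<Rightarrow> 'b::real_normed_vector) \<Rightarrow> real \<times> (real^3) \<Rightarrow> 'b" where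
  "d_xi k f = dir_deriv f (0, axis k 1)"

definition jac_det :: "(real \<times> (real^3) \<Rightarrow> real^3) \<Rightarrow> real \<times> (real^3) \<Rightarrow> real" where
  "jac_det X z = det (\<chi> j k. d_xi k X z $ j)"

definition inv_coord ::
  "(real \<times> (real^3)) set \<Rightarrow> (real \<times> (real^3) \<Rightarrow> real^3) \<Rightarrow> 3 \<Rightarrow> real \<times> (real^3) \<Rightarrow> real"
where
  "inv_coord S X k y = snd (inv_into S (time_map X) y) $ k"

text \<open>The exact metric terms \<open>J \<partial>\<^sub>t \<xi>\<^sub>k\<close> and \<open>J \<partial>\<^sub>x\<^sub>j \<xi>\<^sub>k\<close> at the point \<open>z = (\<tau>, \<xi>)\<close>: the
  derivatives of the inverse coordinate map are taken at the image \<open>(t, x)\<close> of \<open>z\<close>.\<close>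

definition metric_t ::
  "(real \<times> (real^3)) set \<Rightarrow> (real \<times> (real^3) \<Rightarrow> real^3) \<Rightarrow> 3 \<Rightarrow> real \<times> (real^3) \<Rightarrow> real"
where
  "metric_t S X k z = jac_det X z * dir_deriv (inv_coord S X k) (1, 0) (time_map X z)"

definition metric_x ::
  "(real \<times> (real^3)) set \<Rightarrow> (real \<times> (real^3) \<Rightarrow> real^3) \<Rightarrow> 3 \<Rightarrow> 3 \<Rightarrow> real \<times> (real^3) \<Rightarrow> real"
where
  "metric_x S X k j z = jac_det X z * dir_deriv (inv_coord S X k) (0, axis j 1) (time_map X z)"

definition curv_flux ::
  "real \<Rightarrow> (real \<times> (real^3)) set \<Rightarrow> (real \<times> (real^3) \<Rightarrow> real^3) \<Rightarrow> (real \<times> (real^3) \<Rightarrow> state)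
    \<Rightarrow> 3 \<Rightarrow> real \<times> (real^3) \<Rightarrow> state"
where
  "curv_flux \<Gamma> S X U k z =
     metric_t S X k z *\<^sub>R U z + (\<Sum>j\<in>UNIV. metric_x S X k j z *\<^sub>R phys_flux \<Gamma> j (U z))"

definition curv_mag ::
  "(real \<times> (real^3)) set \<Rightarrow> (real \<times> (real^3) \<Rightarrow> real^3) \<Rightarrow> (real \<times> (real^3) \<Rightarrow> state)
    \<Rightarrow> 3 \<Rightarrow> real \<times> (real^3) \<Rightarrow> real"
where
  "curv_mag S X U k z = (\<Sum>j\<in>UNIV. metric_x S X k j z * mag (U z) $ j)"

section \<open>The grid and the discrete metrics\<close>

text \<open>The grid is indexed by all of \<open>int^3\<close>; the index written \<open>i, k, n\<close> in subscripts is
  \<open>i + axis k n\<close>. The vector \<open>\<Delta>\<close> collects the three step sizes.\<close>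

type_synonym index = "int^3"

definition grid_point :: "real^3 \<Rightarrow> real^3 \<Rightarrow> index \<Rightarrow> real^3" where
  "grid_point \<xi>\<^sub>0 \<Delta> i = (\<chi> k. \<xi>\<^sub>0 $ k + of_int (i $ k) * \<Delta> $ k)"

definition order_coeffs :: "nat \<Rightarrow> (nat \<Rightarrow> real) \<Rightarrow> bool" where
  "order_coeffs p \<alpha> \<longleftrightarrow>
     (\<Sum>n=1..p. real n * \<alpha> n) = 1 \<and>
     (\<forall>s\<in>{2..p}. (\<Sum>n=1..p. real n ^ (2 * s - 1) * \<alpha> n) = 0)"

definition delta :: "nat \<Rightarrow> (nat \<Rightarrow> real) \<Rightarrow> 3 \<Rightarrow> (index \<Rightarrow> real) \<Rightarrow> index \<Rightarrow> real" where
  "delta p \<alpha> k a i =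
     (1/2) * (\<Sum>n=1..p. \<alpha> n * (a (i + axis k (int n)) - a (i + axis k (- int n))))"

text \<open>Addition in the index type \<open>3\<close> is modulo 3, so \<open>(k, k + 1, k + 2)\<close> runs through the cyclic
  permutations of \<open>(1, 2, 3)\<close>.\<close>

definition disc_metric_x ::
  "nat \<Rightarrow> (nat \<Rightarrow> real) \<Rightarrow> real^3 \<Rightarrow> (index \<Rightarrow> real^3) \<Rightarrow> 3 \<Rightarrow> 3 \<Rightarrow> index \<Rightarrow> real"
where
  "disc_metric_x p \<alpha> \<Delta> x k j i =
    (let k' = k + 1; k'' = k + 2; j' = j + 1; j'' = j + 2 in
     1 / (\<Delta> $ k' * \<Delta> $ k'') *
       (delta p \<alpha> k'' (\<lambda>l. delta p \<alpha> k' (\<lambda>m. x m $ j') l * x l $ j'') i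
        - delta p \<alpha> k' (\<lambda>l. delta p \<alpha> k'' (\<lambda>m. x m $ j') l * x l $ j'') i))"

definition disc_metric_t ::
  "nat \<Rightarrow> (nat \<Rightarrow> real) \<Rightarrow> real^3 \<Rightarrow> (index \<Rightarrow> real^3) \<Rightarrow> (index \<Rightarrow> real^3) \<Rightarrow> 3 \<Rightarrow> index \<Rightarrow> real"
where
  "disc_metric_t p \<alpha> \<Delta> x x' k i = - (\<Sum>j\<in>UNIV. x' i $ j * disc_metric_x p \<alpha> \<Delta> x k j i)"

section \<open>Numerical fluxes\<close>

definition two_point_fluxes ::
  "real \<Rightarrow> (state \<Rightarrow> state \<Rightarrow> state) \<Rightarrow> (3 \<Rightarrow> state \<Rightarrow> state \<Rightarrow> state) \<Rightarrow> bool"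
where
  "two_point_fluxes \<Gamma> Ut Ft \<longleftrightarrow>
     smooth_on (admissible \<Gamma> \<times> admissible \<Gamma>) (\<lambda>(a, b). Ut a b) \<and>
     (\<forall>j. smooth_on (admissible \<Gamma> \<times> admissible \<Gamma>) (\<lambda>(a, b). Ft j a b)) \<and>
     (\<forall>a\<in>admissible \<Gamma>. Ut a a = a \<and> (\<forall>j. Ft j a a = phys_flux \<Gamma> j a)) \<and>
     (\<forall>a\<in>admissible \<Gamma>. \<forall>b\<in>admissible \<Gamma>.
        Ut a b = Ut b a \<and>
        (ent_var \<Gamma> b - ent_var \<Gamma> a) \<bullet> Ut a b = phi_pot \<Gamma> b - phi_pot \<Gamma> a \<and>
        (\<forall>j. Ft j a b = Ft j b a \<and>
             (ent_var \<Gamma> b - ent_var \<Gamma> a) \<bullet> Ft j a b =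
               psi_pot \<Gamma> j b - psi_pot \<Gamma> j a
               - (1/2) * (mag a $ j + mag b $ j) * (Phi \<Gamma> b - Phi \<Gamma> a)))"

text \<open>All data a two-point flux in direction \<open>k\<close> needs at one grid point:
  \<open>(U, M\<^sub>k\<^sub>,\<^sub>t, (M\<^sub>k\<^sub>,\<^sub>x\<^sub>j)\<^sub>j)\<close>. The direction enters the fluxes only through these metric terms.\<close>

type_synonym node = "state \<times> real \<times> (real^3)"

fun flux2 ::
  "(state \<Rightarrow> state \<Rightarrow> state) \<Rightarrow> (3 \<Rightarrow> state \<Rightarrow> state \<Rightarrow> state) \<Rightarrow> node \<Rightarrow> node \<Rightarrow> state"
where
  "flux2 Ut Ft (Ul, Tl, Ml) (Ur, Tr, Mr) =
     ((1/2) * (Tl + Tr)) *\<^sub>R Ut Ul Ur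
     + (\<Sum>j\<in>UNIV. ((1/2) * (Ml $ j + Mr $ j)) *\<^sub>R Ft j Ul Ur)"

fun mag2 :: "node \<Rightarrow> node \<Rightarrow> real" where
  "mag2 (Ul, Tl, Ml) (Ur, Tr, Mr) =
     (\<Sum>j\<in>UNIV. (1/4) * (Ml $ j + Mr $ j) * (mag Ul $ j + mag Ur $ j))"

fun metric_t2 :: "node \<Rightarrow> node \<Rightarrow> real" where
  "metric_t2 (Ul, Tl, Ml) (Ur, Tr, Mr) = (1/2) * (Tl + Tr)"

fun ent_flux2 ::
  "real \<Rightarrow> (state \<Rightarrow> state \<Rightarrow> state) \<Rightarrow> (3 \<Rightarrow> state \<Rightarrow> state \<Rightarrow> state) \<Rightarrow> node \<Rightarrow> node \<Rightarrow> real"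
where
  "ent_flux2 \<Gamma> Ut Ft (Ul, Tl, Ml) (Ur, Tr, Mr) =
     (1/2) * ((ent_var \<Gamma> Ul + ent_var \<Gamma> Ur) \<bullet> flux2 Ut Ft (Ul, Tl, Ml) (Ur, Tr, Mr))
     - (1/4) * (Tl + Tr) * (phi_pot \<Gamma> Ul + phi_pot \<Gamma> Ur)
     - (\<Sum>j\<in>UNIV. (1/4) * (Ml $ j + Mr $ j) * (psi_pot \<Gamma> j Ul + psi_pot \<Gamma> j Ur))
     + (\<Sum>j\<in>UNIV. (1/8) * (Ml $ j + Mr $ j) * (mag Ul $ j + mag Ur $ j)
                   * (Phi \<Gamma> Ul + Phi \<Gamma> Ur))"

text \<open>The \<open>2p\<close>th-order flux at the interface \<open>i, k, +1/2\<close>, built from a two-point flux \<open>G\<close>.\<close>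

definition flux2p ::
  "nat \<Rightarrow> (nat \<Rightarrow> real) \<Rightarrow> 3 \<Rightarrow> (node \<Rightarrow> node \<Rightarrow> 'b::real_vector) \<Rightarrow> (index \<Rightarrow> node) \<Rightarrow> index \<Rightarrow> 'b"
where
  "flux2p p \<alpha> k G a i =
     (\<Sum>n=1..p. \<alpha> n *\<^sub>R
        (\<Sum>s=0..n-1. G (a (i + axis k (- int s))) (a (i + axis k (- int s + int n)))))"

section \<open>The scheme\<close>

definition node_data ::
  "nat \<Rightarrow> (nat \<Rightarrow> real) \<Rightarrow> real^3 \<Rightarrow> (index \<Rightarrow> real^3) \<Rightarrow> (index \<Rightarrow> real^3) \<Rightarrow> (index \<Rightarrow> state)
    \<Rightarrow> 3 \<Rightarrow> index \<Rightarrow> node"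
where
  "node_data p \<alpha> \<Delta> x x' u k i =
     (u i, disc_metric_t p \<alpha> \<Delta> x x' k i, (\<chi> j. disc_metric_x p \<alpha> \<Delta> x k j i))"

definition flux_sum ::
  "nat \<Rightarrow> (nat \<Rightarrow> real) \<Rightarrow> real^3 \<Rightarrow> (node \<Rightarrow> node \<Rightarrow> 'b::real_vector) \<Rightarrow> (3 \<Rightarrow> index \<Rightarrow> node)
    \<Rightarrow> index \<Rightarrow> 'b"
where
  "flux_sum p \<alpha> \<Delta> G a i =
     (\<Sum>k\<in>UNIV. (1 / \<Delta> $ k) *\<^sub>R
        (flux2p p \<alpha> k G (a k) i - flux2p p \<alpha> k G (a k) (i + axis k (-1))))"

text \<open>The right-hand sides for \<open>J U\<close> and \<open>J\<close>, given the positions \<open>x\<close> and the velocities \<open>x'\<close> of the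
  grid points and the states \<open>u\<close>.\<close>

definition rhs_U ::
  "real \<Rightarrow> (state \<Rightarrow> state \<Rightarrow> state) \<Rightarrow> (3 \<Rightarrow> state \<Rightarrow> state \<Rightarrow> state) \<Rightarrow> nat \<Rightarrow> (nat \<Rightarrow> real)
    \<Rightarrow> real^3 \<Rightarrow> (index \<Rightarrow> real^3) \<Rightarrow> (index \<Rightarrow> real^3) \<Rightarrow> (index \<Rightarrow> state) \<Rightarrow> index \<Rightarrow> state"
where
  "rhs_U \<Gamma> Ut Ft p \<alpha> \<Delta> x x' u i =
     - flux_sum p \<alpha> \<Delta> (flux2 Ut Ft) (node_data p \<alpha> \<Delta> x x' u) i
     - flux_sum p \<alpha> \<Delta> mag2 (node_data p \<alpha> \<Delta> x x' u) i *\<^sub>R grad_Phi \<Gamma> (u i)"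

definition rhs_J ::
  "nat \<Rightarrow> (nat \<Rightarrow> real) \<Rightarrow> real^3 \<Rightarrow> (index \<Rightarrow> real^3) \<Rightarrow> (index \<Rightarrow> real^3) \<Rightarrow> (index \<Rightarrow> state)
    \<Rightarrow> index \<Rightarrow> real"
where
  "rhs_J p \<alpha> \<Delta> x x' u i = - flux_sum p \<alpha> \<Delta> metric_t2 (node_data p \<alpha> \<Delta> x x' u) i"

text \<open>A solution on the time interval \<open>T\<close>: \<open>J\<close>, \<open>u\<close>, \<open>x\<close>, \<open>x'\<close> give the Jacobians, states, positions
  and velocities at every time and grid index. The grid motion is prescribed, not computed.\<close>

definition scheme_solution ::
  "real \<Rightarrow> (state \<Rightarrow> state \<Rightarrow> state) \<Rightarrow> (3 \<Rightarrow> state \<Rightarrow> state \<Rightarrow> state) \<Rightarrow> nat \<Rightarrow> (nat \<Rightarrow> real)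
    \<Rightarrow> real^3 \<Rightarrow> real set \<Rightarrow> (real \<Rightarrow> index \<Rightarrow> real) \<Rightarrow> (real \<Rightarrow> index \<Rightarrow> state)
    \<Rightarrow> (real \<Rightarrow> index \<Rightarrow> real^3) \<Rightarrow> (real \<Rightarrow> index \<Rightarrow> real^3) \<Rightarrow> bool"
where
  "scheme_solution \<Gamma> Ut Ft p \<alpha> \<Delta> T J u x x' \<longleftrightarrow>
     (\<forall>t\<in>T. \<forall>i.
        J t i > 0 \<and> u t i \<in> admissible \<Gamma> \<and>
        ((\<lambda>s. x s i) has_vector_derivative x' t i) (at t within T) \<and>
        ((\<lambda>s. J s i *\<^sub>R u s i) has_vector_derivative
           rhs_U \<Gamma> Ut Ft p \<alpha> \<Delta> (x t) (x' t) (u t) i) (at t within T) \<and>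
        ((\<lambda>s. J s i) has_real_derivative rhs_J p \<alpha> \<Delta> (x t) (x' t) (u t) i) (at t within T))"

end

(* Entropy conservation is an algebraic identity once d/dt eta(U) = V . dU/dt is known: multiply the
   scheme by V, use the defining relations of the two-point fluxes, and observe that the terms left
   over are discrete derivatives of the metrics, which cancel since difference operators commute.
   The chain rule, and the fact that the conservative variables determine the primitive ones, both
   follow from the explicit nonnegative form of the relative entropy
   eta(b) - eta(a) - V(a) . (U(b) - U(a)).

   For the accuracy, telescoping turns flux differences into sums of central differences along grid
   lines. The metrics that enter them are themselves discrete, with an error that is divided by the
   step size once more; hence the error is estimated together with its derivatives. *)

theory Submission
  imports Defs
begin

section \<open>Relative entropy of primitive states\<close>

text \<open>The primitive variables are only implicit functions of the conservative ones, and the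
  proof avoids differentiating them. Invariance of domain upgrades injectivity of
  \<open>cons_of\<close> to continuity of its inverse, hence of \<open>ent_var\<close>; with the
  subgradient inequality at both ends of an increment, continuity is all that the chain rule for
  \<open>eta\<close> asks for.

  On the accuracy side, a metric error of size h^(2p) is differenced and divided by h, and a bound
  on its values at grid points alone would lose one order. The discrete metrics are therefore
  extended to all of space-time by the same central quotients. The error becomes a differentiable
  function, and since quotients are combinations of translates and commute with differentiation, its
  derivatives have size h^(2p) too. Every nested quotient spends one derivative, so bounds of
  arbitrary order are carried along. The three steps may shrink at unrelated rates: all errors are
  measured by the norm of the step vector, and each division by a step is compensated by a factor of
  the same step.\<close>

lemma lorentz_props:
  assumes "norm v < 1"
  shows "lorentz v \<ge> 1" "(lorentz v)\<^sup>2 * (1 - v \<bullet> v) = 1" "1 / (lorentz v)\<^sup>2 = 1 - v \<bullet> v"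
proof -
  have "0 < 1 - (norm v)\<^sup>2" using assms by (simp add: power_less_one_iff)
  moreover have "1 - (norm v)\<^sup>2 \<le> 1" by simp
  moreover have "(norm v)\<^sup>2 = v \<bullet> v" by (simp add: power2_norm_eq_inner)
  ultimately show "lorentz v \<ge> 1" "(lorentz v)\<^sup>2 * (1 - v \<bullet> v) = 1"
    "1 / (lorentz v)\<^sup>2 = 1 - v \<bullet> v"
    by (auto simp: lorentz_def power_divide)
qed

text \<open>\<open>eta\<close> and \<open>ent_var\<close> go through the description
  \<open>prim_of\<close>, whose properness is itself a consequence of the estimates on the relative
  entropy. These estimates therefore have to be made in primitive coordinates.\<close>

fun prim_entropy :: "real \<Rightarrow> primitive \<Rightarrow> real" where
  "prim_entropy \<Gamma> (\<rho>, v, p, B) = - (\<rho> * lorentz v * ln (p / \<rho> powr \<Gamma>)) / (\<Gamma> - 1)"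

fun prim_ent_var :: "real \<Rightarrow> primitive \<Rightarrow> state" where
  "prim_ent_var \<Gamma> (\<rho>, v, p, B) =
    ((\<Gamma> - ln (p / \<rho> powr \<Gamma>)) / (\<Gamma> - 1) + \<rho> / p,
     (\<rho> * lorentz v / p) *\<^sub>R v,
     - (\<rho> * lorentz v / p),
     (\<rho> / (p * lorentz v)) *\<^sub>R (B + ((lorentz v)\<^sup>2 * (v \<bullet> B)) *\<^sub>R v))"

lemma eta_prim: "eta \<Gamma> U = prim_entropy \<Gamma> (prim_of \<Gamma> U)"
  by (cases "prim_of \<Gamma> U")
    (simp add: eta_def dens_def vel_def spec_entropy_def p_gas_def)

text \<open>The Bregman divergence of the entropy with base point \<open>a\<close>.
  \<open>prim_ent_var\<close> is here only a candidate for the gradient; nonnegativity below shows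
  that it is a subgradient.\<close>

definition rel_entropy :: "real \<Rightarrow> primitive \<Rightarrow> primitive \<Rightarrow> real" where
  "rel_entropy \<Gamma> a b = prim_entropy \<Gamma> b - prim_entropy \<Gamma> a
     - prim_ent_var \<Gamma> a \<bullet> (cons_of \<Gamma> b - cons_of \<Gamma> a)"

text \<open>The last two summands are the squared norm of the cross product of \<open>v - v'\<close> and \<open>B'\<close>.\<close>

definition rel_mag :: "primitive \<Rightarrow> primitive \<Rightarrow> real" where
  "rel_mag = (\<lambda>(\<rho>, v, p, B) (\<rho>', v', p', B').
     ((B - B') \<bullet> (B - B')) * (1 - v \<bullet> v) + (v \<bullet> (B - B'))\<^sup>2
     + (((v - v') \<bullet> (v - v')) * (B' \<bullet> B') - ((v - v') \<bullet> B')\<^sup>2))"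

text \<open>The share of the matter, per unit of the conserved density of the second state. The
  product \<open>lorentz v * lorentz v' * (1 - v \<bullet> v')\<close> is the Lorentz factor of the
  relative velocity.\<close>

definition rel_fluid :: "real \<Rightarrow> primitive \<Rightarrow> primitive \<Rightarrow> real" where
  "rel_fluid \<Gamma> = (\<lambda>(\<rho>, v, p, B) (\<rho>', v', p', B').
     ln (p / \<rho> powr \<Gamma>) / (\<Gamma> - 1) - ln (p' / \<rho>' powr \<Gamma>) / (\<Gamma> - 1) - \<Gamma> / (\<Gamma> - 1) - \<rho> / p
     + \<rho> / p * enthalpy \<Gamma> \<rho>' p' * (lorentz v * lorentz v' * (1 - v \<bullet> v'))
     + lorentz v / lorentz v' * (\<rho> / \<rho>' - (\<rho> / p) * (p' / \<rho>')))"

text \<open>The momentum, energy and magnetic components all carry the factor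
  \<open>\<rho> * lorentz v / p\<close>, once \<open>1 / lorentz v\<close> in the last one is
  rewritten as \<open>lorentz v * (1 - v \<bullet> v)\<close>. This separates matter from field: the
  last bracket contains only velocities and magnetic fields.\<close>

lemma prim_pairing:
  fixes v B :: "real^3"
  assumes "norm v < 1" "norm v' < 1" "\<rho> > 0" "p > 0" "\<rho>' > 0" "p' > 0" "\<Gamma> > 1"
  shows "prim_ent_var \<Gamma> (\<rho>, v, p, B) \<bullet> cons_of \<Gamma> (\<rho>', v', p', B')
    = ((\<Gamma> - ln (p / \<rho> powr \<Gamma>)) / (\<Gamma> - 1) + \<rho> / p) * (\<rho>' * lorentz v')
      - \<rho> * lorentz v / p * (\<rho>' * enthalpy \<Gamma> \<rho>' p' * (lorentz v')\<^sup>2 * (1 - v \<bullet> v') - p')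
      - \<rho> * lorentz v / p * (B' \<bullet> B' - (B' \<bullet> B' * (1 - v' \<bullet> v') + (v' \<bullet> B')\<^sup>2) / 2
          - (B' \<bullet> B') * (v \<bullet> v') + (v' \<bullet> B') * (v \<bullet> B') - B \<bullet> B' * (1 - v \<bullet> v) - (v \<bullet> B) * (v \<bullet> B'))"
proof -
  define W where "W = lorentz v"
  define W' where "W' = lorentz v'"
  define s where "s = ln (p / \<rho> powr \<Gamma>)"
  define h where "h = enthalpy \<Gamma> \<rho>' p'"
  have W: "W > 0" and W2: "W\<^sup>2 * (1 - v \<bullet> v) = 1" 
    using lorentz_props[OF assms(1)] unfolding W_def 
    by (auto simp: power2_norm_eq_inner divide_inverse)
  define q where "q = B' \<bullet> B' * (1 - v' \<bullet> v') + (v' \<bullet> B')\<^sup>2"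
  have W3: "b_sq v' B' = q"
    using lorentz_props[OF assms(2)] unfolding b_sq_def q_def
    by (auto simp: power2_norm_eq_inner divide_inverse)
  have f1: "prim_ent_var \<Gamma> (\<rho>, v, p, B) \<bullet> cons_of \<Gamma> (\<rho>', v', p', B')
      = ((\<Gamma> - s) / (\<Gamma> - 1) + \<rho> / p) * (\<rho>' * W')
        + \<rho> * W / p * ((\<rho>' * h * W'\<^sup>2 + B' \<bullet> B') * (v \<bullet> v') - (v' \<bullet> B') * (v \<bullet> B'))
        - \<rho> * W / p * (\<rho>' * h * W'\<^sup>2 - (p' + q / 2) + B' \<bullet> B')
        + \<rho> / (p * W) * (B \<bullet> B' + W\<^sup>2 * (v \<bullet> B) * (v \<bullet> B'))"
    unfolding prim_ent_var.simps cons_of.simps Let_def inner_prod_def inner_scaleR_left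
       inner_scaleR_right inner_diff_right inner_add_left p_tot_def W3 power2_norm_eq_inner
    by (simp add: W_def[symmetric] W'_def[symmetric] s_def[symmetric] h_def[symmetric] 
        power2_eq_square algebra_simps)
  have f2: "\<rho> / (p * W) * (B \<bullet> B' + W\<^sup>2 * (v \<bullet> B) * (v \<bullet> B'))
     = \<rho> * W / p * (B \<bullet> B' * (1 - v \<bullet> v) + (v \<bullet> B) * (v \<bullet> B'))"
  proof -
    have *: "1 / W = W * (1 - v \<bullet> v)" using W2 W by (simp add: power2_eq_square field_simps)
    have "\<rho> / (p * W) * (B \<bullet> B' + W\<^sup>2 * (v \<bullet> B) * (v \<bullet> B'))
      = \<rho> / p * (1 / W) * (B \<bullet> B') + \<rho> * W / p * (v \<bullet> B) * (v \<bullet> B')"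
      using W(1) by (simp add: distrib_left power2_eq_square)
    then show ?thesis unfolding * by (simp only:) (simp add: algebra_simps)
  qed
  show ?thesis
    unfolding f1 f2 W_def[symmetric] W'_def[symmetric] h_def[symmetric] s_def[symmetric] q_def[symmetric]
    by (simp add: algebra_simps)
qed

text \<open>This is \<open>phi_pot\<close> in primitive coordinates. In the diagonal case of the
  pairing the logarithms cancel against the entropy, and the magnetic bracket collapses to half of
  \<open>b_sq\<close>.\<close>

lemma prim_potential:
  fixes v B :: "real^3"
  assumes "norm v < 1" "\<rho> > 0" "p > 0" "\<Gamma> > 1"
  shows "prim_ent_var \<Gamma> (\<rho>, v, p, B) \<bullet> cons_of \<Gamma> (\<rho>, v, p, B) - prim_entropy \<Gamma> (\<rho>, v, p, B)
    = \<rho> * lorentz v * (1 + ((B \<bullet> B) * (1 - v \<bullet> v) + (v \<bullet> B)\<^sup>2) / (2 * p))"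
proof -
  define W where "W = lorentz v"
  define s where "s = ln (p / \<rho> powr \<Gamma>)"
  define h where "h = enthalpy \<Gamma> \<rho> p"
  define q where "q = (B \<bullet> B) * (1 - v \<bullet> v) + (v \<bullet> B)\<^sup>2"
  define X where "X = \<rho> * W / p"
  have W2: "\<rho> * h * W\<^sup>2 * (1 - v \<bullet> v) = \<rho> * h"
    using lorentz_props[OF assms(1)] unfolding W_def by (simp add: mult.assoc)
  have hh: "\<rho> * h = \<rho> + \<Gamma> / (\<Gamma> - 1) * p" using assms unfolding h_def enthalpy_def by (simp add: field_simps)
  have R: "B \<bullet> B - q / 2 - (B \<bullet> B) * (v \<bullet> v) + (v \<bullet> B) * (v \<bullet> B) - B \<bullet> B * (1 - v \<bullet> v) - (v \<bullet> B) * (v \<bullet> B) = - (q / 2)"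
    by (simp add: algebra_simps)
  have 1: "X * p = \<rho> * W" "\<rho> / p * (\<rho> * W) = X * \<rho>" "X * (q / 2) = \<rho> * W * (q / (2 * p))"
    using assms(3) unfolding X_def by auto
  have "prim_ent_var \<Gamma> (\<rho>, v, p, B) \<bullet> cons_of \<Gamma> (\<rho>, v, p, B)
    = ((\<Gamma> - s) / (\<Gamma> - 1) + \<rho> / p) * (\<rho> * W) - X * (\<rho> + \<Gamma> / (\<Gamma> - 1) * p - p) - X * (- (q / 2))"
    using prim_pairing[OF assms(1,1,2,3,2,3,4), of B B]
    unfolding W_def[symmetric] s_def[symmetric] h_def[symmetric] q_def[symmetric] X_def[symmetric] W2 R unfolding hh .
  also have "\<dots> = (\<Gamma> / (\<Gamma> - 1) - s / (\<Gamma> - 1)) * (\<rho> * W) + \<rho> / p * (\<rho> * W)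
        - X * \<rho> - \<Gamma> / (\<Gamma> - 1) * (X * p) + X * p + X * (q / 2)"
    by (simp add: diff_divide_distrib algebra_simps)
  also have "\<dots> = - (\<rho> * W * s) / (\<Gamma> - 1) + \<rho> * W * (1 + q / (2 * p))"
    unfolding 1 by (simp add: algebra_simps)
  finally show ?thesis by (simp add: W_def[symmetric] s_def[symmetric] q_def[symmetric])
qed

text \<open>The magnetic contribution of the potential at the base point and that of the pairing
  share the factor \<open>\<rho> * lorentz v / (2 * p)\<close>; together they form the quadratic
  expression \<open>rel_mag\<close>. Everything else is proportional to
  \<open>\<rho>' * lorentz v'\<close>.\<close>

lemma rel_entropy_split:
  fixes v B :: "real^3"
  assumes "norm v < 1" "norm v' < 1" "\<rho> > 0" "p > 0" "\<rho>' > 0" "p' > 0" "\<Gamma> > 1"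
  shows "rel_entropy \<Gamma> (\<rho>, v, p, B) (\<rho>', v', p', B')
    = \<rho>' * lorentz v' * rel_fluid \<Gamma> (\<rho>, v, p, B) (\<rho>', v', p', B')
      + \<rho> * lorentz v / (2 * p) * rel_mag (\<rho>, v, p, B) (\<rho>', v', p', B')"
proof -
  define W where "W = lorentz v"
  define W' where "W' = lorentz v'"
  define s where "s = ln (p / \<rho> powr \<Gamma>)"
  define s' where "s' = ln (p' / \<rho>' powr \<Gamma>)"
  define h where "h = enthalpy \<Gamma> \<rho>' p'"
  have W: "W > 0" "W' > 0"
    using lorentz_props[OF assms(1)] lorentz_props[OF assms(2)] unfolding W_def W'_def by auto
  define Q where "Q = (B \<bullet> B) * (1 - v \<bullet> v) + (v \<bullet> B)\<^sup>2"
  define R where "R = B' \<bullet> B' - (B' \<bullet> B' * (1 - v' \<bullet> v') + (v' \<bullet> B')\<^sup>2) / 2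
          - (B' \<bullet> B') * (v \<bullet> v') + (v' \<bullet> B') * (v \<bullet> B') - B \<bullet> B' * (1 - v \<bullet> v) - (v \<bullet> B) * (v \<bullet> B')"
  have mag: "rel_mag (\<rho>, v, p, B) (\<rho>', v', p', B') = Q + 2 * R"
  proof -
    define q where "q = B' \<bullet> B' * (1 - v' \<bullet> v') + (v' \<bullet> B')\<^sup>2"
    have "2 * R = 2 * (B' \<bullet> B') - q
          - 2 * ((B' \<bullet> B') * (v \<bullet> v')) + 2 * ((v' \<bullet> B') * (v \<bullet> B'))
          - 2 * (B \<bullet> B' * (1 - v \<bullet> v)) - 2 * ((v \<bullet> B) * (v \<bullet> B'))"
      unfolding R_def q_def[symmetric] by simp
    then show ?thesis unfolding rel_mag_def Q_def q_def
      by (simp add: inner_commute power2_eq_square algebra_simps)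
  qed
  have "rel_entropy \<Gamma> (\<rho>, v, p, B) (\<rho>', v', p', B')
    = prim_entropy \<Gamma> (\<rho>', v', p', B') + \<rho> * W * (1 + Q / (2 * p))
      - (((\<Gamma> - s) / (\<Gamma> - 1) + \<rho> / p) * (\<rho>' * W')
      - \<rho> * W / p * (\<rho>' * h * W'\<^sup>2 * (1 - v \<bullet> v') - p') - \<rho> * W / p * R)"
    using prim_potential[OF assms(1,3,4,7), of B] prim_pairing[OF assms, of B B']
    unfolding rel_entropy_def inner_diff_right W_def W'_def h_def s_def Q_def R_def by linarith
  also have "\<dots> = \<rho>' * W' * (s / (\<Gamma> - 1) - s' / (\<Gamma> - 1) - \<Gamma> / (\<Gamma> - 1) - \<rho> / p
     + \<rho> / p * h * (W * W' * (1 - v \<bullet> v'))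
     + W / W' * (\<rho> / \<rho>' - (\<rho> / p) * (p' / \<rho>'))) + \<rho> * W / (2 * p) * (Q + 2 * R)"
  proof -
    have 1: "\<rho>' * W' * (W / W' * (\<rho> / \<rho>' - (\<rho> / p) * (p' / \<rho>'))) = \<rho> * W - \<rho> * W / p * p'"
      using assms(3-7) W by (simp add: field_simps)
    have 2: "\<rho> * W / (2 * p) * (Q + 2 * R) = \<rho> * W * (Q / (2 * p)) + \<rho> * W / p * R"
      using assms(3-7) by (simp add: field_simps)
    show ?thesis
      unfolding 2 distrib_left[of "\<rho>' * W'" _ "W / W' * (\<rho> / \<rho>' - (\<rho> / p) * (p' / \<rho>'))"] 1
      by (simp add: s'_def[symmetric] W'_def[symmetric] diff_divide_distrib power2_eq_square algebra_simps)
  qed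
  finally show ?thesis
    by (simp only: mag rel_fluid_def split W_def W'_def s_def s'_def h_def)
qed

text \<open>By polarization, \<open>1 - v \<bullet> w\<close> is half the sum of
  \<open>1 - v \<bullet> v\<close>, \<open>1 - w \<bullet> w\<close> and the squared distance of the
  velocities. Multiplied by both Lorentz factors, the first two terms give the mean of
  \<open>\<omega>\<close> and \<open>1 / \<omega>\<close>, which is at least 1, and the third is
  nonnegative and vanishes only for equal velocities. The sharper bound by the mean is needed for
  the fluid part, where \<open>\<gamma> \<ge> 1\<close> alone would not absorb a term in
  \<open>\<omega>\<close>.\<close>

lemma lorentz_relative:
  fixes v w :: "real^3"
  assumes "norm v < 1" "norm w < 1"
  defines "\<gamma> \<equiv> lorentz v * lorentz w * (1 - v \<bullet> w)"
    and "\<omega> \<equiv> lorentz v / lorentz w"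
  shows "\<gamma> \<ge> (\<omega> + 1 / \<omega>) / 2" "\<gamma> \<ge> 1" "\<gamma> = 1 \<Longrightarrow> v = w"
proof -
  define W where "W = lorentz v"
  define Z where "Z = lorentz w"
  have W: "W \<ge> 1" "W\<^sup>2 * (1 - v \<bullet> v) = 1" using lorentz_props[OF assms(1)] by (auto simp: W_def)
  have Z: "Z \<ge> 1" "Z\<^sup>2 * (1 - w \<bullet> w) = 1" using lorentz_props[OF assms(2)] by (auto simp: Z_def)
  have "1 - v \<bullet> w = ((1 - v \<bullet> v) + (1 - w \<bullet> w) + (v - w) \<bullet> (v - w)) / 2"
    by (simp add: inner_diff_left inner_diff_right inner_commute)
  moreover have "1 - v \<bullet> v = 1 / W\<^sup>2" "1 - w \<bullet> w = 1 / Z\<^sup>2" using W Z by (auto simp: field_simps)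
  ultimately have "\<gamma> = W * Z * (1 / W\<^sup>2 + 1 / Z\<^sup>2 + (v - w) \<bullet> (v - w)) / 2"
    unfolding \<gamma>_def W_def Z_def by simp
  also have "\<dots> = (\<omega> + 1 / \<omega>) / 2 + W * Z * ((v - w) \<bullet> (v - w)) / 2"
    using less_le_trans[OF zero_less_one W(1)] less_le_trans[OF zero_less_one Z(1)]
    unfolding \<omega>_def W_def[symmetric] Z_def[symmetric]
    by (simp add: field_simps power2_eq_square)
  finally have g: "\<gamma> = (\<omega> + 1 / \<omega>) / 2 + W * Z * ((v - w) \<bullet> (v - w)) / 2" .
  have om: "\<omega> > 0" unfolding \<omega>_def W_def[symmetric] Z_def[symmetric] using W Z by simp
  have "\<omega> + 1 / \<omega> - 2 = (\<omega> - 1)\<^sup>2 / \<omega>" using om by (simp add: field_simps power2_eq_square)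
  then have "\<omega> + 1 / \<omega> - 2 \<ge> 0" by (simp only: divide_nonneg_pos[OF zero_le_power2 om])
  then have 2: "(\<omega> + 1 / \<omega>) / 2 \<ge> 1" by simp
  have nn: "W * Z * ((v - w) \<bullet> (v - w)) / 2 \<ge> 0" using W Z by simp
  show "\<gamma> \<ge> (\<omega> + 1 / \<omega>) / 2" using g nn by linarith
  show "\<gamma> \<ge> 1" using g nn 2 by linarith
  assume "\<gamma> = 1"
  then have "W * Z * ((v - w) \<bullet> (v - w)) = 0" using g nn 2 by linarith
  then show "v = w" using W Z by auto
qed

lemma ln_gap: "x - 1 - ln x \<ge> 0" "x - 1 - ln x = 0 \<Longrightarrow> x = 1" if "x > 0" for x :: real
  using that ln_le_minus_one[of x] ln_eq_minus_one[of x] by auto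

text \<open>In terms of the ratios \<open>r\<close> of densities, \<open>y\<close> of temperatures
  and \<open>\<omega>\<close> of Lorentz factors, the expression is a sum of six nonnegative terms:
  logarithmic gaps \<open>x - 1 - ln x\<close> and multiples of the two bounds on
  \<open>\<gamma>\<close>. If the sum is zero, then \<open>\<gamma> = 1\<close> gives equal
  velocities and \<open>\<omega> = 1\<close>, after which two of the gaps force \<open>r = 1\<close>
  and \<open>y = 1\<close>.\<close>

lemma rel_fluid_nonneg:
  fixes v v' :: "real^3"
  assumes "norm v < 1" "norm v' < 1" "\<rho> > 0" "p > 0" "\<rho>' > 0" "p' > 0" "1 < \<Gamma>" "\<Gamma> \<le> 2"
  shows "rel_fluid \<Gamma> (\<rho>, v, p, B) (\<rho>', v', p', B') \<ge> 0"
    and "rel_fluid \<Gamma> (\<rho>, v, p, B) (\<rho>', v', p', B') = 0 \<Longrightarrow> \<rho> = \<rho>' \<and> v = v' \<and> p = p'"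
proof -
  define \<gamma> where "\<gamma> = lorentz v * lorentz v' * (1 - v \<bullet> v')"
  define \<omega> where "\<omega> = lorentz v / lorentz v'"
  define y where "y = (\<rho> / p) * (p' / \<rho>')"
  define r where "r = \<rho> / \<rho>'"
  define c where "c = 1 / (\<Gamma> - 1)"
  note lr = lorentz_relative[OF assms(1,2), folded \<gamma>_def \<omega>_def]
  \<comment> \<open>the only place where \<open>\<Gamma> \<le> 2\<close> is needed\<close>
  have c: "c \<ge> 1" using assms by (simp add: c_def)
  have pos: "\<omega> > 0" "y > 0" "r > 0"
    using lorentz_props[OF assms(1)] lorentz_props[OF assms(2)] assms
    by (auto simp: \<omega>_def y_def r_def)
  have G: "\<Gamma> / (\<Gamma> - 1) = 1 + c" using assms unfolding c_def by (simp add: field_simps)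
  have lny: "ln y = ln \<rho> - ln p + ln p' - ln \<rho>'" and lnr: "ln r = ln \<rho> - ln \<rho>'"
    using assms by (auto simp: y_def r_def ln_mult ln_div)
  have e: "\<rho> / p * enthalpy \<Gamma> \<rho>' p' = \<rho> / p + (1 + c) * y"
    using assms(3-6) unfolding enthalpy_def G y_def by (simp add: field_simps)
  have "rel_fluid \<Gamma> (\<rho>, v, p, B) (\<rho>', v', p', B') =
      (ln p - \<Gamma> * ln \<rho>) * c - (ln p' - \<Gamma> * ln \<rho>') * c - (1 + c) - \<rho> / p
      + (\<rho> / p + (1 + c) * y) * \<gamma> + \<omega> * (r - y)"
    using assms unfolding rel_fluid_def split e G \<gamma>_def[symmetric] \<omega>_def[symmetric]
      r_def[symmetric] y_def[symmetric] c_def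
    by (simp add: ln_div ln_powr)
  also have "(ln p - \<Gamma> * ln \<rho>) * c - (ln p' - \<Gamma> * ln \<rho>') * c = - c * ln y - (c * (\<Gamma> - 1)) * ln r"
    unfolding lny lnr by (simp add: algebra_simps)
  also have "c * (\<Gamma> - 1) = 1" using assms by (simp add: c_def)
  finally have F: "rel_fluid \<Gamma> (\<rho>, v, p, B) (\<rho>', v', p', B') =
      - c * ln y - ln r - (1 + c) - \<rho> / p + (\<rho> / p + (1 + c) * y) * \<gamma> + \<omega> * (r - y)" by simp
  have l1: "ln (\<omega> * r) = ln \<omega> + ln r" "ln (y / \<omega>) = ln y - ln \<omega>"
    using pos by (auto simp: ln_mult ln_div)
  have "rel_fluid \<Gamma> (\<rho>, v, p, B) (\<rho>', v', p', B') =
      (\<omega> * r - 1 - ln (\<omega> * r)) + (\<rho> / p) * (\<gamma> - 1) + (c - 1) * (y - 1 - ln y)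
      + c * y * (\<gamma> - 1) + y * (\<gamma> - 1) + (2 * y - \<omega> * y - 1 - ln y + ln \<omega>)"
    unfolding F l1 by (simp add: diff_divide_distrib algebra_simps)
  \<comment> \<open>The term \<open>- \<omega> * y\<close> has the wrong sign. Two of the
    \<open>c + 1\<close> copies of \<open>y * \<gamma>\<close> are set aside for it: they exceed
    \<open>\<omega> * y\<close> by at least \<open>y / \<omega>\<close>, which then completes a
    logarithmic gap. The other \<open>c - 1\<close> copies are nonnegative because
    \<open>c \<ge> 1\<close>.\<close>
  also have "\<dots> = (\<omega> * r - 1 - ln (\<omega> * r)) + (\<rho> / p) * (\<gamma> - 1) + (c - 1) * (y - 1 - ln y)
      + (c - 1) * (y * (\<gamma> - 1)) + 2 * y * (\<gamma> - (\<omega> + 1 / \<omega>) / 2) + (y / \<omega> - 1 - ln (y / \<omega>))"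
  proof -
    have *: "2 * y * (\<gamma> - (\<omega> + 1 / \<omega>) / 2) = 2 * y * \<gamma> - y * \<omega> - y / \<omega>"
      using pos by (simp add: field_simps)
    show ?thesis unfolding l1 * by (simp add: algebra_simps)
  qed
  finally have F2: "rel_fluid \<Gamma> (\<rho>, v, p, B) (\<rho>', v', p', B') =
      (\<omega> * r - 1 - ln (\<omega> * r)) + (\<rho> / p) * (\<gamma> - 1) + (c - 1) * (y - 1 - ln y)
      + (c - 1) * (y * (\<gamma> - 1)) + 2 * y * (\<gamma> - (\<omega> + 1 / \<omega>) / 2) + (y / \<omega> - 1 - ln (y / \<omega>))" .
  have t1: "\<omega> * r - 1 - ln (\<omega> * r) \<ge> 0" using pos by (intro ln_gap) auto
  have t2: "(\<rho> / p) * (\<gamma> - 1) \<ge> 0" using lr assms by simp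
  have t3: "(c - 1) * (y - 1 - ln y) \<ge> 0" using c pos ln_gap(1)[of y] by simp
  have t4: "(c - 1) * (y * (\<gamma> - 1)) \<ge> 0" using c pos lr by simp
  have t5: "2 * y * (\<gamma> - (\<omega> + 1 / \<omega>) / 2) \<ge> 0" using pos lr by simp
  have t6: "y / \<omega> - 1 - ln (y / \<omega>) \<ge> 0" using pos by (intro ln_gap) auto
  show "rel_fluid \<Gamma> (\<rho>, v, p, B) (\<rho>', v', p', B') \<ge> 0" using F2 t1 t2 t3 t4 t5 t6 by linarith
  assume 0: "rel_fluid \<Gamma> (\<rho>, v, p, B) (\<rho>', v', p', B') = 0"
  have "(\<rho> / p) * (\<gamma> - 1) = 0" using F2 t1 t2 t3 t4 t5 t6 0 by linarith
  then have "\<gamma> = 1" using assms by simp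
  then have v: "v = v'" using lr by simp
  then have om: "\<omega> = 1" unfolding \<omega>_def using lorentz_props[OF assms(2)] by auto
  have "\<omega> * r - 1 - ln (\<omega> * r) = 0" using F2 t1 t2 t3 t4 t5 t6 0 by linarith
  then have r: "r = 1" using ln_gap(2)[of r] pos om by simp
  have "y / \<omega> - 1 - ln (y / \<omega>) = 0" using F2 t1 t2 t3 t4 t5 t6 0 by linarith
  then have y: "y = 1" using ln_gap(2)[of y] pos om by simp
  show "\<rho> = \<rho>' \<and> v = v' \<and> p = p'" using v r y assms by (auto simp: r_def y_def)
qed

lemma rel_mag_nonneg:
  fixes v v' :: "real^3"
  assumes "norm v < 1" 
  shows "rel_mag (\<rho>, v, p, B) (\<rho>', v', p', B') \<ge> 0"
    and "rel_mag (\<rho>, v, p, B) (\<rho>', v', p', B') = 0 \<Longrightarrow> B = B'"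
proof -
  have "1 - v \<bullet> v > 0" using assms lorentz_props[OF assms]
    by (smt (verit) divide_pos_pos zero_less_power2 zero_less_one)
  then have 1: "((B - B') \<bullet> (B - B')) * (1 - v \<bullet> v) \<ge> 0"
    "((B - B') \<bullet> (B - B')) * (1 - v \<bullet> v) = 0 \<Longrightarrow> B = B'" by auto
  have 2: "((v - v') \<bullet> (v - v')) * (B' \<bullet> B') - ((v - v') \<bullet> B')\<^sup>2 \<ge> 0"
    using Cauchy_Schwarz_ineq[of "v - v'" B'] by simp
  have 3: "(v \<bullet> (B - B'))\<^sup>2 \<ge> 0" by simp
  show "rel_mag (\<rho>, v, p, B) (\<rho>', v', p', B') \<ge> 0" using 1(1) 2 3 unfolding rel_mag_def split by linarith
  assume "rel_mag (\<rho>, v, p, B) (\<rho>', v', p', B') = 0"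
  then have "((B - B') \<bullet> (B - B')) * (1 - v \<bullet> v) = 0" using 1(1) 2 3 unfolding rel_mag_def split by linarith
  then show "B = B'" using 1 by simp
qed

lemma rel_entropy_nonneg:
  assumes "a \<in> prim_states" "b \<in> prim_states" "1 < \<Gamma>" "\<Gamma> \<le> 2"
  shows "rel_entropy \<Gamma> a b \<ge> 0" and "rel_entropy \<Gamma> a b = 0 \<Longrightarrow> a = b"
proof -
  obtain \<rho> v p B where a: "a = (\<rho>, v, p, B)" by (cases a)
  obtain \<rho>' v' p' B' where b: "b = (\<rho>', v', p', B')" by (cases b)
  have st: "norm v < 1" "norm v' < 1" "\<rho> > 0" "p > 0" "\<rho>' > 0" "p' > 0"
    using assms by (auto simp: a b prim_states_def)
  have W: "lorentz v > 0" "lorentz v' > 0" 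
    using lorentz_props[OF st(1)] lorentz_props[OF st(2)] by auto
  note split = rel_entropy_split[OF st assms(3), of B B']
  note fl = rel_fluid_nonneg[OF st assms(3,4), of B B']
  note mg = rel_mag_nonneg[OF st(1), of \<rho> p B \<rho>' v' p' B']
  have 1: "\<rho>' * lorentz v' * rel_fluid \<Gamma> (\<rho>, v, p, B) (\<rho>', v', p', B') \<ge> 0"
    using fl st W by simp
  have 2: "\<rho> * lorentz v / (2 * p) * rel_mag (\<rho>, v, p, B) (\<rho>', v', p', B') \<ge> 0"
    using mg st W by simp
  show "rel_entropy \<Gamma> a b \<ge> 0" using split 1 2 by (simp add: a b)
  assume "rel_entropy \<Gamma> a b = 0"
  then have "\<rho>' * lorentz v' * rel_fluid \<Gamma> (\<rho>, v, p, B) (\<rho>', v', p', B') = 0"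
    "\<rho> * lorentz v / (2 * p) * rel_mag (\<rho>, v, p, B) (\<rho>', v', p', B') = 0"
    using split 1 2 unfolding a b by linarith+
  then show "a = b" using fl mg st W by (auto simp: a b)
qed

text \<open>If the conservative vectors agree, the linear terms vanish and the divergences in the
  two orders are negatives of each other; being nonnegative, both are zero.\<close>

lemma cons_of_inj:
  assumes "1 < \<Gamma>" "\<Gamma> \<le> 2"
  shows "inj_on (cons_of \<Gamma>) prim_states"
proof (rule inj_onI)
  fix a b assume ab: "a \<in> prim_states" "b \<in> prim_states" "cons_of \<Gamma> a = cons_of \<Gamma> b"
  have "rel_entropy \<Gamma> a b + rel_entropy \<Gamma> b a = 0"
    unfolding rel_entropy_def ab by simp
  then have "rel_entropy \<Gamma> a b = 0"
    using rel_entropy_nonneg(1)[OF ab(1,2) assms] rel_entropy_nonneg(1)[OF ab(2,1) assms] by linarith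
  then show "a = b" using rel_entropy_nonneg(2)[OF ab(1,2) assms] by simp
qed

lemma prim_of_cons:
  assumes "1 < \<Gamma>" "\<Gamma> \<le> 2" "w \<in> prim_states"
  shows "prim_of \<Gamma> (cons_of \<Gamma> w) = w"
  unfolding prim_of_def using assms inj_onD[OF cons_of_inj[OF assms(1,2)]]
  by (intro the_equality) auto

lemma prim_of_admissible:
  assumes "1 < \<Gamma>" "\<Gamma> \<le> 2" "U \<in> admissible \<Gamma>"
  shows "prim_of \<Gamma> U \<in> prim_states" "cons_of \<Gamma> (prim_of \<Gamma> U) = U"
    "norm (vel \<Gamma> U) < 1" "dens \<Gamma> U > 0" "p_gas \<Gamma> U > 0"
proof -
  obtain w where w: "w \<in> prim_states" "U = cons_of \<Gamma> w" using assms by (auto simp: admissible_def)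
  then show *: "prim_of \<Gamma> U \<in> prim_states" "cons_of \<Gamma> (prim_of \<Gamma> U) = U"
    using prim_of_cons[OF assms(1,2)] by auto
  then show "norm (vel \<Gamma> U) < 1" "dens \<Gamma> U > 0" "p_gas \<Gamma> U > 0"
    by (auto simp: vel_def dens_def p_gas_def prim_states_def)
qed

text \<open>\<open>ent_var\<close> reads the magnetic field off \<open>U\<close> itself,
  \<open>prim_ent_var\<close> reads it off \<open>prim_of\<close>. Admissibility makes them agree, a
  condition that \<open>eta_prim\<close> can do without.\<close>

lemma ent_var_prim:
  assumes "1 < \<Gamma>" "\<Gamma> \<le> 2" "U \<in> admissible \<Gamma>"
  shows "ent_var \<Gamma> U = prim_ent_var \<Gamma> (prim_of \<Gamma> U)"
proof -
  obtain \<rho> v p B where w: "prim_of \<Gamma> U = (\<rho>, v, p, B)" by (cases "prim_of \<Gamma> U")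
  have "mag U = B" using prim_of_admissible(2)[OF assms] w by (auto simp: mag_def Let_def)
  then show ?thesis using w
    by (simp add: ent_var_def dens_def vel_def spec_entropy_def p_gas_def Let_def)
qed

text \<open>The global subgradient inequality, the form in which the chain rule uses convexity of
  the entropy.\<close>

lemma eta_supporting:
  assumes "1 < \<Gamma>" "\<Gamma> \<le> 2" "a \<in> admissible \<Gamma>" "b \<in> admissible \<Gamma>"
  shows "ent_var \<Gamma> a \<bullet> (b - a) \<le> eta \<Gamma> b - eta \<Gamma> a"
  using rel_entropy_nonneg(1)[OF prim_of_admissible(1)[OF assms(1-3)]
      prim_of_admissible(1)[OF assms(1,2,4)] assms(1,2)]
    prim_of_admissible(2)[OF assms(1-3)] prim_of_admissible(2)[OF assms(1,2,4)]
  unfolding rel_entropy_def eta_prim ent_var_prim[OF assms(1-3)] by simp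

section \<open>Continuity of the primitive variables and of the entropy variables\<close>

lemma open_prim_states: "open prim_states"
proof -
  have "prim_states = {w. fst w > 0} \<inter> {w. fst (snd (snd w)) > 0} \<inter> {w. norm (fst (snd w)) < 1}"
    by (auto simp: prim_states_def)
  also have "open \<dots>"
    by (intro open_Int open_Collect_less continuous_intros)
  finally show ?thesis .
qed

lemma continuous_on_lorentz [continuous_intros]:
  assumes "continuous_on S f" "\<And>x. x \<in> S \<Longrightarrow> norm (f x) < 1"
  shows "continuous_on S (\<lambda>x. lorentz (f x))"
proof -
  have "1 - (norm (f x))\<^sup>2 > 0" if "x \<in> S" for x using assms(2)[OF that] by (simp add: power_less_one_iff)
  then show ?thesis unfolding lorentz_def
    by (intro continuous_intros assms) (metis less_irrefl real_sqrt_gt_0_iff)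
qed

lemma continuous_on_cons_of: "continuous_on prim_states (cons_of \<Gamma>)"
proof -
  have W: "lorentz (fst (snd w)) > 0" if "w \<in> prim_states" for w
    using lorentz_props(1)[of "fst (snd w)"] that by (auto simp: prim_states_def)
  have "continuous_on prim_states (\<lambda>w. case w of (\<rho>, v, p, B) \<Rightarrow> cons_of \<Gamma> (\<rho>, v, p, B))"
    unfolding cons_of.simps Let_def enthalpy_def p_tot_def b_sq_def case_prod_beta'
    by (intro continuous_intros) (use W in \<open>fastforce simp: prim_states_def\<close>)+
  then show ?thesis by (rule continuous_on_eq) auto
qed

text \<open>There is no closed form for the recovery of primitive variables. Invariance of domain
  supplies continuity: \<open>cons_of\<close> is continuous and injective on an open set and maps
  between spaces of equal dimension, so it is a homeomorphism onto its image.\<close>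

lemma continuous_on_prim_of:
  assumes "1 < \<Gamma>" "\<Gamma> \<le> 2"
  shows "continuous_on (admissible \<Gamma>) (prim_of \<Gamma>)"
proof -
  obtain g where g: "homeomorphism prim_states (admissible \<Gamma>) (cons_of \<Gamma>) g"
    using invariance_of_domain_homeomorphism[OF open_prim_states continuous_on_cons_of _ cons_of_inj[OF assms]]
    unfolding admissible_def by auto
  have "g U = prim_of \<Gamma> U" if "U \<in> admissible \<Gamma>" for U
  proof -
    have "g U \<in> prim_states" "cons_of \<Gamma> (g U) = U" using g that unfolding homeomorphism_def by auto
    then show ?thesis using prim_of_cons[OF assms, of "g U"] by simp
  qed
  moreover have "continuous_on (admissible \<Gamma>) g" using g by (simp add: homeomorphism_def)
  ultimately show ?thesis using continuous_on_eq by blast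
qed

lemma continuous_on_ent_var:
  assumes "1 < \<Gamma>" "\<Gamma> \<le> 2"
  shows "continuous_on (admissible \<Gamma>) (ent_var \<Gamma>)"
proof -
  have W: "lorentz (fst (snd w)) > 0" if "w \<in> prim_states" for w
    using lorentz_props(1)[of "fst (snd w)"] that by (auto simp: prim_states_def)
  have "continuous_on prim_states (\<lambda>w. case w of (\<rho>, v, p, B) \<Rightarrow> prim_ent_var \<Gamma> (\<rho>, v, p, B))"
    unfolding prim_ent_var.simps case_prod_beta'
    by (intro continuous_intros) (use W assms in \<open>fastforce simp: prim_states_def\<close>)+
  then have "continuous_on prim_states (prim_ent_var \<Gamma>)" by (rule continuous_on_eq) auto
  then have "continuous_on (admissible \<Gamma>) (\<lambda>U. prim_ent_var \<Gamma> (prim_of \<Gamma> U))"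
    by (rule continuous_on_compose2[OF _ continuous_on_prim_of[OF assms]])
      (use prim_of_admissible(1)[OF assms] in auto)
  then show ?thesis by (rule continuous_on_eq) (simp add: ent_var_prim[OF assms])
qed

section \<open>Entropy conservation\<close>

lemma has_vector_derivative_quotient:
  assumes "(f has_vector_derivative D) (at x within T)"
  shows "((\<lambda>y. (f y - f x) /\<^sub>R (y - x)) \<longlongrightarrow> D) (at x within T)"
proof -
  have "((\<lambda>y. norm ((f y - f x) /\<^sub>R (y - x) - D)) \<longlongrightarrow> 0) (at x within T)"
  proof (rule Lim_transform_eventually)
    show "((\<lambda>y. norm (f y - f x - (y - x) *\<^sub>R D) / norm (y - x)) \<longlongrightarrow> 0) (at x within T)"
      using assms unfolding has_vector_derivative_def has_derivative_iff_norm by simp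
    have "norm (f y - f x - (y - x) *\<^sub>R D) / norm (y - x) = norm ((f y - f x) /\<^sub>R (y - x) - D)"
      if "y \<noteq> x" for y
    proof -
      have "(f y - f x) /\<^sub>R (y - x) - D = (f y - f x - (y - x) *\<^sub>R D) /\<^sub>R (y - x)"
        using that by (simp add: scaleR_right_diff_distrib)
      then show ?thesis by (simp add: divide_inverse mult.commute)
    qed
    then show "\<forall>\<^sub>F y in at x within T. norm (f y - f x - (y - x) *\<^sub>R D) / norm (y - x)
        = norm ((f y - f x) /\<^sub>R (y - x) - D)"
      by (auto simp: eventually_at_filter)
  qed
  then show ?thesis by (simp add: tendsto_norm_zero_iff Lim_null[of _ D])
qed

text \<open>Convexity replaces the differentiability of the primitive variables: the increment of
  \<open>eta\<close> along the curve is squeezed between the two supporting linear functionals.\<close>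

lemma eta_chain_rule:
  assumes "1 < \<Gamma>" "\<Gamma> \<le> 2" "t \<in> T" "\<And>s. s \<in> T \<Longrightarrow> u s \<in> admissible \<Gamma>"
    and u: "(u has_vector_derivative u') (at t within T)"
  shows "((\<lambda>s. eta \<Gamma> (u s)) has_real_derivative ent_var \<Gamma> (u t) \<bullet> u') (at t within T)"
proof -
  let ?q = "\<lambda>s. (u s - u t) /\<^sub>R (s - t)"
  let ?A = "\<lambda>s. ent_var \<Gamma> (u t) \<bullet> ?q s"
  let ?B = "\<lambda>s. ent_var \<Gamma> (u s) \<bullet> ?q s"
  let ?Q = "\<lambda>s. (eta \<Gamma> (u s) - eta \<Gamma> (u t)) / (s - t)"
  let ?F = "at t within T"
  have q: "(?q \<longlongrightarrow> u') ?F" using has_vector_derivative_quotient[OF u] .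
  have cu: "(u \<longlongrightarrow> u t) ?F"
    using has_vector_derivative_continuous[OF u] by (simp add: continuous_within)
  have V: "((\<lambda>s. ent_var \<Gamma> (u s)) \<longlongrightarrow> ent_var \<Gamma> (u t)) ?F"
    by (rule continuous_on_tendsto_compose[OF continuous_on_ent_var[OF assms(1,2)] cu])
      (use assms(3,4) in \<open>auto simp: eventually_at_filter\<close>)
  have A: "(?A \<longlongrightarrow> ent_var \<Gamma> (u t) \<bullet> u') ?F" by (intro tendsto_intros q)
  have B: "(?B \<longlongrightarrow> ent_var \<Gamma> (u t) \<bullet> u') ?F" by (intro tendsto_intros q V)
  \<comment> \<open>Dividing by \<open>s - t\<close> exchanges the two supporting bounds when
    \<open>s < t\<close>; minimum and maximum cover both sides of \<open>t\<close> at once.\<close>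
  have bounds: "min (?A s) (?B s) \<le> ?Q s \<and> ?Q s \<le> max (?A s) (?B s)" if "s \<in> T" "s \<noteq> t" for s
  proof -
    let ?d = "eta \<Gamma> (u s) - eta \<Gamma> (u t)"
    have lo: "ent_var \<Gamma> (u t) \<bullet> (u s - u t) \<le> ?d"
      using eta_supporting assms that by blast
    have "ent_var \<Gamma> (u s) \<bullet> (u t - u s) \<le> eta \<Gamma> (u t) - eta \<Gamma> (u s)"
      using eta_supporting assms that by blast
    then have hi: "?d \<le> ent_var \<Gamma> (u s) \<bullet> (u s - u t)" by (simp add: inner_diff_right)
    have eq: "?A s = (ent_var \<Gamma> (u t) \<bullet> (u s - u t)) / (s - t)"
      "?B s = (ent_var \<Gamma> (u s) \<bullet> (u s - u t)) / (s - t)" by (auto simp: divide_inverse mult.commute)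
    show ?thesis
    proof (cases "s > t")
      case True
      then have "?A s \<le> ?Q s" "?Q s \<le> ?B s" unfolding eq using lo hi by (auto intro: divide_right_mono)
      then show ?thesis by auto
    next
      case False
      then have "?B s \<le> ?Q s" "?Q s \<le> ?A s" unfolding eq using lo hi that
        by (auto intro: divide_right_mono_neg)
      then show ?thesis by auto
    qed
  qed
  have "(?Q \<longlongrightarrow> ent_var \<Gamma> (u t) \<bullet> u') ?F"
  proof (rule tendsto_sandwich)
    show "((\<lambda>s. min (?A s) (?B s)) \<longlongrightarrow> ent_var \<Gamma> (u t) \<bullet> u') ?F"
      using tendsto_min[OF A B] by simp
    show "((\<lambda>s. max (?A s) (?B s)) \<longlongrightarrow> ent_var \<Gamma> (u t) \<bullet> u') ?F"
      using tendsto_max[OF A B] by simp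
    show "\<forall>\<^sub>F s in ?F. min (?A s) (?B s) \<le> ?Q s" "\<forall>\<^sub>F s in ?F. ?Q s \<le> max (?A s) (?B s)"
      using bounds by (auto simp: eventually_at_filter)
  qed
  then show ?thesis by (simp add: has_field_derivative_iff)
qed

text \<open>Euler's identity for \<open>\<Phi>\<close>, which is homogeneous of degree one in the
  entropy variables, checked on the closed forms. It turns the source term paired with the entropy
  variables into \<open>Phi\<close> times the discrete divergence of the magnetic field.\<close>

lemma ent_var_grad_Phi:
  assumes "1 < \<Gamma>" "\<Gamma> \<le> 2" "U \<in> admissible \<Gamma>"
  shows "ent_var \<Gamma> U \<bullet> grad_Phi \<Gamma> U = Phi \<Gamma> U"
proof -
  define v where "v = vel \<Gamma> U"
  define B where "B = mag U"
  define W where "W = lorentz v"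
  define \<rho> where "\<rho> = dens \<Gamma> U"
  define p where "p = p_gas \<Gamma> U"
  have v: "norm v < 1" and rp: "\<rho> > 0" "p > 0"
    using prim_of_admissible[OF assms] by (auto simp: v_def \<rho>_def p_def)
  note W = lorentz_props[OF v, folded W_def]
  have W0: "W > 0" using W by simp
  have "v \<bullet> v = 1 - 1 / W\<^sup>2" using W by simp
  then have "(\<rho> * W / p) * ((1 / W\<^sup>2) * (v \<bullet> B) + (v \<bullet> B) * (v \<bullet> v)) - (\<rho> * W / p) * (v \<bullet> B)
      + (\<rho> / (p * W)) * (v \<bullet> B + W\<^sup>2 * (v \<bullet> B) * (v \<bullet> v)) = \<rho> * W * (v \<bullet> B) / p"
    using W0 rp by (simp only:) (simp add: field_simps power2_eq_square)
  then show ?thesis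
    unfolding ent_var_def grad_Phi_def Phi_def Let_def v_def[symmetric] B_def[symmetric]
      \<rho>_def[symmetric] p_def[symmetric] W_def[symmetric]
    by (simp add: inner_add_left inner_add_right inner_commute algebra_simps)
qed

section \<open>Telescoping and the algebra of central differences on the grid\<close>

lemma axis_add: "axis k x + axis k y = axis k (x + y :: 'a :: monoid_add)"
  by (auto simp: axis_def vec_eq_iff)

text \<open>Moving to the left interface amounts to replacing \<open>s\<close> by
  \<open>s + 1\<close>, so the inner sum telescopes and only the pairs that contain the node
  \<open>i\<close> survive.\<close>

lemma flux2p_diff:
  "flux2p p \<alpha> k G a i - flux2p p \<alpha> k G a (i + axis k (-1)) =
    (\<Sum>n=1..p. \<alpha> n *\<^sub>R (G (a i) (a (i + axis k (int n))) - G (a (i + axis k (- int n))) (a i)))"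
proof -
  have "(\<Sum>s=0..n-1. G (a (i + axis k (- int s))) (a (i + axis k (- int s + int n))))
      - (\<Sum>s=0..n-1. G (a (i + axis k (-1) + axis k (- int s))) (a (i + axis k (-1) + axis k (- int s + int n))))
    = G (a i) (a (i + axis k (int n))) - G (a (i + axis k (- int n))) (a i)" if "n \<ge> 1" for n
  proof -
    define g where "g s = G (a (i + axis k (- int s))) (a (i + axis k (- int s + int n)))" for s
    have 1: "G (a (i + axis k (-1) + axis k (- int s))) (a (i + axis k (-1) + axis k (- int s + int n)))
      = g (Suc s)" for s
      by (simp add: g_def add.assoc axis_add algebra_simps)
    \<comment> \<open>For \<open>n = 0\<close> truncated subtraction would leave one summand instead
      of none, hence the restriction to \<open>n \<ge> 1\<close>.\<close>
    have "{0..n-1} = {..<n}" using that by auto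
    then have "(\<Sum>s=0..n-1. g s) - (\<Sum>s=0..n-1. g (Suc s)) = g 0 - g n"
      using sum_lessThan_telescope'[of g n] by (simp add: sum_subtractf)
    moreover have "axis k (0::int) = 0" by (simp add: axis_def vec_eq_iff)
    ultimately show ?thesis unfolding 1 by (simp add: g_def)
  qed
  then show ?thesis
    unfolding flux2p_def sum_subtractf[symmetric] scaleR_right_diff_distrib[symmetric]
    by (intro sum.cong refl arg_cong2[where f = scaleR]) auto
qed

lemma delta_sum: "delta p \<alpha> k a i = (\<Sum>n=1..p. \<alpha> n / 2 * (a (i + axis k (int n)) - a (i + axis k (- int n))))"
  by (simp add: delta_def sum_distrib_left)

lemma delta_scale: "delta p \<alpha> k (\<lambda>l. c * a l) i = c * delta p \<alpha> k a i"
  by (simp add: delta_sum sum_distrib_left algebra_simps)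

lemma delta_diff: "delta p \<alpha> k (\<lambda>l. a l - b l) i = delta p \<alpha> k a i - delta p \<alpha> k b i"
  by (simp add: delta_sum sum_subtractf[symmetric] algebra_simps)

lemma delta_commute:
  "delta p \<alpha> k (\<lambda>l. delta p \<alpha> k' a l) i = delta p \<alpha> k' (\<lambda>l. delta p \<alpha> k a l) i"
proof -
  have *: "delta p \<alpha> k (\<lambda>l. delta p \<alpha> k' a l) i = (\<Sum>n=1..p. \<Sum>m=1..p. \<alpha> n * \<alpha> m / 4 *
      (a (i + axis k (int n) + axis k' (int m)) - a (i + axis k (int n) + axis k' (- int m))
       - a (i + axis k (- int n) + axis k' (int m)) + a (i + axis k (- int n) + axis k' (- int m))))"
    for k k'
    unfolding delta_sum sum_subtractf[symmetric] sum_distrib_left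
    by (intro sum.cong refl) (simp add: algebra_simps)
  show ?thesis
    unfolding *[of k k'] *[of k' k]
    by (subst sum.swap) (intro sum.cong refl, simp add: algebra_simps)
qed

lemma three_arith: "(1::3) + 1 = 2" "(1::3) + 2 = 3" "(2::3) + 1 = 3" "(2::3) + 2 = 1"
  "(3::3) + 1 = 1" "(3::3) + 2 = 2"
  by simp_all

text \<open>The discrete form of div curl = 0. The sum over \<open>k\<close> consists of six triple
  differences with the common factor 1 / (product of the three steps). They cancel in pairs because
  the two outer operators commute; the innermost one sits under a product and is never
  moved.\<close>

lemma surface_conservation:
  "(\<Sum>k\<in>UNIV. (1 / \<Delta> $ k) * delta p \<alpha> k (disc_metric_x p \<alpha> \<Delta> x k j) i) = 0"
proof -
  define S where "S k k' k'' = delta p \<alpha> k (\<lambda>l. delta p \<alpha> k'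
    (\<lambda>l. delta p \<alpha> k'' (\<lambda>m. x m $ (j + 1)) l * x l $ (j + 2)) l) i" for k k' k''
  have S: "S k k' k'' = S k' k k''" for k k' k'' unfolding S_def by (rule delta_commute)
  have "disc_metric_x p \<alpha> \<Delta> x k j = (\<lambda>l. 1 / (\<Delta> $ (k + 1) * \<Delta> $ (k + 2)) *
       (delta p \<alpha> (k + 2) (\<lambda>l. delta p \<alpha> (k + 1) (\<lambda>m. x m $ (j + 1)) l * x l $ (j + 2)) l
        - delta p \<alpha> (k + 1) (\<lambda>l. delta p \<alpha> (k + 2) (\<lambda>m. x m $ (j + 1)) l * x l $ (j + 2)) l))" for k
    by (simp add: disc_metric_x_def Let_def fun_eq_iff)
  then have E: "(1 / \<Delta> $ k) * delta p \<alpha> k (disc_metric_x p \<alpha> \<Delta> x k j) i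
     = 1 / (\<Delta> $ k * \<Delta> $ (k + 1) * \<Delta> $ (k + 2)) * (S k (k + 2) (k + 1) - S k (k + 1) (k + 2))" for k
    by (simp only: delta_scale delta_diff S_def) simp
  show ?thesis
    unfolding sum_3 E three_arith
    using S[of 1 2 3] S[of 2 3 1] S[of 1 3 2] by (simp add: algebra_simps diff_divide_distrib)
qed

text \<open>This explains the averages in \<open>ent_flux2\<close>: by the jump relations, the mean
  of the two entropy-weighted fluxes corrected by the mean potentials can be read from either end,
  and what remains there is the potential \<open>psi_pot\<close> of that end alone, times the mean
  metric. In the balance at a node this potential can therefore be factored out of all its
  pairs.\<close>

lemma entropy_exchange:
  fixes Ta Tb :: real and Ma Mb :: "real^3"
  assumes "two_point_fluxes \<Gamma> Ut Ft" "Ua \<in> admissible \<Gamma>" "Ub \<in> admissible \<Gamma>"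
  defines "a \<equiv> (Ua, Ta, Ma)" and "b \<equiv> (Ub, Tb, Mb)"
  shows "ent_var \<Gamma> Ua \<bullet> flux2 Ut Ft a b + Phi \<Gamma> Ua * mag2 a b - phi_pot \<Gamma> Ua * metric_t2 a b
      - ent_flux2 \<Gamma> Ut Ft a b = (\<Sum>j\<in>UNIV. psi_pot \<Gamma> j Ua * ((Ma $ j + Mb $ j) / 2))"
    and "ent_var \<Gamma> Ub \<bullet> flux2 Ut Ft a b + Phi \<Gamma> Ub * mag2 a b - phi_pot \<Gamma> Ub * metric_t2 a b
      - ent_flux2 \<Gamma> Ut Ft a b = (\<Sum>j\<in>UNIV. psi_pot \<Gamma> j Ub * ((Ma $ j + Mb $ j) / 2))"
proof -
  have "(ent_var \<Gamma> Ub - ent_var \<Gamma> Ua) \<bullet> Ut Ua Ub = phi_pot \<Gamma> Ub - phi_pot \<Gamma> Ua"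
    using assms unfolding two_point_fluxes_def by blast
  then have 1: "ent_var \<Gamma> Ub \<bullet> Ut Ua Ub = ent_var \<Gamma> Ua \<bullet> Ut Ua Ub + phi_pot \<Gamma> Ub - phi_pot \<Gamma> Ua"
    by (simp add: inner_diff_left)
  have "(ent_var \<Gamma> Ub - ent_var \<Gamma> Ua) \<bullet> Ft j Ua Ub = psi_pot \<Gamma> j Ub - psi_pot \<Gamma> j Ua
               - (1/2) * (mag Ua $ j + mag Ub $ j) * (Phi \<Gamma> Ub - Phi \<Gamma> Ua)" for j
    using assms unfolding two_point_fluxes_def by blast
  then have 2: "ent_var \<Gamma> Ub \<bullet> Ft j Ua Ub = ent_var \<Gamma> Ua \<bullet> Ft j Ua Ub + (psi_pot \<Gamma> j Ub - psi_pot \<Gamma> j Ua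
               - (1/2) * (mag Ua $ j + mag Ub $ j) * (Phi \<Gamma> Ub - Phi \<Gamma> Ua))" for j
    by (metis inner_diff_left add_diff_cancel_left' diff_add_cancel)
  define X where "X j = ent_var \<Gamma> Ua \<bullet> Ft j Ua Ub" for j
  define m where "m j = (Ma $ j + Mb $ j) / 2" for j
  define s where "s j = (mag Ua $ j + mag Ub $ j) / 2" for j
  have m: "Ma $ j + Mb $ j = 2 * m j" and s: "mag Ua $ j + mag Ub $ j = 2 * s j" for j
    by (auto simp: m_def s_def)
  have F: "ent_var \<Gamma> Ua \<bullet> flux2 Ut Ft a b = ((Ta + Tb) / 2) * (ent_var \<Gamma> Ua \<bullet> Ut Ua Ub) + (\<Sum>j\<in>UNIV. m j * X j)"
    by (simp add: a_def b_def inner_add_right inner_sum_right X_def m_def)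
  have G: "ent_var \<Gamma> Ub \<bullet> flux2 Ut Ft a b = ((Ta + Tb) / 2) * (ent_var \<Gamma> Ua \<bullet> Ut Ua Ub + phi_pot \<Gamma> Ub - phi_pot \<Gamma> Ua)
      + (\<Sum>j\<in>UNIV. m j * (X j + (psi_pot \<Gamma> j Ub - psi_pot \<Gamma> j Ua - s j * (Phi \<Gamma> Ub - Phi \<Gamma> Ua))))"
    by (simp add: a_def b_def inner_add_right inner_sum_right 1 2 X_def m_def s_def)
  have E: "ent_flux2 \<Gamma> Ut Ft a b = (1/2) * (ent_var \<Gamma> Ua \<bullet> flux2 Ut Ft a b + ent_var \<Gamma> Ub \<bullet> flux2 Ut Ft a b)
     - (1/4) * (Ta + Tb) * (phi_pot \<Gamma> Ua + phi_pot \<Gamma> Ub)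
     - (\<Sum>j\<in>UNIV. (1/2) * m j * (psi_pot \<Gamma> j Ua + psi_pot \<Gamma> j Ub))
     + (\<Sum>j\<in>UNIV. (1/2) * m j * s j * (Phi \<Gamma> Ua + Phi \<Gamma> Ub))"
    unfolding a_def b_def ent_flux2.simps m s inner_add_left by simp
  have M: "mag2 a b = (\<Sum>j\<in>UNIV. m j * s j)" unfolding a_def b_def mag2.simps m s by simp
  have T: "metric_t2 a b = (Ta + Tb) / 2" by (simp add: a_def b_def)
  show "ent_var \<Gamma> Ua \<bullet> flux2 Ut Ft a b + Phi \<Gamma> Ua * mag2 a b - phi_pot \<Gamma> Ua * metric_t2 a b
      - ent_flux2 \<Gamma> Ut Ft a b = (\<Sum>j\<in>UNIV. psi_pot \<Gamma> j Ua * ((Ma $ j + Mb $ j) / 2))"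
    "ent_var \<Gamma> Ub \<bullet> flux2 Ut Ft a b + Phi \<Gamma> Ub * mag2 a b - phi_pot \<Gamma> Ub * metric_t2 a b
      - ent_flux2 \<Gamma> Ut Ft a b = (\<Sum>j\<in>UNIV. psi_pot \<Gamma> j Ub * ((Ma $ j + Mb $ j) / 2))"
    unfolding E F G M T m sum_3 by (simp_all add: field_simps)
qed

text \<open>By \<open>entropy_exchange\<close>, all that separates the weighted scheme from the
  entropy flux difference is \<open>psi_pot\<close> at \<open>i\<close> times a weighted sum of
  central differences of the discrete metrics, which is zero by
  \<open>surface_conservation\<close>.\<close>

lemma entropy_balance:
  assumes "1 < \<Gamma>" "\<Gamma> \<le> 2" "two_point_fluxes \<Gamma> Ut Ft" "\<And>l. u l \<in> admissible \<Gamma>"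
  shows "ent_var \<Gamma> (u i) \<bullet> rhs_U \<Gamma> Ut Ft p \<alpha> \<Delta> x x' u i - phi_pot \<Gamma> (u i) * rhs_J p \<alpha> \<Delta> x x' u i
    = - flux_sum p \<alpha> \<Delta> (ent_flux2 \<Gamma> Ut Ft) (node_data p \<alpha> \<Delta> x x' u) i"
proof -
  define a where "a = node_data p \<alpha> \<Delta> x x' u"
  define V where "V = ent_var \<Gamma> (u i)"
  define M where "M = disc_metric_x p \<alpha> \<Delta> x"
  let ?i = "\<lambda>k n. i + axis k n"
  let ?D = "\<lambda>G k n. G (a k i) (a k (?i k (int n))) - G (a k (?i k (- int n))) (a k i)"
  have fs: "flux_sum p \<alpha> \<Delta> G a i = (\<Sum>k\<in>UNIV. \<Sum>n=1..p. (\<alpha> n / \<Delta> $ k) *\<^sub>R ?D G k n)"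
    for G :: "node \<Rightarrow> node \<Rightarrow> 'b::real_vector"
    unfolding flux_sum_def flux2p_diff by (simp add: scaleR_right.sum)
  have a: "a k l = (u l, disc_metric_t p \<alpha> \<Delta> x x' k l, \<chi> j. M k j l)" for k l
    by (simp add: a_def node_data_def M_def)
  have ex: "V \<bullet> ?D (flux2 Ut Ft) k n + Phi \<Gamma> (u i) * ?D mag2 k n - phi_pot \<Gamma> (u i) * ?D metric_t2 k n
     - ?D (ent_flux2 \<Gamma> Ut Ft) k n
     = (\<Sum>j\<in>UNIV. psi_pot \<Gamma> j (u i) * ((M k j (?i k (int n)) - M k j (?i k (- int n))) / 2))" for k n
  proof -
    have 1: "V \<bullet> flux2 Ut Ft (a k i) (a k (?i k (int n))) + Phi \<Gamma> (u i) * mag2 (a k i) (a k (?i k (int n)))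
      - phi_pot \<Gamma> (u i) * metric_t2 (a k i) (a k (?i k (int n))) - ent_flux2 \<Gamma> Ut Ft (a k i) (a k (?i k (int n)))
      = (\<Sum>j\<in>UNIV. psi_pot \<Gamma> j (u i) * ((M k j i + M k j (?i k (int n))) / 2))"
      using entropy_exchange(1)[OF assms(3) assms(4)[of "i"] assms(4)[of "?i k (int n)"],
          where Ma = "\<chi> j. M k j (i)" and Mb = "\<chi> j. M k j (?i k (int n))"]
      unfolding a V_def by (simp only: vec_lambda_beta)
    have 2: "V \<bullet> flux2 Ut Ft (a k (?i k (- int n))) (a k i) + Phi \<Gamma> (u i) * mag2 (a k (?i k (- int n))) (a k i)
      - phi_pot \<Gamma> (u i) * metric_t2 (a k (?i k (- int n))) (a k i) - ent_flux2 \<Gamma> Ut Ft (a k (?i k (- int n))) (a k i)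
      = (\<Sum>j\<in>UNIV. psi_pot \<Gamma> j (u i) * ((M k j (?i k (- int n)) + M k j i) / 2))"
      using entropy_exchange(2)[OF assms(3) assms(4)[of "?i k (- int n)"] assms(4)[of "i"],
          where Ma = "\<chi> j. M k j (?i k (- int n))" and Mb = "\<chi> j. M k j (i)"]
      unfolding a V_def by (simp only: vec_lambda_beta)
    \<comment> \<open>Both pairs carry the same potential, so the metric at \<open>i\<close> itself
      drops out of the difference of the two means and a central difference is left.\<close>
    show ?thesis
      using arg_cong2[OF 1 2, of "(-)"] unfolding sum_subtractf[symmetric]
      by (simp add: inner_diff_right algebra_simps diff_divide_distrib add_divide_distrib)
  qed
  have "V \<bullet> flux_sum p \<alpha> \<Delta> (flux2 Ut Ft) a i + Phi \<Gamma> (u i) * flux_sum p \<alpha> \<Delta> mag2 a i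
      - phi_pot \<Gamma> (u i) * flux_sum p \<alpha> \<Delta> metric_t2 a i - flux_sum p \<alpha> \<Delta> (ent_flux2 \<Gamma> Ut Ft) a i
    = (\<Sum>k\<in>UNIV. \<Sum>n=1..p. \<alpha> n / \<Delta> $ k * (V \<bullet> ?D (flux2 Ut Ft) k n + Phi \<Gamma> (u i) * ?D mag2 k n
        - phi_pot \<Gamma> (u i) * ?D metric_t2 k n - ?D (ent_flux2 \<Gamma> Ut Ft) k n))"
    unfolding fs inner_sum_right sum_distrib_left sum_subtractf[symmetric] sum.distrib[symmetric]
    by (intro sum.cong refl) (simp add: algebra_simps)
  also have "\<dots> = (\<Sum>j\<in>UNIV. psi_pot \<Gamma> j (u i) * (\<Sum>k\<in>UNIV. (1 / \<Delta> $ k) * delta p \<alpha> k (M k j) i))"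
    unfolding ex delta_sum sum_3 sum_distrib_left sum.distrib[symmetric]
    by (intro sum.cong refl) (simp add: diff_divide_distrib algebra_simps)
  also have "\<dots> = 0" unfolding M_def surface_conservation by simp
  finally show ?thesis
    unfolding rhs_U_def rhs_J_def a_def[symmetric]
    using ent_var_grad_Phi[OF assms(1,2) assms(4)[of i]]
    by (simp add: V_def inner_diff_right algebra_simps)
qed

text \<open>The scheme provides derivatives of \<open>J u\<close> and of \<open>J\<close> only; that
  of \<open>u\<close> comes from the product rule for \<open>inverse J\<close> and
  \<open>J u\<close>. Inserting it, the derivative of \<open>J * eta\<close> is the entropy
  variables paired with the derivative of \<open>J u\<close>, minus \<open>phi_pot\<close> times the
  derivative of \<open>J\<close>: the combination treated in \<open>entropy_balance\<close>.\<close>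

lemma entropy_conservation:
  assumes "1 < \<Gamma>" "\<Gamma> \<le> 2" "two_point_fluxes \<Gamma> Ut Ft" 
    "scheme_solution \<Gamma> Ut Ft p \<alpha> \<Delta> T J u x x'" "t \<in> T"
  shows "((\<lambda>s. J s i * eta \<Gamma> (u s i)) has_real_derivative
          - flux_sum p \<alpha> \<Delta> (ent_flux2 \<Gamma> Ut Ft) (node_data p \<alpha> \<Delta> (x t) (x' t) (u t)) i)
          (at t within T)"
proof -
  let ?R = "rhs_U \<Gamma> Ut Ft p \<alpha> \<Delta> (x t) (x' t) (u t) i"
  let ?S = "rhs_J p \<alpha> \<Delta> (x t) (x' t) (u t) i"
  have pos: "J s i > 0" "u s l \<in> admissible \<Gamma>" if "s \<in> T" for s i l
    using assms that unfolding scheme_solution_def by blast+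
  have dw: "((\<lambda>s. J s i *\<^sub>R u s i) has_vector_derivative ?R) (at t within T)"
    and dJ: "((\<lambda>s. J s i) has_real_derivative ?S) (at t within T)"
    using assms unfolding scheme_solution_def by blast+
  have J0: "J t i \<noteq> 0" using pos(1)[OF assms(5)] by (metis less_irrefl)
  have inv: "u s i = inverse (J s i) *\<^sub>R (J s i *\<^sub>R u s i)" if "s \<in> T" for s
    using pos(1)[OF that, of i] by simp
  define u' where "u' = inverse (J t i) *\<^sub>R (?R - ?S *\<^sub>R u t i)"
  have di: "((\<lambda>s. inverse (J s i)) has_real_derivative - (inverse (J t i) * ?S * inverse (J t i))) (at t within T)"
    using DERIV_inverse'[OF dJ J0] .
  have "((\<lambda>s. inverse (J s i) *\<^sub>R (J s i *\<^sub>R u s i)) has_vector_derivative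
      (inverse (J t i) *\<^sub>R ?R + (- (inverse (J t i) * ?S * inverse (J t i))) *\<^sub>R (J t i *\<^sub>R u t i))) (at t within T)"
    by (rule has_vector_derivative_scaleR[OF di dw])
  also have "inverse (J t i) *\<^sub>R ?R + (- (inverse (J t i) * ?S * inverse (J t i))) *\<^sub>R (J t i *\<^sub>R u t i) = u'"
    using J0 unfolding u'_def by (simp add: scaleR_right_diff_distrib)
  finally have "((\<lambda>s. u s i) has_vector_derivative u') (at t within T)"
    by (rule has_vector_derivative_transform[OF assms(5), rotated])
      (rule inv)
  from eta_chain_rule[OF assms(1,2,5) pos(2) this]
  have de: "((\<lambda>s. eta \<Gamma> (u s i)) has_real_derivative ent_var \<Gamma> (u t i) \<bullet> u') (at t within T)" .
  have Ju: "J t i *\<^sub>R u' = ?R - ?S *\<^sub>R u t i" using J0 by (simp add: u'_def)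
  have "?S * eta \<Gamma> (u t i) + (ent_var \<Gamma> (u t i) \<bullet> u') * J t i
      = ?S * eta \<Gamma> (u t i) + ent_var \<Gamma> (u t i) \<bullet> (J t i *\<^sub>R u')" by simp
  also have "\<dots> = ent_var \<Gamma> (u t i) \<bullet> ?R - phi_pot \<Gamma> (u t i) * ?S"
    unfolding Ju phi_pot_def by (simp add: inner_diff_right algebra_simps)
  also have "\<dots> = - flux_sum p \<alpha> \<Delta> (ent_flux2 \<Gamma> Ut Ft) (node_data p \<alpha> \<Delta> (x t) (x' t) (u t)) i"
    by (rule entropy_balance[OF assms(1-3) pos(2)[OF assms(5)]])
  finally show ?thesis using DERIV_mult[OF dJ de] by simp
qed

text \<open>On the diagonal the pairings with the fluxes and the \<open>Phi\<close> terms cancel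
  against those inside \<open>phi_pot\<close> and \<open>psi_pot\<close>, by the very definition of
  the potentials.\<close>

lemma entropy_flux_consistent:
  assumes "two_point_fluxes \<Gamma> Ut Ft" "U \<in> admissible \<Gamma>"
  shows "ent_flux2 \<Gamma> Ut Ft (U, m\<^sub>t, m\<^sub>x) (U, m\<^sub>t, m\<^sub>x)
    = m\<^sub>t * eta \<Gamma> U + (\<Sum>j\<in>UNIV. m\<^sub>x $ j * ent_flux \<Gamma> j U)"
proof -
  have "Ut U U = U" "\<And>j. Ft j U U = phys_flux \<Gamma> j U"
    using assms unfolding two_point_fluxes_def by blast+
  then show ?thesis
    by (simp add: phi_pot_def psi_pot_def inner_add_left inner_add_right sum_3 algebra_simps)
qed

text \<open>The stencil of the interface at +1/2 reaches from offset \<open>- p + 1\<close> to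
  \<open>p\<close>, hence the asymmetric range. The inner sum has \<open>n\<close> equal terms, and
  the first order condition normalises the total weight to 1.\<close>

lemma flux2p_constant:
  assumes "(\<Sum>n=1..p. real n * \<alpha> n) = 1"
    and "\<And>n. - int p < n \<Longrightarrow> n \<le> int p \<Longrightarrow> a (i + axis k n) = c"
  shows "flux2p p \<alpha> k G a i = G c c"
proof -
  have "(\<Sum>s=0..n-1. G (a (i + axis k (- int s))) (a (i + axis k (- int s + int n)))) = real n *\<^sub>R G c c"
    if "n \<in> {1..p}" for n
  proof -
    have "a (i + axis k (- int s)) = c" "a (i + axis k (- int s + int n)) = c" if "s \<in> {0..n-1}" for s
      using that \<open>n \<in> {1..p}\<close> by (auto intro!: assms(2))
    then show ?thesis using that by (simp add: sum_constant_scaleR)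
  qed
  then have "flux2p p \<alpha> k G a i = (\<Sum>n=1..p. real n * \<alpha> n) *\<^sub>R G c c"
    unfolding flux2p_def scaleR_left.sum by (intro sum.cong refl) simp
  then show ?thesis using assms(1) by simp
qed

section \<open>Smooth functions and central differences\<close>

text \<open>A directional derivative as a value of the Frechet derivative, the form on which
  \<open>Ck_on\<close> recurses; \<open>dir_deriv_dird\<close> connects it with the derivative along
  a line.\<close>

abbreviation dird :: "'a::real_normed_vector \<Rightarrow> ('a \<Rightarrow> 'b::real_normed_vector) \<Rightarrow> 'a \<Rightarrow> 'b" where
  "dird v f \<equiv> \<lambda>x. frechet_derivative f (at x) v"

section \<open>Closure properties of continuously differentiable maps\<close>

lemma Ck_on_cong:
  assumes "open S" "\<And>x. x \<in> S \<Longrightarrow> f x = g x" "Ck_on n S f"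
  shows "Ck_on n S g"
  using assms(2,3)
proof (induction n arbitrary: f g)
  case 0
  then show ?case using continuous_on_eq by auto
next
  case (Suc n)
  have d: "f differentiable (at x)" if "x \<in> S" for x using Suc.prems that by simp
  have "g differentiable (at x)" if "x \<in> S" for x
    using d[OF that] has_derivative_transform_within_open[OF _ assms(1) that] Suc.prems(1)
    unfolding differentiable_def by blast
  moreover have "Ck_on n S (dird v g)" for v
  proof (rule Suc.IH)
    show "Ck_on n S (dird v f)" using Suc.prems by simp
    show "dird v f x = dird v g x" if "x \<in> S" for x
      using frechet_derivative_transform_within_open[OF d[OF that] assms(1) that] Suc.prems(1) by metis
  qed
  ultimately show ?case by simp
qed

lemma Ck_on_SucD: "Ck_on (Suc n) S f \<Longrightarrow> Ck_on n S f"
proof (induction n arbitrary: f)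
  case 0
  then show ?case
    by (auto intro!: continuous_at_imp_continuous_on differentiable_imp_continuous_within)
next
  case (Suc n)
  then show ?case by (metis Ck_on.simps(2))
qed

text \<open>The usual calculus rules produce \<open>has_derivative\<close> facts with an explicit
  derivative, while \<open>Ck_on\<close> speaks of \<open>frechet_derivative\<close>; this rule is
  the bridge for the inductions below.\<close>

lemma Ck_on_SucI:
  assumes "open S" "\<And>x. x \<in> S \<Longrightarrow> (f has_derivative f' x) (at x)" "\<And>v. Ck_on n S (\<lambda>x. f' x v)"
  shows "Ck_on (Suc n) S f"
proof -
  have "Ck_on n S (dird v f)" for v
    by (rule Ck_on_cong[OF assms(1) _ assms(3)[of v]]) (metis assms(2) frechet_derivative_at)
  then show ?thesis using assms(2) by (auto simp: differentiable_def)
qed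

lemma has_derivative_frechet: "f differentiable (at x) \<Longrightarrow> (f has_derivative (\<lambda>v. dird v f x)) (at x)"
  by (simp add: frechet_derivative_works)

lemma Ck_on_const: "Ck_on n S (\<lambda>x. c)"
proof (induction n arbitrary: c)
  case (Suc n)
  have "frechet_derivative (\<lambda>x. c) (at x) v = 0" for x v :: 'a by (simp add: frechet_derivative_const)
  then show ?case using Suc by simp
qed simp

lemma Ck_on_ident: "open S \<Longrightarrow> Ck_on n S (\<lambda>x. x)"
proof (cases n)
  case (Suc m)
  then show "open S \<Longrightarrow> Ck_on n S (\<lambda>x. x)"
    by (auto intro!: Ck_on_SucI[where f' = "\<lambda>x v. v"] Ck_on_const derivative_intros)
qed simp

lemma Ck_on_linear:
  assumes "bounded_linear L" "open S" "Ck_on n S f"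
  shows "Ck_on n S (\<lambda>x. L (f x))"
  using assms(3)
proof (induction n arbitrary: f)
  case 0
  then show ?case using bounded_linear.continuous_on[OF assms(1)] by auto
next
  case (Suc n)
  then show ?case
    by (intro Ck_on_SucI[OF assms(2), where f' = "\<lambda>x v. L (dird v f x)"]
        bounded_linear.has_derivative[OF assms(1)] has_derivative_frechet) auto
qed

lemma Ck_on_add:
  assumes "open S" "Ck_on n S f" "Ck_on n S g"
  shows "Ck_on n S (\<lambda>x. f x + g x)"
  using assms(2,3)
proof (induction n arbitrary: f g)
  case 0
  then show ?case by (auto intro: continuous_intros)
next
  case (Suc n)
  then show ?case
    by (intro Ck_on_SucI[OF assms(1), where f' = "\<lambda>x v. dird v f x + dird v g x"]
        has_derivative_add has_derivative_frechet) auto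
qed

lemma Ck_on_bilinear:
  assumes "bounded_bilinear b" "open S" "Ck_on n S f" "Ck_on n S g"
  shows "Ck_on n S (\<lambda>x. b (f x) (g x))"
  using assms(3,4)
proof (induction n arbitrary: f g)
  case 0
  then show ?case using bounded_bilinear.continuous_on[OF assms(1)] by auto
next
  case (Suc n)
  then show ?case
    by (intro Ck_on_SucI[OF assms(2), where f' = "\<lambda>x v. b (f x) (dird v g x) + b (dird v f x) (g x)"]
        bounded_bilinear.FDERIV[OF assms(1)] has_derivative_frechet Ck_on_add Suc.IH assms(2))
      (auto intro: Ck_on_SucD)
qed

lemma Ck_on_sum:
  assumes "open S" "\<And>i. i \<in> I \<Longrightarrow> Ck_on n S (f i)"
  shows "Ck_on n S (\<lambda>x. \<Sum>i\<in>I. f i x)"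
  using assms(2) by (induction I rule: infinite_finite_induct)
    (auto intro: Ck_on_const Ck_on_add assms(1))

text \<open>The chain rule differentiates \<open>g\<close> in the direction
  \<open>dird v f x\<close>, which varies with \<open>x\<close>, whereas \<open>Ck_on\<close> knows
  fixed directions only. Expanding the direction in the basis of the intermediate space makes the
  induction hypothesis applicable to each \<open>dird e g\<close>.\<close>

lemma Ck_on_compose:
  fixes g :: "'b::euclidean_space \<Rightarrow> 'c::real_normed_vector"
  assumes "open S" "Ck_on n S f" "Ck_on n T g" "f ` S \<subseteq> T"
  shows "Ck_on n S (\<lambda>x. g (f x))"
  using assms(2,3)
proof (induction n arbitrary: g)
  case 0
  then show ?case using assms(4) by (auto intro: continuous_on_compose2)
next
  case (Suc n)
  let ?D = "\<lambda>x v. \<Sum>e\<in>Basis. (dird v f x \<bullet> e) *\<^sub>R dird e g (f x)"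
  show ?case
  proof (rule Ck_on_SucI[OF assms(1), where f' = ?D])
    fix x assume x: "x \<in> S"
    then have df: "f differentiable (at x)" using Suc.prems by simp
    have dg: "g differentiable (at (f x))" using Suc.prems assms(4) x by auto
    have lin: "linear (frechet_derivative g (at (f x)))" by (rule linear_frechet_derivative[OF dg])
    have "frechet_derivative g (at (f x)) w = (\<Sum>e\<in>Basis. (w \<bullet> e) *\<^sub>R dird e g (f x))" for w
    proof -
      have "frechet_derivative g (at (f x)) w = frechet_derivative g (at (f x)) (\<Sum>e\<in>Basis. (w \<bullet> e) *\<^sub>R e)"
        by (simp only: euclidean_representation)
      also have "\<dots> = (\<Sum>e\<in>Basis. (w \<bullet> e) *\<^sub>R dird e g (f x))"
        by (simp only: linear_sum[OF lin] linear_cmul[OF lin])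
      finally show ?thesis .
    qed
    then have *: "(\<lambda>v. frechet_derivative g (at (f x)) (dird v f x)) = ?D x"
      by (intro ext) blast
    have "((\<lambda>x. g (f x)) has_derivative (\<lambda>v. frechet_derivative g (at (f x)) (dird v f x))) (at x)"
      using has_derivative_compose[OF has_derivative_frechet[OF df] has_derivative_frechet[OF dg]] .
    then show "((\<lambda>x. g (f x)) has_derivative ?D x) (at x)" unfolding * .
  next
    fix v
    have "Ck_on n S (dird v f)" "Ck_on n S f" using Suc.prems Ck_on_SucD by auto
    then show "Ck_on n S (\<lambda>x. ?D x v)" using Suc.prems
      by (intro Ck_on_sum assms(1) Ck_on_bilinear[OF bounded_bilinear_scaleR]
          Ck_on_linear[OF bounded_linear_inner_left] Suc.IH) auto
  qed
qed

lemma smooth_on_cong: "smooth_on S f \<Longrightarrow> open S \<Longrightarrow> (\<And>x. x \<in> S \<Longrightarrow> f x = g x) \<Longrightarrow> smooth_on S g"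
  unfolding smooth_on_def using Ck_on_cong by metis

lemma smooth_on_const: "smooth_on S (\<lambda>x. c)"
  by (simp add: smooth_on_def Ck_on_const)

lemma smooth_on_ident: "open S \<Longrightarrow> smooth_on S (\<lambda>x. x)"
  by (simp add: smooth_on_def Ck_on_ident)

lemma smooth_on_linear: "bounded_linear L \<Longrightarrow> open S \<Longrightarrow> smooth_on S f \<Longrightarrow> smooth_on S (\<lambda>x. L (f x))"
  by (simp add: smooth_on_def Ck_on_linear)

lemma smooth_on_add: "open S \<Longrightarrow> smooth_on S f \<Longrightarrow> smooth_on S g \<Longrightarrow> smooth_on S (\<lambda>x. f x + g x)"
  by (simp add: smooth_on_def Ck_on_add)

lemma smooth_on_bilinear:
  "bounded_bilinear b \<Longrightarrow> open S \<Longrightarrow> smooth_on S f \<Longrightarrow> smooth_on S g \<Longrightarrow> smooth_on S (\<lambda>x. b (f x) (g x))"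
  by (simp add: smooth_on_def Ck_on_bilinear)

lemmas smooth_on_mult = smooth_on_bilinear[OF bounded_bilinear_mult]
lemmas smooth_on_scaleR = smooth_on_bilinear[OF bounded_bilinear_scaleR]

lemma smooth_on_minus: "open S \<Longrightarrow> smooth_on S f \<Longrightarrow> smooth_on S (\<lambda>x. - f x)"
  by (rule smooth_on_linear[OF bounded_linear_minus[OF bounded_linear_ident]])

lemma smooth_on_diff: "open S \<Longrightarrow> smooth_on S f \<Longrightarrow> smooth_on S g \<Longrightarrow> smooth_on S (\<lambda>x. f x - g x)"
  using smooth_on_add[OF _ _ smooth_on_minus] by simp

lemma smooth_on_sum: "open S \<Longrightarrow> (\<And>i. i \<in> I \<Longrightarrow> smooth_on S (f i)) \<Longrightarrow> smooth_on S (\<lambda>x. \<Sum>i\<in>I. f i x)"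
  by (simp add: smooth_on_def Ck_on_sum)

lemma smooth_on_Pair:
  assumes "open S" "smooth_on S f" "smooth_on S g"
  shows "smooth_on S (\<lambda>x. (f x, g x))"
proof -
  have "bounded_linear (\<lambda>y::'b. (y, 0::'c))" "bounded_linear (\<lambda>y::'c. (0::'b, y))"
    by (auto intro!: bounded_linear_Pair bounded_linear_ident bounded_linear_zero)
  from smooth_on_add[OF assms(1) smooth_on_linear[OF this(1) assms(1,2)] smooth_on_linear[OF this(2) assms(1,3)]]
  show ?thesis by simp
qed

lemma smooth_on_compose:
  fixes g :: "'b::euclidean_space \<Rightarrow> 'c::real_normed_vector"
  shows "open S \<Longrightarrow> smooth_on S f \<Longrightarrow> smooth_on T g \<Longrightarrow> f ` S \<subseteq> T \<Longrightarrow> smooth_on S (\<lambda>x. g (f x))"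
  unfolding smooth_on_def using Ck_on_compose by blast

lemma smooth_on_dird: "smooth_on S f \<Longrightarrow> smooth_on S (dird v f)"
  unfolding smooth_on_def using Ck_on.simps(2) by blast

lemma smooth_on_differentiable: "smooth_on S f \<Longrightarrow> x \<in> S \<Longrightarrow> f differentiable (at x)"
  unfolding smooth_on_def using Ck_on.simps(2) by blast

lemma smooth_on_continuous: "smooth_on S f \<Longrightarrow> continuous_on S f"
  unfolding smooth_on_def using Ck_on.simps(1) by blast

section \<open>Derivatives along lines and symmetry of mixed derivatives\<close>

lemma has_vector_derivative_line:
  assumes "f differentiable (at (z + t *\<^sub>R v))"
  shows "((\<lambda>t. f (z + t *\<^sub>R v)) has_vector_derivative dird v f (z + t *\<^sub>R v)) (at t)"
proof -
  have "((\<lambda>t. z + t *\<^sub>R v) has_derivative (\<lambda>h. h *\<^sub>R v)) (at t)"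
    by (auto intro!: derivative_eq_intros)
  from has_derivative_compose[OF this has_derivative_frechet[OF assms]]
  show ?thesis
    unfolding has_vector_derivative_def by (simp add: linear_cmul[OF linear_frechet_derivative[OF assms]])
qed

lemma dir_deriv_dird: "f differentiable (at z) \<Longrightarrow> dir_deriv f v z = dird v f z"
  unfolding dir_deriv_def
  using has_vector_derivative_line[of f z 0 v] by (auto intro: vector_derivative_at)

lemma has_real_derivative_line:
  fixes f :: "'a::real_normed_vector \<Rightarrow> real"
  assumes "f differentiable (at (z + t *\<^sub>R v))"
  shows "((\<lambda>t. f (z + t *\<^sub>R v)) has_real_derivative dird v f (z + t *\<^sub>R v)) (at t)"
  using has_vector_derivative_line[OF assms] by (simp add: has_real_derivative_iff_has_vector_derivative)

lemma onorm_scaleR_line: "norm y \<le> C \<Longrightarrow> onorm (\<lambda>h. h *\<^sub>R y) \<le> C"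
  by (rule onorm_le) (simp, metis abs_ge_zero mult.commute mult_left_mono)

lemma line_increment_bound:
  fixes f :: "'a::real_normed_vector \<Rightarrow> 'b::real_normed_vector"
  assumes "a \<le> b" "\<And>t. a \<le> t \<Longrightarrow> t \<le> b \<Longrightarrow> f differentiable (at (z + t *\<^sub>R v))"
    "\<And>t. a \<le> t \<Longrightarrow> t \<le> b \<Longrightarrow> norm (dird v f (z + t *\<^sub>R v)) \<le> C"
  shows "norm (f (z + b *\<^sub>R v) - f (z + a *\<^sub>R v)) \<le> C * (b - a)"
proof -
  have "norm (f (z + b *\<^sub>R v) - f (z + a *\<^sub>R v)) \<le> C * norm (b - a)"
  proof (rule differentiable_bound[of "{a..b}" "\<lambda>t. f (z + t *\<^sub>R v)" "\<lambda>t h. h *\<^sub>R dird v f (z + t *\<^sub>R v)"])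
    fix t assume t: "t \<in> {a..b}"
    show "((\<lambda>t. f (z + t *\<^sub>R v)) has_derivative (\<lambda>h. h *\<^sub>R dird v f (z + t *\<^sub>R v))) (at t within {a..b})"
      using has_vector_derivative_line[OF assms(2)] t
      unfolding has_vector_derivative_def by (auto intro: has_derivative_at_withinI)
    show "onorm (\<lambda>h. h *\<^sub>R dird v f (z + t *\<^sub>R v)) \<le> C"
      using assms(3)[of t] t
      by (intro onorm_scaleR_line) auto
  qed (use assms in auto)
  then show ?thesis using assms(1) by simp
qed

lemma mixed_mean_value:
  fixes f :: "'a::real_normed_vector \<Rightarrow> real"
  assumes "0 < h"
    and sub: "\<And>a b. 0 \<le> a \<Longrightarrow> a \<le> h \<Longrightarrow> 0 \<le> b \<Longrightarrow> b \<le> h \<Longrightarrow> z + a *\<^sub>R v + b *\<^sub>R w \<in> S"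
    and f: "smooth_on S f"
  shows "\<exists>a b. 0 \<le> a \<and> a \<le> h \<and> 0 \<le> b \<and> b \<le> h \<and>
    f (z + h *\<^sub>R v + h *\<^sub>R w) - f (z + h *\<^sub>R w) - f (z + h *\<^sub>R v) + f z
      = h * h * dird v (dird w f) (z + a *\<^sub>R v + b *\<^sub>R w)"
proof -
  let ?g = "dird w f"
  have "\<exists>b. 0 < b \<and> b < h \<and>
      (f (z + h *\<^sub>R v + h *\<^sub>R w) - f (z + h *\<^sub>R w)) - (f (z + h *\<^sub>R v + 0 *\<^sub>R w) - f (z + 0 *\<^sub>R w))
      = (h - 0) * (?g (z + h *\<^sub>R v + b *\<^sub>R w) - ?g (z + b *\<^sub>R w))"
  proof (rule MVT2[OF assms(1)])
    fix b assume b: "0 \<le> b" "b \<le> h"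
    have "z + h *\<^sub>R v + b *\<^sub>R w \<in> S" "z + b *\<^sub>R w \<in> S" using sub[of h b] sub[of 0 b] b assms(1) by auto
    then show "((\<lambda>b. f (z + h *\<^sub>R v + b *\<^sub>R w) - f (z + b *\<^sub>R w)) has_real_derivative
      ?g (z + h *\<^sub>R v + b *\<^sub>R w) - ?g (z + b *\<^sub>R w)) (at b)"
      by (intro DERIV_diff has_real_derivative_line
          smooth_on_differentiable[OF f])
  qed
  then obtain b where b: "0 < b" "b < h"
    "f (z + h *\<^sub>R v + h *\<^sub>R w) - f (z + h *\<^sub>R w) - f (z + h *\<^sub>R v) + f z
      = h * (?g (z + h *\<^sub>R v + b *\<^sub>R w) - ?g (z + b *\<^sub>R w))" by auto
  have "\<exists>a. 0 < a \<and> a < h \<and> ?g (z + b *\<^sub>R w + h *\<^sub>R v) - ?g (z + b *\<^sub>R w + 0 *\<^sub>R v)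
      = (h - 0) * dird v ?g (z + b *\<^sub>R w + a *\<^sub>R v)"
  proof (rule MVT2[OF assms(1)])
    fix a assume a: "0 \<le> a" "a \<le> h"
    have "z + b *\<^sub>R w + a *\<^sub>R v \<in> S" using sub[of a b] a b by (simp add: algebra_simps)
    then show "((\<lambda>a. ?g (z + b *\<^sub>R w + a *\<^sub>R v)) has_real_derivative dird v ?g (z + b *\<^sub>R w + a *\<^sub>R v)) (at a)"
      by (intro has_real_derivative_line
          smooth_on_differentiable[OF smooth_on_dird[OF f]])
  qed
  then obtain a where a: "0 < a" "a < h"
    "?g (z + h *\<^sub>R v + b *\<^sub>R w) - ?g (z + b *\<^sub>R w) = h * dird v ?g (z + a *\<^sub>R v + b *\<^sub>R w)"
    by (auto simp: algebra_simps)
  show ?thesis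
    by (rule exI[of _ a], rule exI[of _ b]) (use a b in auto)
qed

text \<open>The same double difference over a small parallelogram equals \<open>h * h\<close> times
  either mixed derivative at some point of it. If the two derivatives differed at \<open>z\<close>,
  continuity would keep each within half of the gap, contradicting their equality at those
  points.\<close>

lemma dird_commute:
  fixes f :: "'a::real_normed_vector \<Rightarrow> real"
  assumes "open S" "smooth_on S f" "z \<in> S"
  shows "dird v (dird w f) z = dird w (dird v f) z"
proof (rule ccontr)
  let ?A = "dird v (dird w f)" and ?B = "dird w (dird v f)"
  assume "?A z \<noteq> ?B z"
  then have e: "\<bar>?A z - ?B z\<bar> / 2 > 0" (is "?e > 0") by simp
  have "isCont ?A z" "isCont ?B z"
    using smooth_on_continuous[OF smooth_on_dird[OF smooth_on_dird[OF assms(2)]]] assms(1,3)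
    by (simp_all add: continuous_on_eq_continuous_at)
  then obtain d1 d2 where d: "d1 > 0" "d2 > 0"
    "\<And>y. dist y z < d1 \<Longrightarrow> \<bar>?A y - ?A z\<bar> < ?e" "\<And>y. dist y z < d2 \<Longrightarrow> \<bar>?B y - ?B z\<bar> < ?e"
    using e unfolding continuous_at_eps_delta dist_real_def by metis
  obtain d3 where d3: "d3 > 0" "ball z d3 \<subseteq> S" using assms openE by blast
  define d where "d = min d1 (min d2 d3)"
  \<comment> \<open>Small enough for the parallelogram with sides \<open>h *\<^sub>R v\<close> and
    \<open>h *\<^sub>R w\<close> to stay within \<open>d\<close> of \<open>z\<close>; the summand 1
    covers the case that both vectors vanish.\<close>
  define h where "h = d / (norm v + norm w + 1)"
  have dpos: "d > 0" using d d3 by (simp add: d_def)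
  have hpos: "h > 0" using dpos by (simp add: h_def add_nonneg_pos)
  have near: "dist (z + a *\<^sub>R v + b *\<^sub>R w) z < d" if "0 \<le> a" "a \<le> h" "0 \<le> b" "b \<le> h" for a b
  proof -
    have "dist (z + a *\<^sub>R v + b *\<^sub>R w) z = norm (a *\<^sub>R v + b *\<^sub>R w)" by (simp add: dist_norm)
    also have "\<dots> \<le> a * norm v + b * norm w"
      using that norm_triangle_ineq[of "a *\<^sub>R v" "b *\<^sub>R w"] by simp
    also have "\<dots> \<le> h * norm v + h * norm w" using that by (intro add_mono mult_right_mono) auto
    also have "\<dots> < h * (norm v + norm w + 1)" using hpos by (simp add: algebra_simps)
    also have "\<dots> = d" unfolding h_def
      by (metis add_nonneg_pos add_nonneg_nonneg norm_ge_zero nonzero_eq_divide_eq order_less_irrefl zero_less_one)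
    finally show ?thesis .
  qed
  have inS: "z + a *\<^sub>R v + b *\<^sub>R w \<in> S" if "0 \<le> a" "a \<le> h" "0 \<le> b" "b \<le> h" for a b
    using near[OF that] d3 by (auto simp: d_def dist_commute)
  obtain a b where ab: "0 \<le> a" "a \<le> h" "0 \<le> b" "b \<le> h"
    "f (z + h *\<^sub>R v + h *\<^sub>R w) - f (z + h *\<^sub>R w) - f (z + h *\<^sub>R v) + f z = h * h * ?A (z + a *\<^sub>R v + b *\<^sub>R w)"
    using mixed_mean_value[OF hpos inS assms(2)] by blast
  have inS': "z + b *\<^sub>R w + a *\<^sub>R v \<in> S" if "0 \<le> b" "b \<le> h" "0 \<le> a" "a \<le> h" for a b
    using inS[OF that(3,4,1,2)] by (simp add: algebra_simps)
  obtain a' b' where ab': "0 \<le> a'" "a' \<le> h" "0 \<le> b'" "b' \<le> h"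
    "f (z + h *\<^sub>R w + h *\<^sub>R v) - f (z + h *\<^sub>R v) - f (z + h *\<^sub>R w) + f z = h * h * ?B (z + b' *\<^sub>R w + a' *\<^sub>R v)"
    using mixed_mean_value[OF hpos inS' assms(2)] by blast
  have "h * h * ?A (z + a *\<^sub>R v + b *\<^sub>R w) = h * h * ?B (z + a' *\<^sub>R v + b' *\<^sub>R w)"
    using ab(5) ab'(5) by (simp add: algebra_simps)
  then have "?A (z + a *\<^sub>R v + b *\<^sub>R w) = ?B (z + a' *\<^sub>R v + b' *\<^sub>R w)" using hpos by simp
  moreover have "\<bar>?A (z + a *\<^sub>R v + b *\<^sub>R w) - ?A z\<bar> < ?e" "\<bar>?B (z + a' *\<^sub>R v + b' *\<^sub>R w) - ?B z\<bar> < ?e"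
    using near[OF ab(1-4)] near[OF ab'(1-4)] d by (auto simp: d_def)
  ultimately show False by (simp add: abs_if split: if_splits)
qed

lemma taylor_bound:
  fixes d :: "nat \<Rightarrow> real \<Rightarrow> 'b::real_normed_vector"
  assumes "\<And>k t. k \<le> m \<Longrightarrow> \<bar>t\<bar> \<le> r \<Longrightarrow> (d k has_vector_derivative d (Suc k) t) (at t)"
    and "\<And>t. \<bar>t\<bar> \<le> r \<Longrightarrow> norm (d (Suc m) t) \<le> C" and "\<bar>t\<bar> \<le> r"
  shows "norm (d 0 t - (\<Sum>k\<le>m. (t ^ k / fact k) *\<^sub>R d k 0)) \<le> C * \<bar>t\<bar> ^ Suc m"
  using assms
proof (induction m arbitrary: d t)
  case 0
  have "norm (d 0 t - d 0 0) \<le> C * norm (t - 0)"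
  proof (rule differentiable_bound[of "closed_segment 0 t" "d 0" "\<lambda>s h. h *\<^sub>R d 1 s"])
    fix s assume "s \<in> closed_segment 0 t"
    then have s: "\<bar>s\<bar> \<le> r" using "0.prems"(3) by (auto simp: closed_segment_eq_real_ivl split: if_splits)
    show "(d 0 has_derivative (\<lambda>h. h *\<^sub>R d 1 s)) (at s within closed_segment 0 t)"
      using "0.prems"(1)[of 0 s] s unfolding has_vector_derivative_def
      by (auto intro: has_derivative_at_withinI)
    show "onorm (\<lambda>h. h *\<^sub>R d 1 s) \<le> C"
      using "0.prems"(2)[OF s] by (intro onorm_scaleR_line) simp
  qed auto
  then show ?case by simp
next
  case (Suc m)
  let ?R = "\<lambda>t. d 0 t - (\<Sum>k\<le>Suc m. (t ^ k / fact k) *\<^sub>R d k 0)"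
  let ?R' = "\<lambda>t. d 1 t - (\<Sum>k\<le>m. (t ^ k / fact k) *\<^sub>R d (Suc k) 0)"
  have C: "C \<ge> 0" using Suc.prems(2)[of 0] Suc.prems(3) norm_ge_zero order_trans by (metis abs_ge_zero abs_zero)
  have IH: "norm (?R' s) \<le> C * \<bar>s\<bar> ^ Suc m" if "\<bar>s\<bar> \<le> r" for s
    using Suc.IH[of "\<lambda>k. d (Suc k)" s] Suc.prems(1,2) that by simp
  have der: "(?R has_vector_derivative ?R' s) (at s)" if "\<bar>s\<bar> \<le> r" for s
  proof -
    have eq: "?R = (\<lambda>t. d 0 t - (d 0 0 + (\<Sum>k\<le>m. (t ^ Suc k / fact (Suc k)) *\<^sub>R d (Suc k) 0)))"
      by (simp only: sum.atMost_Suc_shift) simp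
    have "((\<lambda>t. (t ^ Suc k / fact (Suc k)) *\<^sub>R d (Suc k) 0) has_vector_derivative
        (s ^ k / fact k) *\<^sub>R d (Suc k) 0) (at s)" for k
    proof -
      have "((\<lambda>t. t ^ Suc k / fact (Suc k)) has_real_derivative s ^ k / fact k) (at s)"
        using DERIV_cdivide[OF DERIV_pow[of "Suc k" s UNIV], of "fact (Suc k)"]
        by (simp add: fact_Suc del: of_nat_Suc)
      from has_vector_derivative_scaleR[OF this has_vector_derivative_const]
      show ?thesis by simp
    qed
    then have "((\<lambda>t. d 0 t - (d 0 0 + (\<Sum>k\<le>m. (t ^ Suc k / fact (Suc k)) *\<^sub>R d (Suc k) 0)))
        has_vector_derivative d 1 s - (0 + (\<Sum>k\<le>m. (s ^ k / fact k) *\<^sub>R d (Suc k) 0))) (at s)"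
      using Suc.prems(1)[of 0 s] that
      by (intro has_vector_derivative_diff has_vector_derivative_add has_vector_derivative_const
          has_vector_derivative_sum) auto
    then show ?thesis unfolding eq by simp
  qed
  have "norm (?R t - ?R 0) \<le> (C * \<bar>t\<bar> ^ Suc m) * norm (t - 0)"
  proof (rule differentiable_bound[of "closed_segment 0 t" ?R "\<lambda>s h. h *\<^sub>R ?R' s"])
    fix s assume "s \<in> closed_segment 0 t"
    then have st: "\<bar>s\<bar> \<le> \<bar>t\<bar>" by (auto simp: closed_segment_eq_real_ivl split: if_splits)
    then have s: "\<bar>s\<bar> \<le> r" using Suc.prems(3) by simp
    show "(?R has_derivative (\<lambda>h. h *\<^sub>R ?R' s)) (at s within closed_segment 0 t)"
      using der[OF s] unfolding has_vector_derivative_def by (auto intro: has_derivative_at_withinI)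
    have "norm (?R' s) \<le> C * \<bar>t\<bar> ^ Suc m"
      using IH[OF s] mult_left_mono[OF power_mono[OF st] C, of "Suc m"] by simp
    then show "onorm (\<lambda>h. h *\<^sub>R ?R' s) \<le> C * \<bar>t\<bar> ^ Suc m"
      by (intro onorm_scaleR_line) auto
  qed auto
  moreover have "?R 0 = 0" by (simp only: sum.atMost_Suc_shift) simp
  ultimately have "norm (?R t) \<le> (C * \<bar>t\<bar> ^ Suc m) * \<bar>t\<bar>" by simp
  also have "\<dots> = C * \<bar>t\<bar> ^ Suc (Suc m)" by (simp add: algebra_simps)
  finally show ?case .
qed

text \<open>Stencils based at points of \<open>K\<close> leave \<open>K\<close>. The closed
  neighbourhood is still compact and still inside the domain, so that bounds on it are uniform over
  all small stencils.\<close>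

lemma compact_enlarge:
  fixes K :: "'a::euclidean_space set"
  assumes "compact K" "open S" "K \<subseteq> S"
  obtains \<rho> where "\<rho> > 0" "compact (\<Union>x\<in>K. cball x \<rho>)" "(\<Union>x\<in>K. cball x \<rho>) \<subseteq> S"
proof -
  obtain \<rho> where r: "\<rho> > 0" "(\<Union>x\<in>K. cball x \<rho>) \<subseteq> S"
    using compact_subset_open_imp_cball_epsilon_subset[OF assms] by blast
  have "compact {x + y | x y. x \<in> K \<and> y \<in> cball 0 \<rho>}"
    by (rule compact_sums[OF assms(1) compact_cball])
  moreover have "{x + y | x y. x \<in> K \<and> y \<in> cball 0 \<rho>} = (\<Union>x\<in>K. cball x \<rho>)"
  proof (intro set_eqI iffI)
    fix z assume "z \<in> (\<Union>x\<in>K. cball x \<rho>)"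
    then obtain x where "x \<in> K" "dist x z \<le> \<rho>" by auto
    then show "z \<in> {x + y | x y. x \<in> K \<and> y \<in> cball 0 \<rho>}"
      by (intro CollectI exI[of _ x] exI[of _ "z - x"]) (auto simp: dist_norm norm_minus_commute)
  next
    fix z assume "z \<in> {x + y | x y. x \<in> K \<and> y \<in> cball 0 \<rho>}"
    then obtain x y where "x \<in> K" "norm y \<le> \<rho>" "z = x + y" by auto
    then show "z \<in> (\<Union>x\<in>K. cball x \<rho>)" by (intro UN_I[of x]) (auto simp: dist_norm)
  qed
  ultimately have "compact (\<Union>x\<in>K. cball x \<rho>)" by simp
  then show ?thesis using r that by blast
qed

text \<open>Unnormalised, with the step contained in \<open>d\<close>: under
  \<open>order_coeffs\<close> it approximates twice the derivative in the direction
  \<open>d\<close>.\<close>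

definition cdiff :: "nat \<Rightarrow> (nat \<Rightarrow> real) \<Rightarrow> 'a::real_vector \<Rightarrow> ('a \<Rightarrow> 'b::real_vector) \<Rightarrow> 'a \<Rightarrow> 'b" where
  "cdiff p \<alpha> d f z = (\<Sum>n=1..p. \<alpha> n *\<^sub>R (f (z + real n *\<^sub>R d) - f (z - real n *\<^sub>R d)))"

text \<open>Even powers cancel by antisymmetry of the stencil, and the odd ones up to
  \<open>2 * p - 1\<close> are exactly those prescribed. So \<open>p\<close> conditions control all
  degrees up to \<open>2 * p\<close>, the source of the doubled order.\<close>

lemma order_coeffs_moment:
  assumes "order_coeffs p \<alpha>" "k \<le> 2 * p"
  shows "(\<Sum>n=1..p. \<alpha> n * (real n ^ k - (- real n) ^ k)) = (if k = 1 then 2 else 0)"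
proof (cases "even k")
  case True
  then show ?thesis by auto
next
  case False
  then have "(\<Sum>n=1..p. \<alpha> n * (real n ^ k - (- real n) ^ k)) = 2 * (\<Sum>n=1..p. real n ^ k * \<alpha> n)"
    unfolding sum_distrib_left by (intro sum.cong refl) (simp add: algebra_simps)
  moreover have "(\<Sum>n=1..p. real n ^ k * \<alpha> n) = (if k = 1 then 1 else 0)"
  proof (cases "k = 1")
    case True
    then show ?thesis using assms(1) by (simp add: order_coeffs_def)
  next
    case k: False
    obtain s where s: "k = 2 * s + 1" using False oddE by blast
    then have s2: "Suc s \<in> {2..p}" and eq: "k = 2 * Suc s - 1" using assms(2) k by auto
    have "\<forall>s\<in>{2..p}. (\<Sum>n=1..p. real n ^ (2 * s - 1) * \<alpha> n) = 0"
      using assms(1) by (simp add: order_coeffs_def)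
    from bspec[OF this s2, folded eq] show ?thesis using k by simp
  qed
  ultimately show ?thesis by simp
qed

text \<open>The central difference treats the Taylor polynomial of degree \<open>2 * p\<close>
  exactly, so only the remainders at the stencil points count, and these are bounded uniformly on a
  compact neighbourhood of \<open>K\<close>.\<close>

lemma cdiff_accuracy:
  fixes f :: "'a::euclidean_space \<Rightarrow> 'b::real_normed_vector"
  assumes oc: "order_coeffs p \<alpha>" and "open S" "compact K" "K \<subseteq> S" and f: "smooth_on S f"
  shows "\<exists>C \<epsilon>. \<epsilon> > 0 \<and> (\<forall>z\<in>K. \<forall>h. 0 < h \<and> h < \<epsilon> \<longrightarrow>
    norm (cdiff p \<alpha> (h *\<^sub>R v) f z - (2 * h) *\<^sub>R dird v f z) \<le> C * h ^ (2 * p + 1))"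
proof -
  obtain \<rho> where rho: "\<rho> > 0" "compact (\<Union>x\<in>K. cball x \<rho>)" "(\<Union>x\<in>K. cball x \<rho>) \<subseteq> S"
    by (rule compact_enlarge[OF assms(3,2,4)])
  define L where "L = (\<Union>x\<in>K. cball x \<rho>)"
  have L: "\<rho> > 0" "compact L" "L \<subseteq> S" "\<And>x y. x \<in> K \<Longrightarrow> dist x y \<le> \<rho> \<Longrightarrow> y \<in> L"
    using rho by (auto simp: L_def)
  define D where "D k = (dird v ^^ k) f" for k
  have D0: "D 0 = f" and DS: "D (Suc k) = dird v (D k)" for k by (auto simp: D_def)
  have sm: "smooth_on S (D k)" for k
    by (induction k) (auto simp: D0 DS f intro: smooth_on_dird)
  have "bounded (D (Suc (2 * p)) ` L)"
    by (intro compact_imp_bounded compact_continuous_image L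
        continuous_on_subset[OF smooth_on_continuous[OF sm] L(3)])
  then obtain C0 where C0: "\<And>x. x \<in> L \<Longrightarrow> norm (D (Suc (2 * p)) x) \<le> C0"
    unfolding bounded_iff by auto
  define r where "r = \<rho> / (norm v + 1)"
  have rpos: "r > 0" using L(1) by (simp add: r_def add_nonneg_pos)
  have inL: "z + t *\<^sub>R v \<in> L" if "z \<in> K" "\<bar>t\<bar> \<le> r" for z t
  proof (rule L(4)[OF that(1)])
    have "\<bar>t\<bar> * norm v \<le> r * (norm v + 1)" using that by (intro mult_mono) auto
    also have "\<dots> = \<rho>" by (simp add: r_def add_nonneg_eq_0_iff)
    finally show "dist z (z + t *\<^sub>R v) \<le> \<rho>" by (simp add: dist_norm)
  qed
  have tay: "norm (f (z + t *\<^sub>R v) - (\<Sum>k\<le>2*p. (t ^ k / fact k) *\<^sub>R D k z)) \<le> C0 * \<bar>t\<bar> ^ Suc (2 * p)"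
    if "z \<in> K" "\<bar>t\<bar> \<le> r" for z t
  proof -
    have "norm (D 0 (z + t *\<^sub>R v) - (\<Sum>k\<le>2*p. (t ^ k / fact k) *\<^sub>R D k (z + 0 *\<^sub>R v))) \<le> C0 * \<bar>t\<bar> ^ Suc (2 * p)"
      by (rule taylor_bound[where d = "\<lambda>k t. D k (z + t *\<^sub>R v)" and r = r])
        (use that inL L(3) C0 in \<open>auto simp: DS intro!: has_vector_derivative_line smooth_on_differentiable[OF sm]\<close>)
    then show ?thesis by (simp add: D0)
  qed
  define A where "A = (\<Sum>n=1..p. \<bar>\<alpha> n\<bar> * real n ^ Suc (2 * p))"
  have "norm (cdiff p \<alpha> (h *\<^sub>R v) f z - (2 * h) *\<^sub>R dird v f z) \<le> (2 * C0 * A) * h ^ (2 * p + 1)"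
    if z: "z \<in> K" and h: "0 < h" "h < r / (real p + 1)" for z h
  proof -
    define P where "P t = (\<Sum>k\<le>2*p. (t ^ k / fact k) *\<^sub>R D k z)" for t
    let ?E = "\<lambda>t. f (z + t *\<^sub>R v) - P t"
    have pw: "\<alpha> n * ((real n * h) ^ k / fact k - (- (real n * h)) ^ k / fact k)
        = \<alpha> n * (real n ^ k - (- real n) ^ k) * (h ^ k / fact k)" for n k
    proof -
      have "(- (real n * h)) ^ k = (- real n) ^ k * h ^ k"
        by (simp only: power_mult_distrib[symmetric] mult_minus_left)
      then show ?thesis by (simp add: power_mult_distrib diff_divide_distrib algebra_simps)
    qed
    have "(\<Sum>n=1..p. \<alpha> n *\<^sub>R (P (real n * h) - P (- (real n * h))))
      = (\<Sum>n=1..p. \<Sum>k\<le>2*p. (\<alpha> n * (real n ^ k - (- real n) ^ k) * (h ^ k / fact k)) *\<^sub>R D k z)"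
      unfolding P_def sum_subtractf[symmetric] scaleR_sum_right scaleR_left_diff_distrib[symmetric] scaleR_scaleR
      by (intro sum.cong refl arg_cong2[where f = scaleR] pw)
    also have "\<dots> = (\<Sum>k\<le>2*p. ((\<Sum>n=1..p. \<alpha> n * (real n ^ k - (- real n) ^ k)) * (h ^ k / fact k)) *\<^sub>R D k z)"
      by (subst sum.swap) (simp only: scaleR_sum_left sum_distrib_right)
    also have "\<dots> = (\<Sum>k\<le>2*p. if k = 1 then (2 * h) *\<^sub>R D 1 z else 0)"
      by (intro sum.cong refl, subst order_coeffs_moment[OF oc]) auto
    also have "\<dots> = (2 * h) *\<^sub>R dird v f z"
    proof -
      \<comment> \<open>An empty sum cannot equal 1. For \<open>p = 0\<close> the degree
        \<open>k = 1\<close> would be missing from the sum.\<close>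
      have "p \<noteq> 0" using oc by (intro notI) (simp add: order_coeffs_def)
      then show ?thesis by (simp add: DS[of 0, simplified] D0)
    qed
    finally have T: "(\<Sum>n=1..p. \<alpha> n *\<^sub>R (P (real n * h) - P (- (real n * h)))) = (2 * h) *\<^sub>R dird v f z" .
    have "cdiff p \<alpha> (h *\<^sub>R v) f z - (2 * h) *\<^sub>R dird v f z
        = (\<Sum>n=1..p. \<alpha> n *\<^sub>R (?E (real n * h) - ?E (- (real n * h))))"
      unfolding cdiff_def T[symmetric] sum_subtractf[symmetric] scaleR_right_diff_distrib[symmetric]
      by (intro sum.cong refl arg_cong2[where f = scaleR]) (simp add: algebra_simps)
    \<comment> \<open>Each \<open>n\<close> contributes two remainders, at offsets
      \<open>real n * h\<close> and its negative, which is the origin of the constant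
      \<open>2 * C0 * A\<close>.\<close>
    also have "norm \<dots> \<le> (\<Sum>n=1..p. \<bar>\<alpha> n\<bar> * (2 * C0 * (real n * h) ^ Suc (2 * p)))"
    proof (rule sum_norm_le)
      fix n assume n: "n \<in> {1..p}"
      have "real n * h \<le> (real p + 1) * h" using n h by (intro mult_right_mono) auto
      also have "\<dots> \<le> r" using h by (simp add: pos_less_divide_eq mult.commute less_imp_le)
      finally have nh: "\<bar>real n * h\<bar> \<le> r" "\<bar>- (real n * h)\<bar> \<le> r" using h by auto
      have "norm (?E (real n * h) - ?E (- (real n * h))) \<le> norm (?E (real n * h)) + norm (?E (- (real n * h)))"
        by (rule norm_triangle_ineq4)
      also have "\<dots> \<le> C0 * \<bar>real n * h\<bar> ^ Suc (2 * p) + C0 * \<bar>- (real n * h)\<bar> ^ Suc (2 * p)"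
        unfolding P_def by (intro add_mono tay z nh)
      also have "\<dots> = 2 * C0 * (real n * h) ^ Suc (2 * p)" using h by simp
      finally show "norm (\<alpha> n *\<^sub>R (?E (real n * h) - ?E (- (real n * h))))
        \<le> \<bar>\<alpha> n\<bar> * (2 * C0 * (real n * h) ^ Suc (2 * p))"
        by (simp add: mult_left_mono)
    qed
    also have "\<dots> = (2 * C0 * A) * h ^ (2 * p + 1)"
      unfolding A_def sum_distrib_left sum_distrib_right
      by (intro sum.cong refl) (simp add: power_mult_distrib algebra_simps)
    finally show ?thesis .
  qed
  moreover have "r / (real p + 1) > 0" using rpos by simp
  ultimately show ?thesis by blast
qed

section \<open>Families with uniformly bounded derivatives\<close>

text \<open>Uniform bounds of size \<open>w\<close> for all directional derivatives up to order
  \<open>n\<close>. The constants are independent of the point and of the family index. The bounds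
  hold only eventually, because stencils fit into the domain only for small steps; constant and
  threshold may depend on the directions.\<close>

primrec Ck_bound ::
  "nat \<Rightarrow> 'i filter \<Rightarrow> ('i \<Rightarrow> real) \<Rightarrow> 'a::real_normed_vector set \<Rightarrow> ('i \<Rightarrow> 'a \<Rightarrow> real) \<Rightarrow> bool"
where
  "Ck_bound 0 F w S r \<longleftrightarrow> (\<exists>C. \<forall>\<^sub>F i in F. \<forall>x\<in>S. \<bar>r i x\<bar> \<le> C * w i)"
| "Ck_bound (Suc n) F w S r \<longleftrightarrow> (\<exists>C. \<forall>\<^sub>F i in F. \<forall>x\<in>S. \<bar>r i x\<bar> \<le> C * w i) \<and>
    (\<forall>\<^sub>F i in F. \<forall>x\<in>S. r i differentiable (at x)) \<and>
    (\<forall>v. Ck_bound n F w S (\<lambda>i. dird v (r i)))"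

lemma Ck_bound_0: "Ck_bound n F w S r \<Longrightarrow> Ck_bound 0 F w S r"
  by (cases n) auto

lemma Ck_bound_SucD: "Ck_bound (Suc n) F w S r \<Longrightarrow> Ck_bound n F w S r"
  by (induction n arbitrary: r) auto

lemma Ck_bound_cong:
  assumes "open S" "\<forall>\<^sub>F i in F. \<forall>x\<in>S. r i x = r' i x" "Ck_bound n F w S r"
  shows "Ck_bound n F w S r'"
  using assms(2,3)
proof (induction n arbitrary: r r')
  case 0
  then obtain C where "\<forall>\<^sub>F i in F. \<forall>x\<in>S. \<bar>r i x\<bar> \<le> C * w i" by auto
  then have "\<forall>\<^sub>F i in F. \<forall>x\<in>S. \<bar>r' i x\<bar> \<le> C * w i" using 0(1) by eventually_elim auto
  then show ?case by auto
next
  case (Suc n)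
  then obtain C where C: "\<forall>\<^sub>F i in F. \<forall>x\<in>S. \<bar>r i x\<bar> \<le> C * w i"
    and d: "\<forall>\<^sub>F i in F. \<forall>x\<in>S. r i differentiable (at x)" by auto
  have "\<forall>\<^sub>F i in F. \<forall>x\<in>S. \<bar>r' i x\<bar> \<le> C * w i" using C Suc(2) by eventually_elim auto
  moreover have d': "\<forall>\<^sub>F i in F. \<forall>x\<in>S. r' i differentiable (at x) \<and> (\<forall>v. dird v (r i) x = dird v (r' i) x)"
    using d Suc(2)
  proof eventually_elim
    case (elim i)
    show ?case
    proof (intro ballI)
      fix x assume x: "x \<in> S"
      have "(r' i has_derivative frechet_derivative (r i) (at x)) (at x)"
        by (rule has_derivative_transform_within_open[OF has_derivative_frechet assms(1) x])
          (use elim x in auto)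
      then show "r' i differentiable (at x) \<and> (\<forall>v. dird v (r i) x = dird v (r' i) x)"
        using frechet_derivative_at by (metis differentiable_def)
    qed
  qed
  moreover have "Ck_bound n F w S (\<lambda>i. dird v (r' i))" for v
  proof (rule Suc.IH)
    show "\<forall>\<^sub>F i in F. \<forall>x\<in>S. dird v (r i) x = dird v (r' i) x" using d' by eventually_elim auto
    show "Ck_bound n F w S (\<lambda>i. dird v (r i))" using Suc by simp
  qed
  ultimately show ?case by (auto elim: eventually_mono)
qed

lemma Ck_bound_SucI:
  assumes "open S" "Ck_bound 0 F w S r"
    "\<forall>\<^sub>F i in F. \<forall>x\<in>S. (r i has_derivative r' i x) (at x)"
    "\<And>v. Ck_bound n F w S (\<lambda>i x. r' i x v)"
  shows "Ck_bound (Suc n) F w S r"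
proof -
  have "\<forall>\<^sub>F i in F. \<forall>x\<in>S. r i differentiable (at x)"
    using assms(3) by eventually_elim (auto simp: differentiable_def)
  moreover have "Ck_bound n F w S (\<lambda>i. dird v (r i))" for v
  proof (rule Ck_bound_cong[OF assms(1) _ assms(4)[of v]])
    show "\<forall>\<^sub>F i in F. \<forall>x\<in>S. r' i x v = dird v (r i) x"
      using assms(3) by eventually_elim (metis frechet_derivative_at)
  qed
  ultimately show ?thesis using assms(2) by simp
qed

lemma Ck_bound_diffD:
  assumes "Ck_bound (Suc n) F w S r"
  shows "\<forall>\<^sub>F i in F. \<forall>x\<in>S. (r i has_derivative (\<lambda>v. dird v (r i) x)) (at x)"
proof -
  have "\<forall>\<^sub>F i in F. \<forall>x\<in>S. r i differentiable (at x)" using assms by simp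
  then show ?thesis by eventually_elim (auto intro: has_derivative_frechet)
qed

lemma Ck_bound_add:
  assumes "open S" "Ck_bound n F w S f" "Ck_bound n F w S g"
  shows "Ck_bound n F w S (\<lambda>i x. f i x + g i x)"
  using assms(2,3)
proof (induction n arbitrary: f g)
  case 0
  then obtain C D where "\<forall>\<^sub>F i in F. \<forall>x\<in>S. \<bar>f i x\<bar> \<le> C * w i" "\<forall>\<^sub>F i in F. \<forall>x\<in>S. \<bar>g i x\<bar> \<le> D * w i" by auto
  then have "\<forall>\<^sub>F i in F. \<forall>x\<in>S. \<bar>f i x + g i x\<bar> \<le> (C + D) * w i"
    by eventually_elim (fastforce simp: distrib_right intro: order_trans[OF abs_triangle_ineq] add_mono)
  then show ?case by auto
next
  case (Suc n)
  show ?case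
  proof (rule Ck_bound_SucI[OF assms(1), where r' = "\<lambda>i x v. dird v (f i) x + dird v (g i) x"])
    have "Ck_bound n F w S f" "Ck_bound n F w S g" using Suc Ck_bound_SucD by blast+
    then show "Ck_bound 0 F w S (\<lambda>i x. f i x + g i x)" using Suc.IH Ck_bound_0 by blast
    show "\<forall>\<^sub>F i in F. \<forall>x\<in>S. ((\<lambda>x. f i x + g i x) has_derivative (\<lambda>v. dird v (f i) x + dird v (g i) x)) (at x)"
      using Ck_bound_diffD[OF Suc.prems(1)] Ck_bound_diffD[OF Suc.prems(2)]
      by eventually_elim (auto intro: has_derivative_add)
    show "Ck_bound n F w S (\<lambda>i x. dird v (f i) x + dird v (g i) x)" for v
      using Suc by simp
  qed
qed

lemma Ck_bound_mult:
  assumes "open S" "Ck_bound n F w1 S f" "Ck_bound n F w2 S g"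
  shows "Ck_bound n F (\<lambda>i. w1 i * w2 i) S (\<lambda>i x. f i x * g i x)"
  using assms(2,3)
proof (induction n arbitrary: f g)
  case 0
  then obtain C D where "\<forall>\<^sub>F i in F. \<forall>x\<in>S. \<bar>f i x\<bar> \<le> C * w1 i" "\<forall>\<^sub>F i in F. \<forall>x\<in>S. \<bar>g i x\<bar> \<le> D * w2 i" by auto
  then have "\<forall>\<^sub>F i in F. \<forall>x\<in>S. \<bar>f i x * g i x\<bar> \<le> (C * D) * (w1 i * w2 i)"
  proof eventually_elim
    case (elim i)
    show ?case
    proof
      fix x assume x: "x \<in> S"
      have "\<bar>f i x\<bar> * \<bar>g i x\<bar> \<le> (C * w1 i) * (D * w2 i)"
        using elim x by (intro mult_mono) (auto intro: order_trans[OF abs_ge_zero])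
      then show "\<bar>f i x * g i x\<bar> \<le> (C * D) * (w1 i * w2 i)" by (simp add: abs_mult algebra_simps)
    qed
  qed
  then show ?case by (simp only: Ck_bound.simps) blast
next
  case (Suc n)
  have fg: "Ck_bound n F w1 S f" "Ck_bound n F w2 S g" using Suc Ck_bound_SucD by blast+
  show ?case
  proof (rule Ck_bound_SucI[OF assms(1), where r' = "\<lambda>i x v. f i x * dird v (g i) x + dird v (f i) x * g i x"])
    show "Ck_bound 0 F (\<lambda>i. w1 i * w2 i) S (\<lambda>i x. f i x * g i x)" using Suc.IH[OF fg] Ck_bound_0 by blast
    show "\<forall>\<^sub>F i in F. \<forall>x\<in>S. ((\<lambda>x. f i x * g i x) has_derivative
        (\<lambda>v. f i x * dird v (g i) x + dird v (f i) x * g i x)) (at x)"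
      using Ck_bound_diffD[OF Suc.prems(1)] Ck_bound_diffD[OF Suc.prems(2)]
      by eventually_elim (auto intro: has_derivative_mult)
    show "Ck_bound n F (\<lambda>i. w1 i * w2 i) S (\<lambda>i x. f i x * dird v (g i) x + dird v (f i) x * g i x)" for v
      using Suc fg by (intro Ck_bound_add[OF assms(1)] Suc.IH) auto
  qed
qed

lemma Ck_bound_weight:
  assumes "Ck_bound n F w S r" "\<forall>\<^sub>F i in F. 0 \<le> w i \<and> w i \<le> w' i"
  shows "Ck_bound n F w' S r"
  using assms(1)
proof (induction n arbitrary: r)
  case 0
  then obtain C where "\<forall>\<^sub>F i in F. \<forall>x\<in>S. \<bar>r i x\<bar> \<le> C * w i" by auto
  then have "\<forall>\<^sub>F i in F. \<forall>x\<in>S. \<bar>r i x\<bar> \<le> \<bar>C\<bar> * w' i" using assms(2)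
  proof eventually_elim
    case (elim i)
    have "C * w i \<le> \<bar>C\<bar> * w' i" using elim by (intro mult_mono) auto
    then show ?case using elim by (auto intro: order_trans)
  qed
  then show ?case by auto
next
  case (Suc n)
  have "Ck_bound n F w' S r" using Suc Ck_bound_SucD by blast
  then have "Ck_bound 0 F w' S r" by (rule Ck_bound_0)
  then show ?case using Suc by simp
qed

lemma Ck_bound_fixed:
  assumes "open S" "S \<subseteq> L" "compact L" "L \<subseteq> S'" "smooth_on S' f"
  shows "Ck_bound n F (\<lambda>_. 1) S (\<lambda>_. f)"
  using assms(5)
proof (induction n arbitrary: f)
  case 0
  have "bounded (f ` L)"
    by (intro compact_imp_bounded compact_continuous_image assms
        continuous_on_subset[OF smooth_on_continuous[OF 0]])
  then obtain C where "\<And>x. x \<in> L \<Longrightarrow> norm (f x) \<le> C" unfolding bounded_iff by auto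
  then have "\<forall>x\<in>S. \<bar>f x\<bar> \<le> C * 1" using assms(2) by auto
  then show ?case by (auto intro: always_eventually)
next
  case (Suc n)
  have "f differentiable (at x)" if "x \<in> S" for x
    using smooth_on_differentiable[OF Suc.prems] that assms by blast
  moreover have "Ck_bound 0 F (\<lambda>_. 1) S (\<lambda>_. f)" using Suc.IH[OF Suc.prems] by (rule Ck_bound_0)
  moreover have "Ck_bound n F (\<lambda>_. 1) S (\<lambda>_. dird v f)" for v
    using Suc.IH[OF smooth_on_dird[OF Suc.prems]] .
  ultimately show ?case by simp
qed

lemma Ck_bound_mult_fixed:
  assumes "open S" "S \<subseteq> L" "compact L" "L \<subseteq> S'" "smooth_on S' f" "Ck_bound n F w S r"
  shows "Ck_bound n F w S (\<lambda>i x. f x * r i x)"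
  using Ck_bound_mult[OF assms(1) Ck_bound_fixed[OF assms(1-5)] assms(6)] by simp

lemma Ck_bound_cmult:
  assumes "open S" "Ck_bound n F w S r"
  shows "Ck_bound n F w S (\<lambda>i x. c * r i x)"
proof -
  have "Ck_bound n F (\<lambda>_. 1) S (\<lambda>_ _. c)" for c
  proof (induction n arbitrary: c)
    case 0
    have "\<forall>x\<in>S. \<bar>c\<bar> \<le> \<bar>c\<bar> * 1" by simp
    then show ?case by (simp only: Ck_bound.simps) (blast intro: always_eventually)
  next
    case (Suc n)
    have "Ck_bound 0 F (\<lambda>_. 1) S (\<lambda>_ _. c)" using Suc.IH[of c] by (rule Ck_bound_0)
    then show ?case using Suc.IH[of 0] by (simp add: frechet_derivative_const)
  qed
  from Ck_bound_mult[OF assms(1) this assms(2)] show ?thesis by simp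
qed

lemma Ck_bound_minus: "open S \<Longrightarrow> Ck_bound n F w S r \<Longrightarrow> Ck_bound n F w S (\<lambda>i x. - r i x)"
  using Ck_bound_cmult[of S n F w r "-1"] by simp

lemma Ck_bound_diff:
  "open S \<Longrightarrow> Ck_bound n F w S f \<Longrightarrow> Ck_bound n F w S g \<Longrightarrow> Ck_bound n F w S (\<lambda>i x. f i x - g i x)"
  using Ck_bound_add[OF _ _ Ck_bound_minus, of S n F w f g] by simp

lemma Ck_bound_sum:
  assumes "open S" "finite I" "I \<noteq> {}" "\<And>j. j \<in> I \<Longrightarrow> Ck_bound n F w S (f j)"
  shows "Ck_bound n F w S (\<lambda>i x. \<Sum>j\<in>I. f j i x)"
  using assms(2-4)
  by (induction I rule: finite_ne_induct) (auto intro: Ck_bound_add assms(1))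

section \<open>Central difference quotients of such families\<close>

definition cquot :: "nat \<Rightarrow> (nat \<Rightarrow> real) \<Rightarrow> real \<Rightarrow> 'a::real_vector \<Rightarrow> ('a \<Rightarrow> real) \<Rightarrow> 'a \<Rightarrow> real" where
  "cquot p \<alpha> h v f z = (1 / (2 * h)) * cdiff p \<alpha> (h *\<^sub>R v) f z"

lemma has_derivative_shift:
  assumes "(f has_derivative D) (at (x + c))"
  shows "((\<lambda>x. f (x + c)) has_derivative D) (at x)"
  using has_derivative_compose[of "\<lambda>x. x + c" "\<lambda>x. x" x UNIV f D] assms
  by (simp add: has_derivative_add_const)

text \<open>A quotient is a finite combination of translates, so it commutes with differentiation.
  This fact drives both inductions below.\<close>

lemma has_derivative_cquot:
  assumes "\<And>n. n \<in> {1..p} \<Longrightarrow> f differentiable (at (x + (real n * h) *\<^sub>R v))"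
    "\<And>n. n \<in> {1..p} \<Longrightarrow> f differentiable (at (x - (real n * h) *\<^sub>R v))"
  shows "(cquot p \<alpha> h v f has_derivative (\<lambda>u. cquot p \<alpha> h v (dird u f) x)) (at x)"
proof -
  have "((\<lambda>x. f (x + (real n * h) *\<^sub>R v)) has_derivative (\<lambda>u. dird u f (x + (real n * h) *\<^sub>R v))) (at x)"
    "((\<lambda>x. f (x - (real n * h) *\<^sub>R v)) has_derivative (\<lambda>u. dird u f (x - (real n * h) *\<^sub>R v))) (at x)"
    if "n \<in> {1..p}" for n
    using has_derivative_shift[OF has_derivative_frechet[OF assms(1)[OF that]]]
      has_derivative_shift[of f _ x "- ((real n * h) *\<^sub>R v)"] has_derivative_frechet[OF assms(2)[OF that]]
    by (simp_all)
  then have "((\<lambda>x. (1 / (2 * h)) * (\<Sum>n=1..p. \<alpha> n *\<^sub>R (f (x + (real n * h) *\<^sub>R v) - f (x - (real n * h) *\<^sub>R v))))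
    has_derivative (\<lambda>u. (1 / (2 * h)) * (\<Sum>n=1..p. \<alpha> n *\<^sub>R
      (dird u f (x + (real n * h) *\<^sub>R v) - dird u f (x - (real n * h) *\<^sub>R v))))) (at x)"
    by (intro has_derivative_mult_right has_derivative_sum has_derivative_scaleR_right has_derivative_diff)
  then show ?thesis unfolding cquot_def[abs_def] cdiff_def by simp
qed

text \<open>The increment over a stencil of length \<open>2 * n * h\<close> is at most that length
  times a bound for the derivative, and the length cancels the division by \<open>2 * h\<close>. The
  price is one derivative instead of one power of \<open>h\<close>.\<close>

lemma cquot_bound:
  assumes "h > 0" "\<And>t. \<bar>t\<bar> \<le> real p * h \<Longrightarrow> f differentiable (at (z + t *\<^sub>R v))"
    "\<And>t. \<bar>t\<bar> \<le> real p * h \<Longrightarrow> \<bar>dird v f (z + t *\<^sub>R v)\<bar> \<le> C"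
  shows "\<bar>cquot p \<alpha> h v f z\<bar> \<le> (\<Sum>n=1..p. \<bar>\<alpha> n\<bar> * real n) * C"
proof -
  have "\<bar>cdiff p \<alpha> (h *\<^sub>R v) f z\<bar> \<le> (\<Sum>n=1..p. \<bar>\<alpha> n\<bar> * (C * (2 * (real n * h))))"
    unfolding cdiff_def real_norm_def[symmetric]
  proof (rule sum_norm_le)
    fix n assume n: "n \<in> {1..p}"
    have nh: "real n * h \<le> real p * h" "0 \<le> real n * h" using n assms(1) by auto
    have "norm (f (z + (real n * h) *\<^sub>R v) - f (z + (- (real n * h)) *\<^sub>R v))
        \<le> C * (real n * h - (- (real n * h)))"
      by (rule line_increment_bound) (use nh assms(2,3) in auto)
    then have "norm (f (z + real n *\<^sub>R h *\<^sub>R v) - f (z - real n *\<^sub>R h *\<^sub>R v)) \<le> C * (2 * (real n * h))"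
      by (simp add: mult.commute)
    then show "norm (\<alpha> n *\<^sub>R (f (z + real n *\<^sub>R h *\<^sub>R v) - f (z - real n *\<^sub>R h *\<^sub>R v)))
      \<le> norm (\<alpha> n) * (C * (2 * (real n * h)))" by (simp add: abs_mult mult_left_mono)
  qed
  then have "(1 / (2 * h)) * \<bar>cdiff p \<alpha> (h *\<^sub>R v) f z\<bar>
      \<le> (1 / (2 * h)) * (\<Sum>n=1..p. \<bar>\<alpha> n\<bar> * (C * (2 * (real n * h))))"
    using assms(1) by (intro mult_left_mono) auto
  also have "\<dots> = (\<Sum>n=1..p. \<bar>\<alpha> n\<bar> * real n) * C"
    unfolding sum_distrib_left sum_distrib_right
    by (intro sum.cong refl) (use assms(1) in \<open>simp add: field_simps\<close>)
  finally show ?thesis using assms(1) by (simp add: cquot_def abs_mult)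
qed

text \<open>Taking a quotient keeps the weight \<open>w\<close> and costs one order of
  differentiability and a margin around \<open>T\<close>.\<close>

lemma Ck_bound_cquot:
  assumes "open T" "Ck_bound (Suc n) F w S r"
    and h: "\<forall>\<^sub>F i in F. h i > 0 \<and> (\<forall>x\<in>T. \<forall>t. \<bar>t\<bar> \<le> real p * h i \<longrightarrow> x + t *\<^sub>R v \<in> S)"
  shows "Ck_bound n F w T (\<lambda>i. cquot p \<alpha> (h i) v (r i))"
  using assms(2)
proof (induction n arbitrary: r)
  case 0
  have d: "\<forall>\<^sub>F i in F. \<forall>x\<in>S. r i differentiable (at x)" using 0 by simp
  have "Ck_bound 0 F w S (\<lambda>i. dird v (r i))" using 0 by (simp only: Ck_bound.simps(2))
  then obtain C where C: "\<forall>\<^sub>F i in F. \<forall>x\<in>S. \<bar>dird v (r i) x\<bar> \<le> C * w i" by auto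
  have "\<forall>\<^sub>F i in F. \<forall>x\<in>T. \<bar>cquot p \<alpha> (h i) v (r i) x\<bar> \<le> ((\<Sum>n=1..p. \<bar>\<alpha> n\<bar> * real n) * C) * w i"
    using C d h
  proof eventually_elim
    case (elim i)
    show ?case
    proof
      fix x assume "x \<in> T"
      then have "\<bar>cquot p \<alpha> (h i) v (r i) x\<bar> \<le> (\<Sum>n=1..p. \<bar>\<alpha> n\<bar> * real n) * (C * w i)"
        using elim by (intro cquot_bound) auto
      then show "\<bar>cquot p \<alpha> (h i) v (r i) x\<bar> \<le> ((\<Sum>n=1..p. \<bar>\<alpha> n\<bar> * real n) * C) * w i"
        by (simp add: mult.assoc)
    qed
  qed
  then show ?case by (simp only: Ck_bound.simps) blast
next
  case (Suc n)
  show ?case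
  proof (rule Ck_bound_SucI[OF assms(1), where r' = "\<lambda>i x u. cquot p \<alpha> (h i) v (dird u (r i)) x"])
    show "Ck_bound 0 F w T (\<lambda>i. cquot p \<alpha> (h i) v (r i))"
      using Suc.IH[of r] Ck_bound_SucD[OF Suc.prems] Ck_bound_0 by blast
    have "\<forall>\<^sub>F i in F. \<forall>x\<in>S. r i differentiable (at x)" using Suc.prems by simp
    then show "\<forall>\<^sub>F i in F. \<forall>x\<in>T. (cquot p \<alpha> (h i) v (r i) has_derivative
        (\<lambda>u. cquot p \<alpha> (h i) v (dird u (r i)) x)) (at x)"
      using h
    proof eventually_elim
      case (elim i)
      show ?case
      proof
        fix x assume x: "x \<in> T"
        have in_S: "x + t *\<^sub>R v \<in> S" if "\<bar>t\<bar> \<le> real p * h i" for t using elim x that by blast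
        show "(cquot p \<alpha> (h i) v (r i) has_derivative (\<lambda>u. cquot p \<alpha> (h i) v (dird u (r i)) x)) (at x)"
        proof (rule has_derivative_cquot)
          fix n assume n: "n \<in> {1..p}"
          have nh: "\<bar>real n * h i\<bar> \<le> real p * h i" "\<bar>- (real n * h i)\<bar> \<le> real p * h i"
            using n elim by (auto simp: abs_mult)
          show "r i differentiable (at (x + (real n * h i) *\<^sub>R v))"
            using in_S[OF nh(1)] elim by blast
          show "r i differentiable (at (x - (real n * h i) *\<^sub>R v))"
            using in_S[OF nh(2)] elim by simp
        qed
      qed
    qed
    show "Ck_bound n F w T (\<lambda>i x. cquot p \<alpha> (h i) v (dird u (r i)) x)" for u
      using Suc.IH[of "\<lambda>i. dird u (r i)"] Suc.prems by simp
  qed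
qed

text \<open>Only order zero is an estimate. A derivative of the error is again an error, namely that
  of the derivative of \<open>f\<close>, because quotients commute with differentiation and mixed
  derivatives are symmetric; hence the induction with \<open>f\<close> arbitrary.\<close>

lemma Ck_bound_cquot_error:
  fixes f :: "'a::euclidean_space \<Rightarrow> real"
  assumes oc: "order_coeffs p \<alpha>" and "open S" "S \<subseteq> L" "compact L" "L \<subseteq> S'" "open S'" "smooth_on S' f"
    and h: "\<forall>\<^sub>F i in F. h i > 0" "(h \<longlongrightarrow> 0) F"
  shows "Ck_bound n F (\<lambda>i. h i ^ (2 * p)) S (\<lambda>i z. cquot p \<alpha> (h i) v f z - dird v f z)"
  using assms(7)
proof (induction n arbitrary: f)
  case 0
  obtain C \<epsilon> where C: "\<epsilon> > 0" "\<forall>z\<in>L. \<forall>h. 0 < h \<and> h < \<epsilon> \<longrightarrow>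
    norm (cdiff p \<alpha> (h *\<^sub>R v) f z - (2 * h) *\<^sub>R dird v f z) \<le> C * h ^ (2 * p + 1)"
    using cdiff_accuracy[OF oc assms(6,4,5) 0] by blast
  have "\<forall>\<^sub>F i in F. h i < \<epsilon>" using order_tendstoD(2)[OF h(2) C(1)] .
  then have "\<forall>\<^sub>F i in F. \<forall>x\<in>S. \<bar>cquot p \<alpha> (h i) v f x - dird v f x\<bar> \<le> (C / 2) * h i ^ (2 * p)"
    using h(1)
  proof eventually_elim
    case (elim i)
    show ?case
    proof
      fix x assume "x \<in> S"
      then have "x \<in> L" using assms(3) by blast
      then have "\<bar>cdiff p \<alpha> (h i *\<^sub>R v) f x - (2 * h i) * dird v f x\<bar> \<le> C * h i ^ (2 * p + 1)"
        using C(2) elim by auto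
      then have "(1 / (2 * h i)) * \<bar>cdiff p \<alpha> (h i *\<^sub>R v) f x - (2 * h i) * dird v f x\<bar>
          \<le> (1 / (2 * h i)) * (C * h i ^ (2 * p + 1))"
        using elim by (intro mult_left_mono) auto
      also have "\<dots> = (C / 2) * h i ^ (2 * p)" using elim by (simp add: field_simps)
      also have "(1 / (2 * h i)) * \<bar>cdiff p \<alpha> (h i *\<^sub>R v) f x - (2 * h i) * dird v f x\<bar>
          = \<bar>(1 / (2 * h i)) * (cdiff p \<alpha> (h i *\<^sub>R v) f x - (2 * h i) * dird v f x)\<bar>"
        using elim by (simp add: abs_mult)
      also have "(1 / (2 * h i)) * (cdiff p \<alpha> (h i *\<^sub>R v) f x - (2 * h i) * dird v f x)
          = cquot p \<alpha> (h i) v f x - dird v f x"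
        using elim by (simp add: cquot_def right_diff_distrib)
      finally show "\<bar>cquot p \<alpha> (h i) v f x - dird v f x\<bar> \<le> (C / 2) * h i ^ (2 * p)" .
    qed
  qed
  then show ?case by (simp only: Ck_bound.simps) blast
next
  case (Suc n)
  obtain \<rho> where rho: "\<rho> > 0" "compact (\<Union>x\<in>L. cball x \<rho>)" "(\<Union>x\<in>L. cball x \<rho>) \<subseteq> S'"
    by (rule compact_enlarge[OF assms(4,6,5)])
  have "((\<lambda>i. real p * h i * norm v) \<longlongrightarrow> real p * 0 * norm v) F"
    by (intro tendsto_intros h)
  then have "\<forall>\<^sub>F i in F. real p * h i * norm v < \<rho>"
    using order_tendstoD(2) rho(1) by fastforce
  then have shift: "\<forall>\<^sub>F i in F. \<forall>x\<in>S. \<forall>t. \<bar>t\<bar> \<le> real p * h i \<longrightarrow> x + t *\<^sub>R v \<in> S'"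
  proof eventually_elim
    case (elim i)
    show ?case
    proof (intro ballI allI impI)
      fix x t assume x: "x \<in> S" and t: "\<bar>t\<bar> \<le> real p * h i"
      have "\<bar>t\<bar> * norm v \<le> real p * h i * norm v" using t by (intro mult_right_mono) auto
      then have "x + t *\<^sub>R v \<in> cball x \<rho>" using elim by (simp add: dist_norm)
      then show "x + t *\<^sub>R v \<in> S'" using x assms(3) rho(3) by blast
    qed
  qed
  have dv: "smooth_on S' (dird v f)" by (rule smooth_on_dird[OF Suc.prems])
  show ?case
  proof (rule Ck_bound_SucI[OF assms(2), where r' = "\<lambda>i x u. cquot p \<alpha> (h i) v (dird u f) x - dird u (dird v f) x"])
    show "Ck_bound 0 F (\<lambda>i. h i ^ (2 * p)) S (\<lambda>i z. cquot p \<alpha> (h i) v f z - dird v f z)"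
      using Suc.IH[OF Suc.prems] by (rule Ck_bound_0)
    show "\<forall>\<^sub>F i in F. \<forall>x\<in>S. ((\<lambda>z. cquot p \<alpha> (h i) v f z - dird v f z) has_derivative
        (\<lambda>u. cquot p \<alpha> (h i) v (dird u f) x - dird u (dird v f) x)) (at x)"
      using shift h(1)
    proof eventually_elim
      case (elim i)
      show ?case
      proof
        fix x assume x: "x \<in> S"
        have in_S: "x + t *\<^sub>R v \<in> S'" if "\<bar>t\<bar> \<le> real p * h i" for t using elim x that by blast
        show "((\<lambda>z. cquot p \<alpha> (h i) v f z - dird v f z) has_derivative
          (\<lambda>u. cquot p \<alpha> (h i) v (dird u f) x - dird u (dird v f) x)) (at x)"
        proof (rule has_derivative_diff[OF has_derivative_cquot has_derivative_frechet])
          fix n assume n: "n \<in> {1..p}"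
          have nh: "\<bar>real n * h i\<bar> \<le> real p * h i" "\<bar>- (real n * h i)\<bar> \<le> real p * h i"
            using n elim by (auto simp: abs_mult)
          show "f differentiable (at (x + (real n * h i) *\<^sub>R v))"
            using in_S[OF nh(1)] smooth_on_differentiable[OF Suc.prems] by blast
          show "f differentiable (at (x - (real n * h i) *\<^sub>R v))"
            using in_S[OF nh(2)] smooth_on_differentiable[OF Suc.prems] by simp
        next
          show "dird v f differentiable (at x)"
            using smooth_on_differentiable[OF dv] x assms by blast
        qed
      qed
    qed
    show "Ck_bound n F (\<lambda>i. h i ^ (2 * p)) S (\<lambda>i x. cquot p \<alpha> (h i) v (dird u f) x - dird u (dird v f) x)" for u
    proof (rule Ck_bound_cong[OF assms(2) _ Suc.IH[OF smooth_on_dird[OF Suc.prems, of u]]])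
      have "dird v (dird u f) x = dird u (dird v f) x" if "x \<in> S" for x
        by (rule dird_commute[OF assms(6) Suc.prems]) (use that assms in auto)
      then show "\<forall>\<^sub>F i in F. \<forall>x\<in>S. cquot p \<alpha> (h i) v (dird u f) x - dird v (dird u f) x
          = cquot p \<alpha> (h i) v (dird u f) x - dird u (dird v f) x" by simp
    qed
  qed
qed

section \<open>Accuracy of the two-point flux differences\<close>

text \<open>What telescoping leaves in one direction of a flux made of an averaged metric
  \<open>m\<close> and a two-point function \<open>f\<close> of the positions. It is linear in
  \<open>m\<close>, so a discrete metric can be split into the exact one and its error.\<close>

definition fdiff :: "nat \<Rightarrow> (nat \<Rightarrow> real) \<Rightarrow> 'a::real_vector \<Rightarrow> ('a \<Rightarrow> real) \<Rightarrow> ('a \<Rightarrow> 'a \<Rightarrow> 'b::real_vector) \<Rightarrow> 'a \<Rightarrow> 'b" where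
  "fdiff p \<alpha> d m f z = (\<Sum>n=1..p. \<alpha> n *\<^sub>R
     (((m z + m (z + real n *\<^sub>R d)) / 2) *\<^sub>R f z (z + real n *\<^sub>R d)
      - ((m (z - real n *\<^sub>R d) + m z) / 2) *\<^sub>R f (z - real n *\<^sub>R d) z))"

lemma fdiff_add: "fdiff p \<alpha> d (\<lambda>z. m z + e z) f z = fdiff p \<alpha> d m f z + fdiff p \<alpha> d e f z"
  unfolding fdiff_def sum.distrib[symmetric] scaleR_right_distrib[symmetric]
  by (intro sum.cong refl arg_cong2[where f = scaleR])
    (simp add: add_divide_distrib scaleR_left_distrib)

text \<open>The two-point expression as a function of base point and signed offset together.
  Treating the pair as one variable lets \<open>cdiff_accuracy\<close> deliver constants uniform in
  the base point.\<close>

lemma smooth_line_flux: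
  fixes f :: "'a::euclidean_space \<Rightarrow> 'a \<Rightarrow> 'b::real_normed_vector" and v :: 'a
  assumes "open S" "smooth_on (S \<times> S) (\<lambda>(x, y). f x y)" "smooth_on S m"
  defines "R \<equiv> {zy :: 'a \<times> real. fst zy \<in> S \<and> fst zy + snd zy *\<^sub>R v \<in> S}"
  shows "open R" "smooth_on R (\<lambda>(z, y). ((m z + m (z + y *\<^sub>R v)) / 2) *\<^sub>R f z (z + y *\<^sub>R v))"
proof -
  have R: "R = fst -` S \<inter> (\<lambda>zy. fst zy + snd zy *\<^sub>R v) -` S" by (auto simp: R_def)
  show o: "open R" unfolding R
    by (intro open_Int open_vimage assms(1) continuous_intros)
  have l1: "bounded_linear (fst :: 'a \<times> real \<Rightarrow> 'a)" by (rule bounded_linear_fst)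
  have l2: "bounded_linear (\<lambda>zy::'a \<times> real. fst zy + snd zy *\<^sub>R v)"
    by (intro bounded_linear_add bounded_linear_fst bounded_linear_scaleR_const bounded_linear_snd)
  have l3: "bounded_linear (\<lambda>x::real. x / 2)" by (rule bounded_linear_divide)
  note s1 = smooth_on_linear[OF l1 o smooth_on_ident[OF o]]
  note s2 = smooth_on_linear[OF l2 o smooth_on_ident[OF o]]
  have m1: "smooth_on R (\<lambda>zy. m (fst zy))"
    by (rule smooth_on_compose[OF o s1 assms(3)]) (auto simp: R_def)
  have m2: "smooth_on R (\<lambda>zy. m (fst zy + snd zy *\<^sub>R v))"
    by (rule smooth_on_compose[OF o s2 assms(3)]) (auto simp: R_def)
  have f: "smooth_on R (\<lambda>zy. case (fst zy, fst zy + snd zy *\<^sub>R v) of (x, y) \<Rightarrow> f x y)"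
    by (rule smooth_on_compose[OF o smooth_on_Pair[OF o s1 s2] assms(2)]) (auto simp: R_def)
  from smooth_on_scaleR[OF o smooth_on_linear[OF l3 o smooth_on_add[OF o m1 m2]] f]
  show "smooth_on R (\<lambda>(z, y). ((m z + m (z + y *\<^sub>R v)) / 2) *\<^sub>R f z (z + y *\<^sub>R v))"
    by (simp add: case_prod_beta')
qed

text \<open>By symmetry the two partial derivatives of \<open>f\<close> agree on the diagonal, so differentiating in
  the second argument alone gives half of the derivative along the diagonal.\<close>

lemma line_flux_derivative:
  fixes f :: "'a::euclidean_space \<Rightarrow> 'a \<Rightarrow> 'b::real_normed_vector"
  assumes "open S" "smooth_on (S \<times> S) (\<lambda>(x, y). f x y)" "smooth_on S m"
    and sym: "\<And>x y. x \<in> S \<Longrightarrow> y \<in> S \<Longrightarrow> f x y = f y x" and z: "z \<in> S"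
  shows "2 *\<^sub>R dird (0, 1) (\<lambda>(z, y). ((m z + m (z + y *\<^sub>R v)) / 2) *\<^sub>R f z (z + y *\<^sub>R v)) (z, 0)
    = dird v (\<lambda>z. m z *\<^sub>R f z z) z"
proof -
  let ?f = "\<lambda>(x, y). f x y"
  let ?g = "\<lambda>(z, y). ((m z + m (z + y *\<^sub>R v)) / 2) *\<^sub>R f z (z + y *\<^sub>R v)"
  define F where "F = frechet_derivative ?f (at (z, z))"
  have dm: "m differentiable (at z)" using smooth_on_differentiable[OF assms(3) z] .
  have df: "?f differentiable (at (z, z))" using smooth_on_differentiable[OF assms(2)] z by simp
  have linF: "linear F" unfolding F_def by (rule linear_frechet_derivative[OF df])
  have lf: "((\<lambda>t. ?f ((z, z) + t *\<^sub>R w)) has_vector_derivative F w) (at 0)" for w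
    using has_vector_derivative_line[of ?f "(z, z)" 0 w] df by (simp add: F_def)
  have lm: "((\<lambda>t. m (z + t *\<^sub>R v)) has_real_derivative dird v m z) (at 0)"
    using has_real_derivative_line[of m z 0 v] dm by simp
  have f1: "((\<lambda>t. f z (z + t *\<^sub>R v)) has_vector_derivative F (0, v)) (at 0)"
    using lf[of "(0, v)"] by simp
  have "((\<lambda>t. f (z + t *\<^sub>R v) z) has_vector_derivative F (v, 0)) (at 0)"
    using lf[of "(v, 0)"] by simp
  moreover have "open ((\<lambda>t. z + t *\<^sub>R v) -` S)" by (intro open_vimage assms(1) continuous_intros)
  ultimately have "((\<lambda>t. f z (z + t *\<^sub>R v)) has_vector_derivative F (v, 0)) (at 0)"
    by (rule has_vector_derivative_transform_within_open) (use z sym in auto)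
  then have Fsym: "F (v, 0) = F (0, v)" using f1 vector_derivative_unique_at by blast
  have "F (v, v) = F ((v, 0) + (0, v))" by simp
  also have "\<dots> = F (v, 0) + F (0, v)" by (rule linear_add[OF linF])
  finally have Fvv: "F (v, v) = 2 *\<^sub>R F (0, v)" by (simp add: Fsym scaleR_2)
  have zR: "(z, 0) \<in> {zy. fst zy \<in> S \<and> fst zy + snd zy *\<^sub>R v \<in> S}" using z by simp
  have dg: "?g differentiable (at (z, 0))"
    by (rule smooth_on_differentiable[OF smooth_line_flux(2)[OF assms(1-3)] zR])
  have "((\<lambda>t. ?g ((z, 0) + t *\<^sub>R (0, 1))) has_vector_derivative dird (0, 1) ?g (z, 0)) (at 0)"
    using has_vector_derivative_line[of ?g "(z, 0)" 0 "(0, 1)"] dg by simp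
  then have g1: "((\<lambda>t. ((m z + m (z + t *\<^sub>R v)) / 2) *\<^sub>R f z (z + t *\<^sub>R v)) has_vector_derivative
      dird (0, 1) ?g (z, 0)) (at 0)" by simp
  have "((\<lambda>t. (m z + m (z + t *\<^sub>R v)) / 2) has_real_derivative (0 + dird v m z) / 2) (at 0)"
    by (intro DERIV_cdivide DERIV_add DERIV_const lm)
  from has_vector_derivative_scaleR[OF this f1]
  have "((\<lambda>t. ((m z + m (z + t *\<^sub>R v)) / 2) *\<^sub>R f z (z + t *\<^sub>R v)) has_vector_derivative
      m z *\<^sub>R F (0, v) + (dird v m z / 2) *\<^sub>R f z z) (at 0)" by simp
  then have G: "dird (0, 1) ?g (z, 0) = m z *\<^sub>R F (0, v) + (dird v m z / 2) *\<^sub>R f z z"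
    using g1 vector_derivative_unique_at by blast
  have "((\<lambda>t. f (z + t *\<^sub>R v) (z + t *\<^sub>R v)) has_vector_derivative F (v, v)) (at 0)"
    using lf[of "(v, v)"] by simp
  from has_vector_derivative_scaleR[OF lm this]
  have d1: "((\<lambda>t. m (z + t *\<^sub>R v) *\<^sub>R f (z + t *\<^sub>R v) (z + t *\<^sub>R v)) has_vector_derivative
      m z *\<^sub>R F (v, v) + dird v m z *\<^sub>R f z z) (at 0)" by simp
  have "((\<lambda>z. ?f (z, z)) has_derivative (\<lambda>w. F (w, w))) (at z)"
    unfolding F_def
    by (rule has_derivative_compose[of "\<lambda>z. (z, z)" "\<lambda>w. (w, w)" z UNIV ?f])
      (auto intro!: derivative_eq_intros has_derivative_frechet[OF df])
  then have "((\<lambda>z. f z z) has_derivative (\<lambda>w. F (w, w))) (at z)" by simp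
  from has_derivative_scaleR[OF has_derivative_frechet[OF dm] this]
  have "(\<lambda>z. m z *\<^sub>R f z z) differentiable (at z)" by (rule differentiableI)
  then have "((\<lambda>t. m (z + t *\<^sub>R v) *\<^sub>R f (z + t *\<^sub>R v) (z + t *\<^sub>R v)) has_vector_derivative
      dird v (\<lambda>z. m z *\<^sub>R f z z) z) (at 0)"
    using has_vector_derivative_line[of "\<lambda>z. m z *\<^sub>R f z z" z 0 v] by simp
  then have "dird v (\<lambda>z. m z *\<^sub>R f z z) z = m z *\<^sub>R F (v, v) + dird v m z *\<^sub>R f z z"
    using d1 vector_derivative_unique_at by blast
  then show ?thesis unfolding G Fvv by (simp add: scaleR_right_distrib)
qed

lemma eventually_shift_mem:
  fixes K S :: "'a::euclidean_space set"
  assumes "compact K" "open S" "K \<subseteq> S" "(h \<longlongrightarrow> 0) F"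
  shows "\<forall>\<^sub>F i in F. \<forall>z\<in>K. \<forall>t. \<bar>t\<bar> \<le> c * h i \<longrightarrow> z + t *\<^sub>R v \<in> S"
proof -
  obtain \<rho> where rho: "\<rho> > 0" "compact (\<Union>x\<in>K. cball x \<rho>)" "(\<Union>x\<in>K. cball x \<rho>) \<subseteq> S"
    by (rule compact_enlarge[OF assms(1-3)])
  have "((\<lambda>i. c * h i * norm v) \<longlongrightarrow> c * 0 * norm v) F"
    by (intro tendsto_intros assms)
  then have "\<forall>\<^sub>F i in F. c * h i * norm v < \<rho>"
    using order_tendstoD(2) rho(1) by fastforce
  then show ?thesis
  proof eventually_elim
    case (elim i)
    show ?case
    proof (intro ballI allI impI)
      fix z t assume z: "z \<in> K" and t: "\<bar>t\<bar> \<le> c * h i"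
      have "\<bar>t\<bar> * norm v \<le> c * h i * norm v" using t by (intro mult_right_mono) auto
      then have "z + t *\<^sub>R v \<in> cball z \<rho>" using elim by (simp add: dist_norm)
      then show "z + t *\<^sub>R v \<in> S" using z rho(3) by blast
    qed
  qed
qed

text \<open>By symmetry of \<open>f\<close> the left flux is the same function of the offset,
  evaluated at a negative one. So \<open>fdiff\<close> is a central difference in the offset at 0,
  and the factor 2 of \<open>cdiff\<close> meets the one half in
  \<open>line_flux_derivative\<close>.\<close>

lemma fdiff_exact:
  fixes f :: "'a::euclidean_space \<Rightarrow> 'a \<Rightarrow> 'b::real_normed_vector"
  assumes oc: "order_coeffs p \<alpha>" and "open S" "smooth_on (S \<times> S) (\<lambda>(x, y). f x y)" "smooth_on S m"
    and sym: "\<And>x y. x \<in> S \<Longrightarrow> y \<in> S \<Longrightarrow> f x y = f y x"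
    and K: "compact K" "K \<subseteq> S" and h: "\<forall>\<^sub>F i in F. h i > 0" "(h \<longlongrightarrow> 0) F"
  shows "\<exists>C. \<forall>\<^sub>F i in F. \<forall>z\<in>K. norm (fdiff p \<alpha> (h i *\<^sub>R v) m f z - h i *\<^sub>R dird v (\<lambda>z. m z *\<^sub>R f z z) z)
    \<le> C * h i ^ (2 * p + 1)"
proof -
  let ?g = "\<lambda>(z, y). ((m z + m (z + y *\<^sub>R v)) / 2) *\<^sub>R f z (z + y *\<^sub>R v)"
  let ?R = "{zy. fst zy \<in> S \<and> fst zy + snd zy *\<^sub>R v \<in> S}"
  note g = smooth_line_flux[OF assms(2-4), of v]
  have "compact (K \<times> {0::real})" "K \<times> {0} \<subseteq> ?R" using K by (auto intro: compact_Times)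
  from cdiff_accuracy[OF oc g(1) this g(2), of "(0, 1)"]
  obtain C \<epsilon> where C: "\<epsilon> > 0" "\<And>z h. z \<in> K \<Longrightarrow> 0 < h \<Longrightarrow> h < \<epsilon> \<Longrightarrow>
    norm (cdiff p \<alpha> (h *\<^sub>R (0, 1)) ?g (z, 0) - (2 * h) *\<^sub>R dird (0, 1) ?g (z, 0)) \<le> C * h ^ (2 * p + 1)"
    by (auto simp del: scaleR_Pair)
  have "\<forall>\<^sub>F i in F. h i < \<epsilon>" using order_tendstoD(2)[OF h(2) C(1)] .
  moreover have "\<forall>\<^sub>F i in F. \<forall>z\<in>K. \<forall>t. \<bar>t\<bar> \<le> real p * h i \<longrightarrow> z + t *\<^sub>R v \<in> S"
    by (rule eventually_shift_mem[OF K(1) assms(2) K(2) h(2)])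
  ultimately have "\<forall>\<^sub>F i in F. \<forall>z\<in>K. norm (fdiff p \<alpha> (h i *\<^sub>R v) m f z - h i *\<^sub>R dird v (\<lambda>z. m z *\<^sub>R f z z) z)
    \<le> C * h i ^ (2 * p + 1)" using h(1)
  proof eventually_elim
    case (elim i)
    show ?case
    proof
      fix z assume z: "z \<in> K"
      have "cdiff p \<alpha> (h i *\<^sub>R (0, 1)) ?g (z, 0) = fdiff p \<alpha> (h i *\<^sub>R v) m f z"
        unfolding cdiff_def fdiff_def
      proof (intro sum.cong refl arg_cong2[where f = scaleR])
        fix n assume n: "n \<in> {1..p}"
        then have "\<bar>- (real n * h i)\<bar> \<le> real p * h i" using elim by (auto simp: abs_mult)
        then have "z + (- (real n * h i)) *\<^sub>R v \<in> S" using elim z by blast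
        then have "f (z - (real n * h i) *\<^sub>R v) z = f z (z - (real n * h i) *\<^sub>R v)"
          using sym z K by auto
        then show "?g ((z, 0) + real n *\<^sub>R h i *\<^sub>R (0, 1)) - ?g ((z, 0) - real n *\<^sub>R h i *\<^sub>R (0, 1))
          = ((m z + m (z + real n *\<^sub>R h i *\<^sub>R v)) / 2) *\<^sub>R f z (z + real n *\<^sub>R h i *\<^sub>R v)
          - ((m (z - real n *\<^sub>R h i *\<^sub>R v) + m z) / 2) *\<^sub>R f (z - real n *\<^sub>R h i *\<^sub>R v) z"
          by (simp add: add.commute)
      qed
      moreover have "(2 * h i) *\<^sub>R dird (0, 1) ?g (z, 0) = h i *\<^sub>R dird v (\<lambda>z. m z *\<^sub>R f z z) z"
        using line_flux_derivative[OF assms(2-4) sym, of z v] z K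
        by (metis (no_types, lifting) mult.commute scaleR_scaleR subsetD)
      ultimately show "norm (fdiff p \<alpha> (h i *\<^sub>R v) m f z - h i *\<^sub>R dird v (\<lambda>z. m z *\<^sub>R f z z) z)
        \<le> C * h i ^ (2 * p + 1)"
        using C(2)[OF z, of "h i"] elim by simp
    qed
  qed
  then show ?thesis by blast
qed

text \<open>The point is the factor \<open>h i\<close> in the bound: it survives the later division
  by the step. It arises because both \<open>f\<close> and the error \<open>e\<close> are
  differenced over a stencil of length proportional to \<open>h i\<close>, which is why the first
  derivative of \<open>e\<close> must be of size \<open>w\<close> as well.\<close>

lemma fdiff_perturbation:
  fixes f :: "'a::euclidean_space \<Rightarrow> 'a \<Rightarrow> 'b::real_normed_vector"
  assumes "open S" "smooth_on (S \<times> S) (\<lambda>(x, y). f x y)"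
    and sym: "\<And>x y. x \<in> S \<Longrightarrow> y \<in> S \<Longrightarrow> f x y = f y x"
    and K: "compact K" "K \<subseteq> N" "open N" "N \<subseteq> S" and e: "Ck_bound 1 F w N e"
    and h: "\<forall>\<^sub>F i in F. h i > 0" "(h \<longlongrightarrow> 0) F"
  shows "\<exists>C. \<forall>\<^sub>F i in F. \<forall>z\<in>K. norm (fdiff p \<alpha> (h i *\<^sub>R v) (e i) f z) \<le> C * (h i * w i)"
proof -
  let ?f = "\<lambda>(x, y). f x y"
  obtain \<rho> where rho: "\<rho> > 0" "compact (\<Union>x\<in>K. cball x \<rho>)" "(\<Union>x\<in>K. cball x \<rho>) \<subseteq> N"
    by (rule compact_enlarge[OF K(1,3,2)])
  define L where "L = (\<Union>x\<in>K. cball x \<rho>)"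
  have L: "compact (L \<times> L)" "L \<times> L \<subseteq> S \<times> S" using rho K by (auto simp: L_def intro: compact_Times)
  have "bounded (?f ` (L \<times> L))"
    by (intro compact_imp_bounded compact_continuous_image L(1)
        continuous_on_subset[OF smooth_on_continuous[OF assms(2)] L(2)])
  then obtain A where A: "\<And>x y. x \<in> L \<Longrightarrow> y \<in> L \<Longrightarrow> norm (f x y) \<le> A" unfolding bounded_iff by fastforce
  have "bounded (dird (0, v) ?f ` (L \<times> L))"
    by (intro compact_imp_bounded compact_continuous_image L(1)
        continuous_on_subset[OF smooth_on_continuous[OF smooth_on_dird[OF assms(2)]] L(2)])
  then obtain B where B: "\<And>x y. x \<in> L \<Longrightarrow> y \<in> L \<Longrightarrow> norm (dird (0, v) ?f (x, y)) \<le> B"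
    unfolding bounded_iff by fastforce
  have "Ck_bound 0 F w N (\<lambda>i. dird v (e i))" and "Ck_bound 0 F w N e" using e by auto
  then obtain C D where C: "\<forall>\<^sub>F i in F. \<forall>x\<in>N. \<bar>e i x\<bar> \<le> C * w i"
    and D: "\<forall>\<^sub>F i in F. \<forall>x\<in>N. \<bar>dird v (e i) x\<bar> \<le> D * w i" by auto
  have de: "\<forall>\<^sub>F i in F. \<forall>x\<in>N. e i differentiable (at x)" using e by simp
  have sh: "\<forall>\<^sub>F i in F. \<forall>z\<in>K. \<forall>t. \<bar>t\<bar> \<le> real p * h i \<longrightarrow> z + t *\<^sub>R v \<in> interior L"
  proof (rule eventually_shift_mem[OF K(1) open_interior _ h(2)])
    show "K \<subseteq> interior L"
    proof
      fix x assume "x \<in> K"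
      then have "ball x \<rho> \<subseteq> L" by (force simp: L_def intro: less_imp_le)
      then show "x \<in> interior L" using rho(1) by (auto intro: interiorI[of "ball x \<rho>"])
    qed
  qed
  define Q where "Q = (\<Sum>n=1..p. \<bar>\<alpha> n\<bar> * (2 * real n)) * (C * B + D * A)"
  have "\<forall>\<^sub>F i in F. \<forall>z\<in>K. norm (fdiff p \<alpha> (h i *\<^sub>R v) (e i) f z) \<le> Q * (h i * w i)"
    using C D de sh h(1)
  proof eventually_elim
    case (elim i)
    show ?case
    proof
      fix z assume z: "z \<in> K"
      have inL: "z + t *\<^sub>R v \<in> L" if "\<bar>t\<bar> \<le> real p * h i" for t
        using elim(4) z that interior_subset by blast
      have LN: "L \<subseteq> N" using rho by (simp add: L_def)
      have zL: "z \<in> L" using inL[of 0] elim by simp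
      have fd: "?f differentiable (at (x, y))" if "x \<in> L" "y \<in> L" for x y
        using smooth_on_differentiable[OF assms(2)] L(2) that by blast
      have "norm (fdiff p \<alpha> (h i *\<^sub>R v) (e i) f z)
        \<le> (\<Sum>n=1..p. \<bar>\<alpha> n\<bar> * ((2 * real n) * ((C * B + D * A) * (h i * w i))))"
        unfolding fdiff_def
      proof (rule sum_norm_le)
        fix n assume n: "n \<in> {1..p}"
        define t where "t = real n * h i"
        have t: "0 \<le> t" "t \<le> real p * h i" "\<bar>t\<bar> \<le> real p * h i" "\<bar>- t\<bar> \<le> real p * h i"
          using n elim by (auto simp: t_def abs_mult)
        define zp where "zp = z + t *\<^sub>R v"
        define zm where "zm = z - t *\<^sub>R v"
        have zL2: "zp \<in> L" "zm \<in> L" using inL[OF t(3)] inL[OF t(4)] by (auto simp: zp_def zm_def)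
        have seg: "z + s *\<^sub>R v \<in> L" if "- t \<le> s" "s \<le> t" for s
          using inL[of s] that t by auto
        have segN: "z + s *\<^sub>R v \<in> N" if "- t \<le> s" "s \<le> t" for s
          using seg[OF that] LN by blast
        have df: "norm (f z zp - f z zm) \<le> B * (2 * t)"
        proof -
          have "norm (?f ((z, z) + t *\<^sub>R (0, v)) - ?f ((z, z) + (- t) *\<^sub>R (0, v))) \<le> B * (t - (- t))"
            by (rule line_increment_bound) (use t fd B seg zL in auto)
          then show ?thesis by (simp add: zp_def zm_def)
        qed
        have dE: "\<bar>e i zp - e i zm\<bar> \<le> (D * w i) * (2 * t)"
        proof -
          have "norm (e i (z + t *\<^sub>R v) - e i (z + (- t) *\<^sub>R v)) \<le> (D * w i) * (t - (- t))"
            by (rule line_increment_bound) (use t(1) elim(2,3) segN in auto)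
          then show ?thesis by (simp add: zp_def zm_def)
        qed
        have ez: "\<bar>e i z\<bar> \<le> C * w i" "\<bar>e i zp\<bar> \<le> C * w i" using elim zL zL2 LN by auto
        have Cw: "0 \<le> C * w i" using ez(1) by linarith
        have Dw: "0 \<le> D * w i" using elim zL LN by (meson abs_ge_zero order_trans subsetD)
        \<comment> \<open>A discrete product rule: mean error times the increment of
          \<open>f\<close>, plus half the increment of the error times a value of
          \<open>f\<close>.\<close>
        have "((e i z + e i zp) / 2) *\<^sub>R f z zp - ((e i zm + e i z) / 2) *\<^sub>R f zm z
          = ((e i z + e i zp) / 2) *\<^sub>R (f z zp - f z zm) + ((e i zp - e i zm) / 2) *\<^sub>R f z zm"
        proof -
          have "f zm z = f z zm" using sym zL zL2 LN K by blast
          then show ?thesis by (simp add: algebra_simps add_divide_distrib diff_divide_distrib)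
        qed
        also have "norm \<dots> \<le> \<bar>(e i z + e i zp) / 2\<bar> * norm (f z zp - f z zm)
            + \<bar>(e i zp - e i zm) / 2\<bar> * norm (f z zm)"
          by (rule order_trans[OF norm_triangle_ineq]) simp
        also have "\<dots> \<le> (C * w i) * (B * (2 * t)) + ((D * w i) * (2 * t)) * A"
        proof (intro add_mono mult_mono)
          show "\<bar>(e i z + e i zp) / 2\<bar> \<le> C * w i" using ez by simp
          show "\<bar>(e i zp - e i zm) / 2\<bar> \<le> (D * w i) * (2 * t)" using dE by simp
        qed (use df A zL zL2 Cw Dw t in auto)
        also have "\<dots> = (2 * real n) * ((C * B + D * A) * (h i * w i))"
          by (simp add: t_def algebra_simps)
        finally have "norm (((e i z + e i zp) / 2) *\<^sub>R f z zp - ((e i zm + e i z) / 2) *\<^sub>R f zm z)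
          \<le> (2 * real n) * ((C * B + D * A) * (h i * w i))" .
        then have "\<bar>\<alpha> n\<bar> * norm (((e i z + e i zp) / 2) *\<^sub>R f z zp - ((e i zm + e i z) / 2) *\<^sub>R f zm z)
          \<le> \<bar>\<alpha> n\<bar> * ((2 * real n) * ((C * B + D * A) * (h i * w i)))"
          by (rule mult_left_mono) simp
        then show "norm (\<alpha> n *\<^sub>R (((e i z + e i (z + real n *\<^sub>R h i *\<^sub>R v)) / 2) *\<^sub>R f z (z + real n *\<^sub>R h i *\<^sub>R v)
          - ((e i (z - real n *\<^sub>R h i *\<^sub>R v) + e i z) / 2) *\<^sub>R f (z - real n *\<^sub>R h i *\<^sub>R v) z))
          \<le> \<bar>\<alpha> n\<bar> * ((2 * real n) * ((C * B + D * A) * (h i * w i)))"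
          by (simp only: norm_scaleR scaleR_scaleR zp_def zm_def t_def real_norm_def)
      qed
      also have "\<dots> = Q * (h i * w i)"
        unfolding Q_def sum_distrib_right by (intro sum.cong refl) (simp add: algebra_simps)
      finally show "norm (fdiff p \<alpha> (h i *\<^sub>R v) (e i) f z) \<le> Q * (h i * w i)" .
    qed
  qed
  then show ?thesis by blast
qed

lemma fdiff_accuracy:
  fixes f :: "'a::euclidean_space \<Rightarrow> 'a \<Rightarrow> 'b::real_normed_vector"
  assumes oc: "order_coeffs p \<alpha>" and S: "open S" "smooth_on (S \<times> S) (\<lambda>(x, y). f x y)" "smooth_on S m"
    and sym: "\<And>x y. x \<in> S \<Longrightarrow> y \<in> S \<Longrightarrow> f x y = f y x"
    and K: "compact K" "K \<subseteq> N" "open N" "N \<subseteq> S" and e: "Ck_bound 1 F w N (\<lambda>i z. mh i z - m z)"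
    and h: "\<forall>\<^sub>F i in F. h i > 0" "(h \<longlongrightarrow> 0) F" and w: "\<forall>\<^sub>F i in F. h i ^ (2 * p) \<le> w i"
  shows "\<exists>C. \<forall>\<^sub>F i in F. \<forall>z\<in>K. norm ((1 / h i) *\<^sub>R fdiff p \<alpha> (h i *\<^sub>R v) (mh i) f z
    - dird v (\<lambda>z. m z *\<^sub>R f z z) z) \<le> C * w i"
proof -
  obtain C where C: "\<forall>\<^sub>F i in F. \<forall>z\<in>K. norm (fdiff p \<alpha> (h i *\<^sub>R v) m f z
      - h i *\<^sub>R dird v (\<lambda>z. m z *\<^sub>R f z z) z) \<le> C * h i ^ (2 * p + 1)"
    using fdiff_exact[OF oc S sym K(1) _ h] K by blast
  obtain D where D: "\<forall>\<^sub>F i in F. \<forall>z\<in>K. norm (fdiff p \<alpha> (h i *\<^sub>R v) (\<lambda>z. mh i z - m z) f z) \<le> D * (h i * w i)"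
    using fdiff_perturbation[OF S(1,2) sym K e h] by blast
  have "\<forall>\<^sub>F i in F. \<forall>z\<in>K. norm ((1 / h i) *\<^sub>R fdiff p \<alpha> (h i *\<^sub>R v) (mh i) f z
    - dird v (\<lambda>z. m z *\<^sub>R f z z) z) \<le> (\<bar>C\<bar> + D) * w i"
    using C D h(1) w
  proof eventually_elim
    case (elim i)
    show ?case
    proof
      fix z assume z: "z \<in> K"
      let ?d = "dird v (\<lambda>z. m z *\<^sub>R f z z) z"
      have "fdiff p \<alpha> (h i *\<^sub>R v) (mh i) f z = fdiff p \<alpha> (h i *\<^sub>R v) m f z
          + fdiff p \<alpha> (h i *\<^sub>R v) (\<lambda>z. mh i z - m z) f z"
        using fdiff_add[of p \<alpha> "h i *\<^sub>R v" m "\<lambda>z. mh i z - m z" f z] by simp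
      then have eq: "(1 / h i) *\<^sub>R fdiff p \<alpha> (h i *\<^sub>R v) (mh i) f z - ?d
        = (1 / h i) *\<^sub>R ((fdiff p \<alpha> (h i *\<^sub>R v) m f z - h i *\<^sub>R ?d)
          + fdiff p \<alpha> (h i *\<^sub>R v) (\<lambda>z. mh i z - m z) f z)"
        using elim by (simp add: algebra_simps)
      have "norm ((fdiff p \<alpha> (h i *\<^sub>R v) m f z - h i *\<^sub>R ?d) + fdiff p \<alpha> (h i *\<^sub>R v) (\<lambda>z. mh i z - m z) f z)
        \<le> C * h i ^ (2 * p + 1) + D * (h i * w i)"
        using elim z by (intro order_trans[OF norm_triangle_ineq] add_mono) auto
      also have "\<dots> \<le> h i * ((\<bar>C\<bar> + D) * w i)"
      proof -
        have "C * h i ^ (2 * p) \<le> \<bar>C\<bar> * w i" using elim by (intro mult_mono) auto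
        then have "h i * (C * h i ^ (2 * p)) \<le> h i * (\<bar>C\<bar> * w i)" using elim by (intro mult_left_mono) auto
        then show ?thesis by (simp add: algebra_simps)
      qed
      finally have "(1 / h i) * norm ((fdiff p \<alpha> (h i *\<^sub>R v) m f z - h i *\<^sub>R ?d)
          + fdiff p \<alpha> (h i *\<^sub>R v) (\<lambda>z. mh i z - m z) f z) \<le> (1 / h i) * (h i * ((\<bar>C\<bar> + D) * w i))"
        using elim by (intro mult_left_mono) auto
      then show "norm ((1 / h i) *\<^sub>R fdiff p \<alpha> (h i *\<^sub>R v) (mh i) f z - ?d) \<le> (\<bar>C\<bar> + D) * w i"
        unfolding eq norm_scaleR using elim by simp
    qed
  qed
  then show ?thesis by blast
qed

section \<open>Exact and discrete metrics\<close>

lemma dir_deriv_eq: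
  assumes "(f has_derivative f') (at z)"
  shows "dir_deriv f v z = f' v"
  using dir_deriv_dird[OF differentiableI[OF assms], of v] frechet_derivative_at[OF assms] by simp

lemma dir_deriv_local:
  assumes "open S" "z \<in> S" "\<And>x. x \<in> S \<Longrightarrow> f x = g x" "g differentiable (at z)"
  shows "dir_deriv f v z = dird v g z"
  by (rule dir_deriv_eq[OF has_derivative_transform_within_open[OF has_derivative_frechet[OF assms(4)] assms(1,2)]])
    (simp add: assms(3))

section \<open>Cofactors and the derivative of the inverse coordinate map\<close>

abbreviation xi_axis :: "3 \<Rightarrow> real \<times> (real^3)" where
  "xi_axis k \<equiv> (0, axis k 1)"

text \<open>The cofactors of the matrix of spatial derivatives of \<open>X\<close>. With cyclic
  indices the minors carry the right sign, so no alternating factor occurs.\<close>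

definition cof :: "(real \<times> (real^3) \<Rightarrow> real^3) \<Rightarrow> 3 \<Rightarrow> 3 \<Rightarrow> real \<times> (real^3) \<Rightarrow> real" where
  "cof X k j z =
     dird (xi_axis (k + 1)) (\<lambda>z. X z $ (j + 1)) z * dird (xi_axis (k + 2)) (\<lambda>z. X z $ (j + 2)) z
     - dird (xi_axis (k + 2)) (\<lambda>z. X z $ (j + 1)) z * dird (xi_axis (k + 1)) (\<lambda>z. X z $ (j + 2)) z"

lemma cofactor_expansion:
  fixes a :: "3 \<Rightarrow> 3 \<Rightarrow> real"
  shows "(\<Sum>k\<in>UNIV. a i k * (a (j + 1) (k + 1) * a (j + 2) (k + 2) - a (j + 1) (k + 2) * a (j + 2) (k + 1)))
    = (if i = j then det (\<chi> j k. a j k) else 0)"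
proof -
  have "\<forall>i j. (\<Sum>k\<in>UNIV. a i k * (a (j + 1) (k + 1) * a (j + 2) (k + 2) - a (j + 1) (k + 2) * a (j + 2) (k + 1)))
    = (if i = j then det (\<chi> j k. a j k) else 0)"
    unfolding forall_3 sum_3 det_3 three_arith by (simp add: algebra_simps)
  then show ?thesis by blast
qed

lemma component_dird:
  assumes "X differentiable (at z)"
  shows "dird v (\<lambda>z. X z $ j) z = dird v X z $ j"
proof -
  have "((\<lambda>z. X z $ j) has_derivative (\<lambda>v. dird v X z $ j)) (at z)"
    by (rule bounded_linear.has_derivative[OF bounded_linear_vec_nth has_derivative_frechet[OF assms]])
  from frechet_derivative_at[OF this] show ?thesis by metis
qed

text \<open>Cramer's rule. The time component \<open>s\<close> is kept by \<open>time_map\<close>,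
  so its contribution along \<open>d_tau X\<close> is subtracted from \<open>y\<close> before the
  spatial system is solved. The linear map \<open>g\<close> is verified as a right inverse of the
  derivative, which is what the inverse function theorem used here asks for.\<close>

lemma inverse_map_derivative:
  fixes X :: "real \<times> (real^3) \<Rightarrow> real^3"
  assumes S: "open S" "z \<in> S" and X: "smooth_on S X" and inj: "inj_on (time_map X) S" and J: "jac_det X z > 0"
  shows "(inv_coord S X k has_derivative
    (\<lambda>(s, y). (\<Sum>j\<in>UNIV. cof X k j z * (y $ j - s * d_tau X z $ j)) / jac_det X z)) (at (time_map X z))"
proof -
  let ?D = "frechet_derivative X (at z)"
  let ?T = "\<lambda>(s, y). (s, ?D (s, y))"
  define g where "g = (\<lambda>(s, y). (s, \<chi> k. (\<Sum>j\<in>UNIV. cof X k j z * (y $ j - s * d_tau X z $ j)) / jac_det X z))"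
  have dX: "X differentiable (at z)" using smooth_on_differentiable[OF X S(2)] .
  have lin: "linear ?D" by (rule linear_frechet_derivative[OF dX])
  have dxi: "d_xi k X z = ?D (xi_axis k)" for k
    unfolding d_xi_def by (rule dir_deriv_dird[OF dX])
  have dtau: "d_tau X z = ?D (1, 0)" unfolding d_tau_def by (rule dir_deriv_dird[OF dX])
  define a where "a j k = ?D (xi_axis k) $ j" for j k
  have Ja: "jac_det X z = det (\<chi> j k. a j k)" by (simp add: jac_det_def dxi a_def)
  have cof: "cof X k j z = a (j + 1) (k + 1) * a (j + 2) (k + 2) - a (j + 1) (k + 2) * a (j + 2) (k + 1)" for k j
    by (simp add: cof_def a_def component_dird[OF dX])
  have expand: "?D (s, y) = s *\<^sub>R d_tau X z + (\<Sum>k\<in>UNIV. y $ k *\<^sub>R ?D (xi_axis k))" for s y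
  proof -
    have "(s, y) = s *\<^sub>R (1, 0) + (\<Sum>k\<in>UNIV. y $ k *\<^sub>R xi_axis k)"
      by (simp add: prod_eq_iff fst_sum snd_sum vec_eq_iff axis_def if_distrib cong: if_cong)
    then have "?D (s, y) = ?D (s *\<^sub>R (1, 0) + (\<Sum>k\<in>UNIV. y $ k *\<^sub>R xi_axis k))" by simp
    then show ?thesis
      by (simp only: linear_add[OF lin] linear_sum[OF lin] linear_cmul[OF lin] dtau)
  qed
  have id: "?T \<circ> g = id"
  proof (rule ext, clarify)
    fix s y
    have "?D (g (s, y)) $ i = y $ i" for i
    proof -
      have "?D (g (s, y)) $ i = s * d_tau X z $ i
        + (\<Sum>k\<in>UNIV. (\<Sum>j\<in>UNIV. cof X k j z * (y $ j - s * d_tau X z $ j)) / jac_det X z * a i k)"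
        unfolding g_def split
          expand[of s "\<chi> k. (\<Sum>j\<in>UNIV. cof X k j z * (y $ j - s * d_tau X z $ j)) / jac_det X z"]
        by (simp add: a_def)
      also have "(\<Sum>k\<in>UNIV. (\<Sum>j\<in>UNIV. cof X k j z * (y $ j - s * d_tau X z $ j)) / jac_det X z * a i k)
        = (\<Sum>j\<in>UNIV. (\<Sum>k\<in>UNIV. a i k * cof X k j z) * (y $ j - s * d_tau X z $ j) / jac_det X z)"
        unfolding sum_divide_distrib sum_distrib_right
        by (subst sum.swap) (simp add: algebra_simps)
      also have "\<dots> = (\<Sum>j\<in>UNIV. (if j = i then y $ j - s * d_tau X z $ j else 0))"
        unfolding cof cofactor_expansion Ja[symmetric] using J by (intro sum.cong refl) auto
      finally show ?thesis by simp
    qed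
    then have "?D (g (s, y)) = y" by (simp add: vec_eq_iff)
    then show "(?T \<circ> g) (s, y) = id (s, y)" by (simp add: g_def)
  qed
  have dT: "(time_map X has_derivative ?T) (at z)"
    unfolding time_map_def[abs_def] case_prod_beta' prod.collapse
    by (intro has_derivative_Pair has_derivative_fst has_derivative_ident has_derivative_frechet[OF dX])
  have cT: "continuous_on S (time_map X)"
    unfolding time_map_def[abs_def] by (intro continuous_intros smooth_on_continuous[OF X])
  have "(inv_into S (time_map X) has_derivative g) (at (time_map X z))"
    by (rule has_derivative_inverse_strong[OF S cT _ dT id]) (simp add: inj)
  then have "((\<lambda>y. snd (inv_into S (time_map X) y) $ k) has_derivative (\<lambda>y. snd (g y) $ k)) (at (time_map X z))"
    by (intro bounded_linear.has_derivative[OF bounded_linear_vec_nth] has_derivative_snd)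
  then show ?thesis
    by (simp add: inv_coord_def[abs_def] g_def case_prod_beta')
qed

text \<open>The Jacobian cancels the determinant of Cramer's rule. The metrics thus become
  polynomials in the first derivatives of \<open>X\<close>, with no trace of the inverse map, and
  their smoothness is immediate.\<close>

lemma exact_metrics:
  fixes X :: "real \<times> (real^3) \<Rightarrow> real^3"
  assumes "open S" "z \<in> S" "smooth_on S X" "inj_on (time_map X) S" "jac_det X z > 0"
  shows "metric_x S X k j z = cof X k j z"
    and "metric_t S X k z = - (\<Sum>j\<in>UNIV. d_tau X z $ j * cof X k j z)"
proof -
  note d = inverse_map_derivative[OF assms, of k]
  have "(\<Sum>i\<in>UNIV. cof X k i z * (axis j 1 $ i)) = cof X k j z"
    by (simp add: axis_def if_distrib cong: if_cong)
  then show "metric_x S X k j z = cof X k j z"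
    unfolding metric_x_def dir_deriv_eq[OF d] using assms(5) by simp
  show "metric_t S X k z = - (\<Sum>j\<in>UNIV. d_tau X z $ j * cof X k j z)"
    unfolding metric_t_def dir_deriv_eq[OF d] using assms(5) by (simp add: sum_negf mult.commute)
qed

section \<open>Discrete metrics as nested difference quotients\<close>

lemma cquot_add: "cquot p \<alpha> h v (\<lambda>z. f z + g z) z = cquot p \<alpha> h v f z + cquot p \<alpha> h v g z"
  unfolding cquot_def cdiff_def distrib_left[symmetric] sum.distrib[symmetric]
  by (simp add: algebra_simps)

lemma cquot_scale: "cquot p \<alpha> h v (\<lambda>z. c * f z) z = c * cquot p \<alpha> h v f z"
  unfolding cquot_def cdiff_def by (simp add: sum_distrib_left algebra_simps)

lemma dird_mult:
  fixes f g :: "'a::real_normed_vector \<Rightarrow> real"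
  assumes "f differentiable (at z)" "g differentiable (at z)"
  shows "dird v (\<lambda>z. f z * g z) z = f z * dird v g z + dird v f z * g z"
  using frechet_derivative_at[OF has_derivative_mult[OF has_derivative_frechet[OF assms(1)]
      has_derivative_frechet[OF assms(2)]]] by metis

text \<open>Write the inner quotient as derivative plus error \<open>r\<close>. The outer quotient
  of \<open>b * r\<close> costs one derivative of \<open>r\<close>, which is known to every order;
  the outer quotient of the exact product is the error of one fixed smooth function. Each of the two
  quotients needs its own margin, hence the chain of sets.\<close>

lemma Ck_bound_nested_cquot:
  fixes a b :: "'a::euclidean_space \<Rightarrow> real"
  assumes oc: "order_coeffs p \<alpha>"
    and sets: "open N1" "N1 \<subseteq> L1" "compact L1" "L1 \<subseteq> N2" "open N2" "N2 \<subseteq> L2" "compact L2" "L2 \<subseteq> S" "open S"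
    and a: "smooth_on S a" and b: "smooth_on S b"
    and h1: "\<forall>\<^sub>F i in F. h1 i > 0" "(h1 \<longlongrightarrow> 0) F" "\<forall>\<^sub>F i in F. h1 i ^ (2 * p) \<le> w i"
    and h2: "\<forall>\<^sub>F i in F. h2 i > 0" "(h2 \<longlongrightarrow> 0) F" "\<forall>\<^sub>F i in F. h2 i ^ (2 * p) \<le> w i"
  shows "Ck_bound n F w N1 (\<lambda>i z. cquot p \<alpha> (h2 i) v2 (\<lambda>z. cquot p \<alpha> (h1 i) v1 a z * b z) z
     - dird v2 (\<lambda>z. dird v1 a z * b z) z)"
proof -
  define r where "r i z = cquot p \<alpha> (h1 i) v1 a z - dird v1 a z" for i z
  have "Ck_bound (Suc n) F (\<lambda>i. h1 i ^ (2 * p)) N2 r"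
    unfolding r_def[abs_def] by (rule Ck_bound_cquot_error[OF oc sets(5-9) a h1(1,2)])
  moreover have "\<forall>\<^sub>F i in F. 0 \<le> h1 i ^ (2 * p) \<and> h1 i ^ (2 * p) \<le> w i"
    using h1(1,3) by eventually_elim simp
  ultimately have "Ck_bound (Suc n) F w N2 r" by (rule Ck_bound_weight)
  then have rb: "Ck_bound (Suc n) F w N2 (\<lambda>i z. b z * r i z)"
    by (rule Ck_bound_mult_fixed[OF sets(5-8) b])
  have "\<forall>\<^sub>F i in F. \<forall>z\<in>L1. \<forall>t. \<bar>t\<bar> \<le> real p * h2 i \<longrightarrow> z + t *\<^sub>R v2 \<in> N2"
    by (rule eventually_shift_mem[OF sets(3,5,4) h2(2)])
  then have sh: "\<forall>\<^sub>F i in F. h2 i > 0 \<and> (\<forall>x\<in>N1. \<forall>t. \<bar>t\<bar> \<le> real p * h2 i \<longrightarrow> x + t *\<^sub>R v2 \<in> N2)"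
    using h2(1) by eventually_elim (insert sets(2), blast)
  have 1: "Ck_bound n F w N1 (\<lambda>i. cquot p \<alpha> (h2 i) v2 (\<lambda>z. b z * r i z))"
    by (rule Ck_bound_cquot[OF sets(1) rb sh])
  have f: "smooth_on S (\<lambda>z. dird v1 a z * b z)"
    by (rule smooth_on_mult[OF sets(9) smooth_on_dird[OF a] b])
  have "Ck_bound n F (\<lambda>i. h2 i ^ (2 * p)) N1 (\<lambda>i z. cquot p \<alpha> (h2 i) v2 (\<lambda>z. dird v1 a z * b z) z
      - dird v2 (\<lambda>z. dird v1 a z * b z) z)"
    by (rule Ck_bound_cquot_error[OF oc sets(1-3) _ sets(9) f h2(1,2)]) (use sets in blast)
  moreover have "\<forall>\<^sub>F i in F. 0 \<le> h2 i ^ (2 * p) \<and> h2 i ^ (2 * p) \<le> w i"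
    using h2(1,3) by eventually_elim simp
  ultimately have 2: "Ck_bound n F w N1 (\<lambda>i z. cquot p \<alpha> (h2 i) v2 (\<lambda>z. dird v1 a z * b z) z
      - dird v2 (\<lambda>z. dird v1 a z * b z) z)" by (rule Ck_bound_weight)
  have "(\<lambda>z. cquot p \<alpha> (h1 i) v1 a z * b z) = (\<lambda>z. b z * r i z + dird v1 a z * b z)" for i
    by (simp add: r_def fun_eq_iff algebra_simps)
  then have "cquot p \<alpha> (h2 i) v2 (\<lambda>z. cquot p \<alpha> (h1 i) v1 a z * b z) z
     - dird v2 (\<lambda>z. dird v1 a z * b z) z
    = cquot p \<alpha> (h2 i) v2 (\<lambda>z. b z * r i z) z + (cquot p \<alpha> (h2 i) v2 (\<lambda>z. dird v1 a z * b z) z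
      - dird v2 (\<lambda>z. dird v1 a z * b z) z)" for i z
    by (simp only: cquot_add)
  then show ?thesis using Ck_bound_add[OF sets(1) 1 2] by (simp only:)
qed

text \<open>Positive step vectors tending to zero, with no relation imposed between the
  components.\<close>

definition steps :: "(real^3) filter" where
  "steps = at 0 within {\<Delta>. \<forall>k. 0 < \<Delta> $ k}"

lemma steps_props:
  "\<forall>\<^sub>F \<Delta> in steps. \<Delta> $ k > 0" "((\<lambda>\<Delta>. \<Delta> $ k) \<longlongrightarrow> 0) steps"
  "\<forall>\<^sub>F \<Delta> in steps. (\<Delta> $ k) ^ (2 * p) \<le> norm \<Delta> ^ (2 * p)"
proof -
  show pos: "\<forall>\<^sub>F \<Delta> in steps. \<Delta> $ k > 0" by (auto simp: steps_def eventually_at_filter)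
  have "((\<lambda>\<Delta>::real^3. \<Delta> $ k) \<longlongrightarrow> 0 $ k) steps"
    unfolding steps_def by (intro tendsto_vec_nth tendsto_ident_at)
  then show "((\<lambda>\<Delta>. \<Delta> $ k) \<longlongrightarrow> 0) steps" by simp
  show "\<forall>\<^sub>F \<Delta> in steps. (\<Delta> $ k) ^ (2 * p) \<le> norm \<Delta> ^ (2 * p)"
    using pos
  proof eventually_elim
    case (elim \<Delta>)
    have "\<Delta> $ k \<le> norm \<Delta>" using component_le_norm_cart[of \<Delta> k] by linarith
    then show ?case using elim by (intro power_mono) auto
  qed
qed

text \<open>\<open>disc_metric_x\<close> with grid functions replaced by functions on space-time. On
  the grid the two agree, but this one can be differentiated.\<close>

definition metric_h :: "nat \<Rightarrow> (nat \<Rightarrow> real) \<Rightarrow> (real \<times> (real^3) \<Rightarrow> real^3) \<Rightarrow> 3 \<Rightarrow> 3 \<Rightarrow> real^3 \<Rightarrow> real \<times> (real^3) \<Rightarrow> real" where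
  "metric_h p \<alpha> X k j \<Delta> z =
     cquot p \<alpha> (\<Delta> $ (k + 2)) (xi_axis (k + 2))
       (\<lambda>z. cquot p \<alpha> (\<Delta> $ (k + 1)) (xi_axis (k + 1)) (\<lambda>z. X z $ (j + 1)) z * X z $ (j + 2)) z
     - cquot p \<alpha> (\<Delta> $ (k + 1)) (xi_axis (k + 1))
       (\<lambda>z. cquot p \<alpha> (\<Delta> $ (k + 2)) (xi_axis (k + 2)) (\<lambda>z. X z $ (j + 1)) z * X z $ (j + 2)) z"

definition metric_ht :: "nat \<Rightarrow> (nat \<Rightarrow> real) \<Rightarrow> (real \<times> (real^3) \<Rightarrow> real^3) \<Rightarrow> 3 \<Rightarrow> real^3 \<Rightarrow> real \<times> (real^3) \<Rightarrow> real" where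
  "metric_ht p \<alpha> X k \<Delta> z = - (\<Sum>j\<in>UNIV. d_tau X z $ j * metric_h p \<alpha> X k j \<Delta> z)"

lemma smooth_on_component: "open S \<Longrightarrow> smooth_on S X \<Longrightarrow> smooth_on S (\<lambda>z. X z $ j)"
  by (rule smooth_on_linear[OF bounded_linear_vec_nth])

lemma smooth_on_cof: "open S \<Longrightarrow> smooth_on S X \<Longrightarrow> smooth_on S (cof X k j)"
  unfolding cof_def[abs_def]
  by (intro smooth_on_diff smooth_on_mult smooth_on_dird smooth_on_component)

lemma smooth_on_d_tau:
  assumes "open S" "smooth_on S X"
  shows "smooth_on S (d_tau X)"
  by (rule smooth_on_cong[OF smooth_on_dird[OF assms(2), of "(1, 0)"] assms(1)])
    (simp add: d_tau_def dir_deriv_dird smooth_on_differentiable[OF assms(2)])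

text \<open>The limit of the nested quotients is the difference of two derivatives of products; by
  symmetry of mixed derivatives the terms with second derivatives of \<open>X\<close> cancel and the
  cofactor remains.\<close>

lemma metric_h_error:
  assumes oc: "order_coeffs p \<alpha>"
    and sets: "open N1" "N1 \<subseteq> L1" "compact L1" "L1 \<subseteq> N2" "open N2" "N2 \<subseteq> L2" "compact L2" "L2 \<subseteq> S" "open S"
    and X: "smooth_on S X"
  shows "Ck_bound n steps (\<lambda>\<Delta>. norm \<Delta> ^ (2 * p)) N1 (\<lambda>\<Delta> z. metric_h p \<alpha> X k j \<Delta> z - cof X k j z)"
proof -
  let ?a = "\<lambda>z. X z $ (j + 1)" and ?b = "\<lambda>z. X z $ (j + 2)"
  let ?v1 = "xi_axis (k + 1)" and ?v2 = "xi_axis (k + 2)"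
  note sm = smooth_on_component[OF sets(9) X]
  note e = Ck_bound_nested_cquot[OF oc sets sm sm steps_props steps_props]
  have main: "Ck_bound n steps (\<lambda>\<Delta>. norm \<Delta> ^ (2 * p)) N1 (\<lambda>\<Delta> z.
    (cquot p \<alpha> (\<Delta> $ (k + 2)) ?v2 (\<lambda>z. cquot p \<alpha> (\<Delta> $ (k + 1)) ?v1 ?a z * ?b z) z
     - dird ?v2 (\<lambda>z. dird ?v1 ?a z * ?b z) z)
    - (cquot p \<alpha> (\<Delta> $ (k + 1)) ?v1 (\<lambda>z. cquot p \<alpha> (\<Delta> $ (k + 2)) ?v2 ?a z * ?b z) z
     - dird ?v1 (\<lambda>z. dird ?v2 ?a z * ?b z) z))"
    by (rule Ck_bound_diff[OF sets(1) e e])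
  have "cof X k j z = dird ?v2 (\<lambda>z. dird ?v1 ?a z * ?b z) z - dird ?v1 (\<lambda>z. dird ?v2 ?a z * ?b z) z"
    if "z \<in> N1" for z
  proof -
    have z: "z \<in> S" using that sets by blast
    have "dird v (\<lambda>z. dird w ?a z * ?b z) z = dird w ?a z * dird v ?b z + dird v (dird w ?a) z * ?b z" for v w
      by (intro dird_mult smooth_on_differentiable[OF _ z] sm smooth_on_dird)
    moreover have "dird ?v1 (dird ?v2 ?a) z = dird ?v2 (dird ?v1 ?a) z"
      by (rule dird_commute[OF sets(9) sm z])
    ultimately show ?thesis by (simp add: cof_def)
  qed
  then show ?thesis
    by (intro Ck_bound_cong[OF sets(1) _ main]) (auto simp: metric_h_def)
qed

lemma metric_ht_error:
  assumes oc: "order_coeffs p \<alpha>"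
    and sets: "open N1" "N1 \<subseteq> L1" "compact L1" "L1 \<subseteq> N2" "open N2" "N2 \<subseteq> L2" "compact L2" "L2 \<subseteq> S" "open S"
    and X: "smooth_on S X"
  shows "Ck_bound n steps (\<lambda>\<Delta>. norm \<Delta> ^ (2 * p)) N1
    (\<lambda>\<Delta> z. metric_ht p \<alpha> X k \<Delta> z - (- (\<Sum>j\<in>UNIV. d_tau X z $ j * cof X k j z)))"
proof -
  have L1: "L1 \<subseteq> S" using sets by blast
  have "Ck_bound n steps (\<lambda>\<Delta>. norm \<Delta> ^ (2 * p)) N1
    (\<lambda>\<Delta> z. - (\<Sum>j\<in>UNIV. d_tau X z $ j * (metric_h p \<alpha> X k j \<Delta> z - cof X k j z)))"
    by (intro Ck_bound_minus Ck_bound_sum sets(1) finite_class.finite_UNIV UNIV_not_empty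
        Ck_bound_mult_fixed[OF sets(1-3) L1] metric_h_error[OF oc sets X]
        smooth_on_component smooth_on_d_tau sets(9) X)
  moreover have "- (\<Sum>j\<in>UNIV. d_tau X z $ j * (metric_h p \<alpha> X k j \<Delta> z - cof X k j z))
    = metric_ht p \<alpha> X k \<Delta> z - (- (\<Sum>j\<in>UNIV. d_tau X z $ j * cof X k j z))" for \<Delta> z
    by (simp add: metric_ht_def right_diff_distrib sum_subtractf)
  ultimately show ?thesis by simp
qed

section \<open>Accuracy of the scheme\<close>

definition approx :: "'i filter \<Rightarrow> ('i \<Rightarrow> real) \<Rightarrow> 'a set \<Rightarrow> ('i \<Rightarrow> 'a \<Rightarrow> 'b::real_normed_vector) \<Rightarrow> ('a \<Rightarrow> 'b) \<Rightarrow> bool" where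
  "approx F w K A B \<longleftrightarrow> (\<exists>C. \<forall>\<^sub>F i in F. \<forall>z\<in>K. norm (A i z - B z) \<le> C * w i)"

lemma approx_add:
  assumes "approx F w K A B" "approx F w K A' B'"
  shows "approx F w K (\<lambda>i z. A i z + A' i z) (\<lambda>z. B z + B' z)"
proof -
  obtain C D where "\<forall>\<^sub>F i in F. \<forall>z\<in>K. norm (A i z - B z) \<le> C * w i"
    "\<forall>\<^sub>F i in F. \<forall>z\<in>K. norm (A' i z - B' z) \<le> D * w i"
    using assms unfolding approx_def by blast
  then have "\<forall>\<^sub>F i in F. \<forall>z\<in>K. norm ((A i z + A' i z) - (B z + B' z)) \<le> (C + D) * w i"
  proof eventually_elim
    case (elim i)
    show ?case
    proof
      fix z assume "z \<in> K"
      then have "norm ((A i z - B z) + (A' i z - B' z)) \<le> C * w i + D * w i"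
        using elim by (intro order_trans[OF norm_triangle_ineq] add_mono) auto
      then show "norm ((A i z + A' i z) - (B z + B' z)) \<le> (C + D) * w i"
        by (simp add: algebra_simps)
    qed
  qed
  then show ?thesis unfolding approx_def by blast
qed

lemma approx_sum:
  assumes "finite I" "I \<noteq> {}" "\<And>j. j \<in> I \<Longrightarrow> approx F w K (A j) (B j)"
  shows "approx F w K (\<lambda>i z. \<Sum>j\<in>I. A j i z) (\<lambda>z. \<Sum>j\<in>I. B j z)"
  using assms by (induction I rule: finite_ne_induct) (auto intro: approx_add)

lemma approx_cong:
  assumes "approx F w K A B" "\<And>z. z \<in> K \<Longrightarrow> B z = B' z"
  shows "approx F w K A B'"
  using assms by (simp add: approx_def)

section \<open>The right-hand sides on a uniform grid\<close>

lemma grid_point_shift: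
  "(\<tau>, grid_point \<xi> \<Delta> (l + axis k n)) = (\<tau>, grid_point \<xi> \<Delta> l) + (of_int n * \<Delta> $ k) *\<^sub>R xi_axis k"
  by (simp add: grid_point_def vec_eq_iff axis_def distrib_right)

lemma delta_cquot:
  assumes "\<Delta> $ k \<noteq> 0"
  shows "delta p \<alpha> k (\<lambda>l. f (\<tau>, grid_point \<xi> \<Delta> l)) i
    = \<Delta> $ k * cquot p \<alpha> (\<Delta> $ k) (xi_axis k) f (\<tau>, grid_point \<xi> \<Delta> i)"
  unfolding delta_def cquot_def cdiff_def grid_point_shift using assms by simp

lemma disc_metric_x_grid:
  assumes "\<And>k. \<Delta> $ k \<noteq> 0"
  shows "disc_metric_x p \<alpha> \<Delta> (\<lambda>l. X (\<tau>, grid_point \<xi> \<Delta> l)) k j i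
    = metric_h p \<alpha> X k j \<Delta> (\<tau>, grid_point \<xi> \<Delta> i)"
proof -
  let ?z = "\<lambda>l. (\<tau>, grid_point \<xi> \<Delta> l)"
  have "delta p \<alpha> k2 (\<lambda>l. delta p \<alpha> k1 (\<lambda>m. X (?z m) $ j1) l * X (?z l) $ j2) i
    = \<Delta> $ k2 * (\<Delta> $ k1 * cquot p \<alpha> (\<Delta> $ k2) (xi_axis k2)
        (\<lambda>z. cquot p \<alpha> (\<Delta> $ k1) (xi_axis k1) (\<lambda>z. X z $ j1) z * X z $ j2) (?z i))" for k1 k2 j1 j2
  proof -
    let ?f = "\<lambda>z. \<Delta> $ k1 * (cquot p \<alpha> (\<Delta> $ k1) (xi_axis k1) (\<lambda>z. X z $ j1) z * X z $ j2)"
    have "(\<lambda>l. delta p \<alpha> k1 (\<lambda>m. X (?z m) $ j1) l * X (?z l) $ j2) = (\<lambda>l. ?f (?z l))"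
      unfolding delta_cquot[where f = "\<lambda>z. X z $ j1", OF assms] by (simp add: mult.assoc)
    then show ?thesis by (simp only: delta_cquot[where f = ?f, OF assms] cquot_scale)
  qed
  then show ?thesis
    unfolding disc_metric_x_def Let_def metric_h_def using assms by (simp add: field_simps)
qed

lemma node_data_grid:
  fixes \<tau> :: real and \<xi> \<Delta> :: "real^3" and X :: "real \<times> (real^3) \<Rightarrow> real^3" and U :: "real \<times> (real^3) \<Rightarrow> state"
    and p :: nat and \<alpha> :: "nat \<Rightarrow> real"
  assumes "\<And>k. \<Delta> $ k \<noteq> 0"
  defines "z \<equiv> \<lambda>l. (\<tau>, grid_point \<xi> \<Delta> l)"
  shows "node_data p \<alpha> \<Delta> (\<lambda>l. X (z l)) (\<lambda>l. d_tau X (z l)) (\<lambda>l. U (z l)) k l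
    = (U (z l), metric_ht p \<alpha> X k \<Delta> (z l), \<chi> j. metric_h p \<alpha> X k j \<Delta> (z l))"
  by (simp add: node_data_def disc_metric_t_def metric_ht_def z_def disc_metric_x_grid[OF assms(1)])

lemma flux_sum_grid:
  fixes \<tau> :: real and \<xi> \<Delta> :: "real^3" and X :: "real \<times> (real^3) \<Rightarrow> real^3" and U :: "real \<times> (real^3) \<Rightarrow> state"
    and p :: nat and \<alpha> :: "nat \<Rightarrow> real"
    and G :: "node \<Rightarrow> node \<Rightarrow> 'b::real_vector"
  assumes "\<And>k. \<Delta> $ k \<noteq> 0"
  defines "z \<equiv> \<lambda>l. (\<tau>, grid_point \<xi> \<Delta> l)"
    and "N \<equiv> \<lambda>k y. (U y, metric_ht p \<alpha> X k \<Delta> y, \<chi> j. metric_h p \<alpha> X k j \<Delta> y)"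
    and "d \<equiv> \<lambda>k n. (real n * \<Delta> $ k) *\<^sub>R xi_axis k"
  shows "flux_sum p \<alpha> \<Delta> G (node_data p \<alpha> \<Delta> (\<lambda>l. X (z l)) (\<lambda>l. d_tau X (z l)) (\<lambda>l. U (z l))) i
    = (\<Sum>k\<in>UNIV. (1 / \<Delta> $ k) *\<^sub>R (\<Sum>n=1..p. \<alpha> n *\<^sub>R
        (G (N k (z i)) (N k (z i + d k n)) - G (N k (z i - d k n)) (N k (z i)))))"
  unfolding flux_sum_def flux2p_diff z_def node_data_grid[OF assms(1)] N_def d_def grid_point_shift by simp

text \<open>All three kinds of flux take the form of \<open>fdiff\<close>, so a single accuracy
  result covers them: the magnetic flux uses the mean of the two field components as its two-point
  function, and the volume law uses the constant 1.\<close>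

lemma flux_sum_flux2:
  fixes \<tau> :: real and \<xi> \<Delta> :: "real^3" and X :: "real \<times> (real^3) \<Rightarrow> real^3" and U :: "real \<times> (real^3) \<Rightarrow> state"
    and p :: nat and \<alpha> :: "nat \<Rightarrow> real"
  assumes "\<And>k. \<Delta> $ k \<noteq> 0"
  defines "z \<equiv> \<lambda>l. (\<tau>, grid_point \<xi> \<Delta> l)"
  defines "a \<equiv> node_data p \<alpha> \<Delta> (\<lambda>l. X (z l)) (\<lambda>l. d_tau X (z l)) (\<lambda>l. U (z l))"
  shows "flux_sum p \<alpha> \<Delta> (flux2 Ut Ft) a i
    = (\<Sum>k\<in>UNIV. (1 / \<Delta> $ k) *\<^sub>R fdiff p \<alpha> (\<Delta> $ k *\<^sub>R xi_axis k) (metric_ht p \<alpha> X k \<Delta>) (\<lambda>x y. Ut (U x) (U y)) (z i)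
        + (\<Sum>j\<in>UNIV. (1 / \<Delta> $ k) *\<^sub>R fdiff p \<alpha> (\<Delta> $ k *\<^sub>R xi_axis k) (metric_h p \<alpha> X k j \<Delta>) (\<lambda>x y. Ft j (U x) (U y)) (z i)))"
    and "flux_sum p \<alpha> \<Delta> mag2 a i
    = (\<Sum>k\<in>UNIV. \<Sum>j\<in>UNIV. (1 / \<Delta> $ k) *\<^sub>R fdiff p \<alpha> (\<Delta> $ k *\<^sub>R xi_axis k) (metric_h p \<alpha> X k j \<Delta>)
        (\<lambda>x y. (mag (U x) $ j + mag (U y) $ j) / 2) (z i))"
    and "flux_sum p \<alpha> \<Delta> metric_t2 a i
    = (\<Sum>k\<in>UNIV. (1 / \<Delta> $ k) *\<^sub>R fdiff p \<alpha> (\<Delta> $ k *\<^sub>R xi_axis k) (metric_ht p \<alpha> X k \<Delta>) (\<lambda>x y. 1) (z i))"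
proof -
  have sw: "(\<Sum>j\<in>(UNIV::3 set). \<Sum>n=1..p. g j n) = (\<Sum>n=1..p. \<Sum>j\<in>UNIV. g j n)"
    for g :: "3 \<Rightarrow> nat \<Rightarrow> 'c::real_vector" by (rule sum.swap)
  show "flux_sum p \<alpha> \<Delta> (flux2 Ut Ft) a i
    = (\<Sum>k\<in>UNIV. (1 / \<Delta> $ k) *\<^sub>R fdiff p \<alpha> (\<Delta> $ k *\<^sub>R xi_axis k) (metric_ht p \<alpha> X k \<Delta>) (\<lambda>x y. Ut (U x) (U y)) (z i)
        + (\<Sum>j\<in>UNIV. (1 / \<Delta> $ k) *\<^sub>R fdiff p \<alpha> (\<Delta> $ k *\<^sub>R xi_axis k) (metric_h p \<alpha> X k j \<Delta>) (\<lambda>x y. Ft j (U x) (U y)) (z i)))"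
    unfolding a_def z_def flux_sum_grid[OF assms(1)] fdiff_def scaleR_sum_right[symmetric] scaleR_right_distrib[symmetric] sw
      sum.distrib[symmetric]
    by (intro sum.cong refl arg_cong2[where f = scaleR])
      (simp add: sum_subtractf add_diff_add)
  show "flux_sum p \<alpha> \<Delta> mag2 a i
    = (\<Sum>k\<in>UNIV. \<Sum>j\<in>UNIV. (1 / \<Delta> $ k) *\<^sub>R fdiff p \<alpha> (\<Delta> $ k *\<^sub>R xi_axis k) (metric_h p \<alpha> X k j \<Delta>)
        (\<lambda>x y. (mag (U x) $ j + mag (U y) $ j) / 2) (z i))"
    unfolding a_def z_def flux_sum_grid[OF assms(1)] fdiff_def scaleR_sum_right[symmetric] sw
    by (intro sum.cong refl arg_cong2[where f = scaleR]) (simp add: sum_subtractf)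
  show "flux_sum p \<alpha> \<Delta> metric_t2 a i
    = (\<Sum>k\<in>UNIV. (1 / \<Delta> $ k) *\<^sub>R fdiff p \<alpha> (\<Delta> $ k *\<^sub>R xi_axis k) (metric_ht p \<alpha> X k \<Delta>) (\<lambda>x y. 1) (z i))"
    unfolding a_def z_def flux_sum_grid[OF assms(1)] fdiff_def
    by (intro sum.cong refl arg_cong2[where f = scaleR]) simp
qed

text \<open>In the source term an error is multiplied by \<open>grad_Phi\<close>. Since the velocity
  is below 1 in norm, the state alone bounds that factor, so boundedness of \<open>U\<close> on
  \<open>K\<close> makes it uniform.\<close>

lemma grad_Phi_bound:
  assumes "1 < \<Gamma>" "\<Gamma> \<le> 2" "u \<in> admissible \<Gamma>"
  shows "norm (grad_Phi \<Gamma> u) \<le> 3 * norm u + 1"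
proof -
  let ?v = "vel \<Gamma> u" and ?B = "mag u"
  have v: "norm ?v < 1" using prim_of_admissible[OF assms] by blast
  have W: "1 / (lorentz ?v)\<^sup>2 \<le> 1" "0 \<le> 1 / (lorentz ?v)\<^sup>2"
    unfolding lorentz_props(3)[OF v] by (simp, simp add: lorentz_props(3)[OF v, symmetric])
  have B: "norm ?B \<le> norm u"
  proof -
    obtain D m E B where "u = (D, m, E, B)" by (cases u)
    then show ?thesis
      using norm_snd_le[of B E] norm_snd_le[of "(E, B)" m] norm_snd_le[of "(m, E, B)" D]
      by (simp add: mag_def)
  qed
  have vB: "\<bar>?v \<bullet> ?B\<bar> \<le> norm ?B"
    using Cauchy_Schwarz_ineq2[of ?v ?B] mult_right_mono[of "norm ?v" 1 "norm ?B"] v by simp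
  have 1: "norm ((1 / (lorentz ?v)\<^sup>2) *\<^sub>R ?B) \<le> norm ?B"
    using W mult_right_mono[OF W(1), of "norm ?B"] by simp
  have "\<bar>?v \<bullet> ?B\<bar> * norm ?v \<le> norm ?B * 1" using vB v by (intro mult_mono) auto
  then have 2: "norm ((?v \<bullet> ?B) *\<^sub>R ?v) \<le> norm ?B" by simp
  have "norm (grad_Phi \<Gamma> u) \<le> norm ((1 / (lorentz ?v)\<^sup>2) *\<^sub>R ?B + (?v \<bullet> ?B) *\<^sub>R ?v) + (\<bar>?v \<bullet> ?B\<bar> + norm ?v)"
  proof -
    have "norm (grad_Phi \<Gamma> u) = norm ((1 / (lorentz ?v)\<^sup>2) *\<^sub>R ?B + (?v \<bullet> ?B) *\<^sub>R ?v, ?v \<bullet> ?B, ?v)"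
      by (simp add: grad_Phi_def Let_def norm_Pair)
    also have "\<dots> \<le> norm ((1 / (lorentz ?v)\<^sup>2) *\<^sub>R ?B + (?v \<bullet> ?B) *\<^sub>R ?v) + norm (?v \<bullet> ?B, ?v)"
      by (rule norm_Pair_le)
    also have "norm (?v \<bullet> ?B, ?v) \<le> norm (?v \<bullet> ?B) + norm ?v" by (rule norm_Pair_le)
    finally show ?thesis by simp
  qed
  also have "\<dots> \<le> (norm ?B + norm ?B) + (norm ?B + 1)"
    using norm_triangle_ineq[of "(1 / (lorentz ?v)\<^sup>2) *\<^sub>R ?B" "(?v \<bullet> ?B) *\<^sub>R ?v"] 1 2 vB v by linarith
  finally show ?thesis using B by linarith
qed

lemma smooth_on_two_point:
  fixes U :: "'a::euclidean_space \<Rightarrow> state" and g :: "state \<Rightarrow> state \<Rightarrow> 'b::real_normed_vector"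
  assumes "open S" "smooth_on S U" "U ` S \<subseteq> A" "smooth_on (A \<times> A) (\<lambda>(a, b). g a b)"
  shows "smooth_on (S \<times> S) (\<lambda>(x, y). g (U x) (U y))"
proof -
  have o: "open (S \<times> S)" using assms(1) by (rule open_Times) (rule assms(1))
  note i = smooth_on_ident[OF o]
  have 1: "smooth_on (S \<times> S) (\<lambda>xy. U (fst xy))"
    by (rule smooth_on_compose[OF o smooth_on_linear[OF bounded_linear_fst o i] assms(2)]) auto
  have 2: "smooth_on (S \<times> S) (\<lambda>xy. U (snd xy))"
    by (rule smooth_on_compose[OF o smooth_on_linear[OF bounded_linear_snd o i] assms(2)]) auto
  have "smooth_on (S \<times> S) (\<lambda>xy. case (U (fst xy), U (snd xy)) of (a, b) \<Rightarrow> g a b)"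
    by (rule smooth_on_compose[OF o smooth_on_Pair[OF o 1 2] assms(4)]) (use assms(3) in auto)
  then show ?thesis by (simp add: case_prod_beta')
qed

lemma smooth_on_mag: "open S \<Longrightarrow> smooth_on S f \<Longrightarrow> smooth_on S (\<lambda>x. mag (f x) $ j)"
  unfolding mag_def
  by (rule smooth_on_linear[where L = "\<lambda>u. snd (snd (snd u)) $ j"])
    (auto intro!: bounded_linear_compose[OF bounded_linear_vec_nth] bounded_linear_compose[OF bounded_linear_snd]
      bounded_linear_snd)

lemma scheme_accuracy:
  fixes X :: "real \<times> (real^3) \<Rightarrow> real^3" and U :: "real \<times> (real^3) \<Rightarrow> state"
  assumes G: "1 < \<Gamma>" "\<Gamma> \<le> 2" and oc: "order_coeffs p \<alpha>" and tp: "two_point_fluxes \<Gamma> Ut Ft"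
    and S: "open S" and X: "smooth_on S X" "inj_on (time_map X) S" "\<forall>z\<in>S. jac_det X z > 0"
    and U: "smooth_on S U" "U ` S \<subseteq> admissible \<Gamma>" and K: "compact K" "K \<subseteq> S"
  shows "\<exists>C \<epsilon>. \<epsilon> > 0 \<and>
         (\<forall>(\<Delta> :: real^3) \<xi>\<^sub>0 \<tau> i.
            (\<forall>k. 0 < \<Delta> $ k \<and> \<Delta> $ k < \<epsilon>) \<and> (\<tau>, grid_point \<xi>\<^sub>0 \<Delta> i) \<in> K \<longrightarrow>
            (let z = (\<lambda>l. (\<tau>, grid_point \<xi>\<^sub>0 \<Delta> l));
                 x = (\<lambda>l. X (z l)); x' = (\<lambda>l. d_tau X (z l)); u = (\<lambda>l. U (z l));
                 h = Max (range (\<lambda>k. \<Delta> $ k))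
             in norm (rhs_U \<Gamma> Ut Ft p \<alpha> \<Delta> x x' u i
                      - (- (\<Sum>k\<in>UNIV. d_xi k (curv_flux \<Gamma> S X U k) (z i))
                         - (\<Sum>k\<in>UNIV. d_xi k (curv_mag S X U k) (z i)) *\<^sub>R grad_Phi \<Gamma> (U (z i))))
                  \<le> C * h ^ (2 * p) \<and>
                \<bar>rhs_J p \<alpha> \<Delta> x x' u i - (- (\<Sum>k\<in>UNIV. d_xi k (metric_t S X k) (z i)))\<bar>
                  \<le> C * h ^ (2 * p)))"
proof -
  \<comment> \<open>Three margins are required: flux stencils lead from \<open>K\<close> into the
    interior of \<open>L1\<close>, outer metric quotients from \<open>L1\<close> into the interior
    of \<open>L2\<close>, inner ones from \<open>L2\<close> into \<open>S\<close>.\<close>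
  obtain \<rho>2 where r2: "\<rho>2 > 0" "compact (\<Union>x\<in>K. cball x \<rho>2)" "(\<Union>x\<in>K. cball x \<rho>2) \<subseteq> S"
    by (rule compact_enlarge[OF K(1) S K(2)])
  define L2 where "L2 = (\<Union>x\<in>K. cball x \<rho>2)"
  have K2: "K \<subseteq> interior L2"
  proof
    fix x assume "x \<in> K"
    then have "ball x \<rho>2 \<subseteq> L2" by (force simp: L2_def intro: less_imp_le)
    then show "x \<in> interior L2" using r2(1) by (auto intro: interiorI[of "ball x \<rho>2"])
  qed
  obtain \<rho>1 where r1: "\<rho>1 > 0" "compact (\<Union>x\<in>K. cball x \<rho>1)" "(\<Union>x\<in>K. cball x \<rho>1) \<subseteq> interior L2"
    by (rule compact_enlarge[OF K(1) open_interior K2])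
  define L1 where "L1 = (\<Union>x\<in>K. cball x \<rho>1)"
  have K1: "K \<subseteq> interior L1"
  proof
    fix x assume "x \<in> K"
    then have "ball x \<rho>1 \<subseteq> L1" by (force simp: L1_def intro: less_imp_le)
    then show "x \<in> interior L1" using r1(1) by (auto intro: interiorI[of "ball x \<rho>1"])
  qed
  have sets: "open (interior L1)" "interior L1 \<subseteq> L1" "compact L1" "L1 \<subseteq> interior L2" "open (interior L2)"
    "interior L2 \<subseteq> L2" "compact L2" "L2 \<subseteq> S" "open S"
    using r1 r2 S interior_subset by (auto simp: L1_def[symmetric] L2_def[symmetric])
  have N1: "interior L1 \<subseteq> S" using sets by blast
  let ?w = "\<lambda>\<Delta>::real^3. norm \<Delta> ^ (2 * p)"
  define mt where "mt k z = - (\<Sum>j\<in>UNIV. d_tau X z $ j * cof X k j z)" for k z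
  have smt: "smooth_on S (mt k)" for k
    unfolding mt_def[abs_def]
    by (intro smooth_on_minus smooth_on_sum smooth_on_mult smooth_on_component smooth_on_d_tau smooth_on_cof S X(1))
  note smx = smooth_on_cof[OF S X(1)]
  \<comment> \<open>Order 1 is what \<open>fdiff_accuracy\<close> consumes: the flux difference
    spends one derivative of the metric error.\<close>
  note et = metric_ht_error[OF oc sets X(1), of 1, folded mt_def]
  note ex = metric_h_error[OF oc sets X(1), of 1]
  have mx_eq: "metric_x S X k j z = cof X k j z" and mt_eq: "metric_t S X k z = mt k z" if "z \<in> S" for k j z
    using exact_metrics[OF S that X(1,2)] X(3) that by (auto simp: mt_def)
  have core: "approx steps ?w K (\<lambda>\<Delta> z. (1 / \<Delta> $ k) *\<^sub>R fdiff p \<alpha> (\<Delta> $ k *\<^sub>R xi_axis k) (mh \<Delta>) f z)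
      (\<lambda>z. dird (xi_axis k) (\<lambda>z. m z *\<^sub>R f z z) z)"
    if "smooth_on (S \<times> S) (\<lambda>(x, y). f x y)" "smooth_on S m" "\<And>x y. x \<in> S \<Longrightarrow> y \<in> S \<Longrightarrow> f x y = f y x"
      "Ck_bound 1 steps ?w (interior L1) (\<lambda>\<Delta> z. mh \<Delta> z - m z)"
    for k m mh and f :: "real \<times> (real^3) \<Rightarrow> real \<times> (real^3) \<Rightarrow> 'c::real_normed_vector"
    unfolding approx_def
    by (rule fdiff_accuracy[OF oc S that(1,2,3) K(1) K1 open_interior N1 that(4) steps_props])
  have sUt: "smooth_on (S \<times> S) (\<lambda>(x, y). Ut (U x) (U y))"
    and sFt: "\<And>j. smooth_on (S \<times> S) (\<lambda>(x, y). Ft j (U x) (U y))"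
    using tp by (auto simp: two_point_fluxes_def intro!: smooth_on_two_point[OF S U])
  have adm: "U z \<in> admissible \<Gamma>" if "z \<in> S" for z using U(2) that by blast
  have sym: "Ut (U x) (U y) = Ut (U y) (U x)" "Ft j (U x) (U y) = Ft j (U y) (U x)" if "x \<in> S" "y \<in> S" for x y j
    using tp adm[OF that(1)] adm[OF that(2)] unfolding two_point_fluxes_def by blast+
  have cons: "Ut (U z) (U z) = U z" "Ft j (U z) (U z) = phys_flux \<Gamma> j (U z)" if "z \<in> S" for z j
    using tp adm[OF that] unfolding two_point_fluxes_def by blast+
  have o2: "open (S \<times> S)" by (rule open_Times[OF S S])
  have smag: "smooth_on (S \<times> S) (\<lambda>(x, y). (mag (U x) $ j + mag (U y) $ j) / 2)" for j
  proof -
    have 1: "smooth_on (S \<times> S) (\<lambda>xy. mag (U (fst xy)) $ j)"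
      by (intro smooth_on_mag o2 smooth_on_compose[OF o2 smooth_on_linear[OF bounded_linear_fst o2 smooth_on_ident[OF o2]] U(1)]) auto
    have 2: "smooth_on (S \<times> S) (\<lambda>xy. mag (U (snd xy)) $ j)"
      by (intro smooth_on_mag o2 smooth_on_compose[OF o2 smooth_on_linear[OF bounded_linear_snd o2 smooth_on_ident[OF o2]] U(1)]) auto
    from smooth_on_linear[OF bounded_linear_divide o2 smooth_on_add[OF o2 1 2], of 2]
    show ?thesis by (simp add: case_prod_beta')
  qed
  have s1: "smooth_on (S \<times> S) (\<lambda>(x, y). 1 :: real)"
    using smooth_on_const[of "S \<times> S" "1::real"] by (simp add: case_prod_beta')
  have diag: "smooth_on S (\<lambda>z. f z z)" if "smooth_on (S \<times> S) (\<lambda>(x, y). f x y)"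
    for f :: "real \<times> (real^3) \<Rightarrow> real \<times> (real^3) \<Rightarrow> 'c::real_normed_vector"
    using smooth_on_compose[OF S smooth_on_Pair[OF S smooth_on_ident[OF S] smooth_on_ident[OF S]] that] by auto

  have flux_d: "d_xi k (curv_flux \<Gamma> S X U k) z
      = dird (xi_axis k) (\<lambda>z. mt k z *\<^sub>R Ut (U z) (U z)) z
        + (\<Sum>j\<in>UNIV. dird (xi_axis k) (\<lambda>z. cof X k j z *\<^sub>R Ft j (U z) (U z)) z)" if z: "z \<in> S" for k z
  proof -
    let ?g = "\<lambda>z. mt k z *\<^sub>R Ut (U z) (U z) + (\<Sum>j\<in>UNIV. cof X k j z *\<^sub>R Ft j (U z) (U z))"
    have d1: "(\<lambda>z. mt k z *\<^sub>R Ut (U z) (U z)) differentiable (at z)"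
      by (rule smooth_on_differentiable[OF smooth_on_scaleR[OF S smt diag[OF sUt]] z])
    have d2: "(\<lambda>z. cof X k j z *\<^sub>R Ft j (U z) (U z)) differentiable (at z)" for j
      by (rule smooth_on_differentiable[OF smooth_on_scaleR[OF S smx diag[OF sFt]] z])
    have g: "(?g has_derivative (\<lambda>v. dird v (\<lambda>z. mt k z *\<^sub>R Ut (U z) (U z)) z
        + (\<Sum>j\<in>UNIV. dird v (\<lambda>z. cof X k j z *\<^sub>R Ft j (U z) (U z)) z))) (at z)"
      by (intro has_derivative_add has_derivative_sum has_derivative_frechet d1 d2)
    have "(curv_flux \<Gamma> S X U k has_derivative (\<lambda>v. dird v (\<lambda>z. mt k z *\<^sub>R Ut (U z) (U z)) z
        + (\<Sum>j\<in>UNIV. dird v (\<lambda>z. cof X k j z *\<^sub>R Ft j (U z) (U z)) z))) (at z)"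
      by (rule has_derivative_transform_within_open[OF g S z])
        (simp add: curv_flux_def mx_eq mt_eq cons)
    then show ?thesis unfolding d_xi_def by (rule dir_deriv_eq)
  qed
  have mag_d: "d_xi k (curv_mag S X U k) z
      = (\<Sum>j\<in>UNIV. dird (xi_axis k) (\<lambda>z. cof X k j z *\<^sub>R ((mag (U z) $ j + mag (U z) $ j) / 2)) z)"
    if z: "z \<in> S" for k z
  proof -
    have d2: "(\<lambda>z. cof X k j z *\<^sub>R ((mag (U z) $ j + mag (U z) $ j) / 2)) differentiable (at z)" for j
      by (rule smooth_on_differentiable[OF smooth_on_scaleR[OF S smx diag[OF smag]] z])
    have g: "((\<lambda>z. \<Sum>j\<in>UNIV. cof X k j z *\<^sub>R ((mag (U z) $ j + mag (U z) $ j) / 2)) has_derivative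
        (\<lambda>v. \<Sum>j\<in>UNIV. dird v (\<lambda>z. cof X k j z *\<^sub>R ((mag (U z) $ j + mag (U z) $ j) / 2)) z)) (at z)"
      by (intro has_derivative_sum has_derivative_frechet d2)
    have "(curv_mag S X U k has_derivative
        (\<lambda>v. \<Sum>j\<in>UNIV. dird v (\<lambda>z. cof X k j z *\<^sub>R ((mag (U z) $ j + mag (U z) $ j) / 2)) z)) (at z)"
      by (rule has_derivative_transform_within_open[OF g S z])
        (simp add: curv_mag_def mx_eq)
    then show ?thesis unfolding d_xi_def by (rule dir_deriv_eq)
  qed
  have t_d: "d_xi k (metric_t S X k) z = dird (xi_axis k) (\<lambda>z. mt k z *\<^sub>R 1) z" if z: "z \<in> S" for k z
    unfolding d_xi_def
    by (rule dir_deriv_local[OF S z]) (use mt_eq smooth_on_differentiable[OF smt z] in auto)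

  define AF where "AF \<Delta> z = (\<Sum>k\<in>UNIV. (1 / \<Delta> $ k) *\<^sub>R fdiff p \<alpha> (\<Delta> $ k *\<^sub>R xi_axis k) (metric_ht p \<alpha> X k \<Delta>) (\<lambda>x y. Ut (U x) (U y)) z
        + (\<Sum>j\<in>UNIV. (1 / \<Delta> $ k) *\<^sub>R fdiff p \<alpha> (\<Delta> $ k *\<^sub>R xi_axis k) (metric_h p \<alpha> X k j \<Delta>) (\<lambda>x y. Ft j (U x) (U y)) z))" for \<Delta> z
  define AB where "AB \<Delta> z = (\<Sum>k\<in>UNIV. \<Sum>j\<in>UNIV. (1 / \<Delta> $ k) *\<^sub>R fdiff p \<alpha> (\<Delta> $ k *\<^sub>R xi_axis k) (metric_h p \<alpha> X k j \<Delta>)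
        (\<lambda>x y. (mag (U x) $ j + mag (U y) $ j) / 2) z)" for \<Delta> z
  define AJ where "AJ \<Delta> z = (\<Sum>k\<in>UNIV. (1 / \<Delta> $ k) *\<^sub>R fdiff p \<alpha> (\<Delta> $ k *\<^sub>R xi_axis k) (metric_ht p \<alpha> X k \<Delta>) (\<lambda>x y. 1 :: real) z)" for \<Delta> z
  have "approx steps ?w K AF (\<lambda>z. \<Sum>k\<in>UNIV. dird (xi_axis k) (\<lambda>z. mt k z *\<^sub>R Ut (U z) (U z)) z
        + (\<Sum>j\<in>UNIV. dird (xi_axis k) (\<lambda>z. cof X k j z *\<^sub>R Ft j (U z) (U z)) z))"
    unfolding AF_def[abs_def]
    by (intro approx_sum approx_add core sUt sFt smt smx et ex finite_class.finite_UNIV UNIV_not_empty) (auto intro: sym)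
  then have aF: "approx steps ?w K AF (\<lambda>z. \<Sum>k\<in>UNIV. d_xi k (curv_flux \<Gamma> S X U k) z)"
    by (rule approx_cong) (use K flux_d in auto)
  have "approx steps ?w K AB (\<lambda>z. \<Sum>k\<in>UNIV. \<Sum>j\<in>UNIV. dird (xi_axis k)
      (\<lambda>z. cof X k j z *\<^sub>R ((mag (U z) $ j + mag (U z) $ j) / 2)) z)"
    unfolding AB_def[abs_def]
    by (intro approx_sum core smag smx ex finite_class.finite_UNIV UNIV_not_empty) auto
  then have aB: "approx steps ?w K AB (\<lambda>z. \<Sum>k\<in>UNIV. d_xi k (curv_mag S X U k) z)"
    by (rule approx_cong) (use K mag_d in auto)
  have "approx steps ?w K AJ (\<lambda>z. \<Sum>k\<in>UNIV. dird (xi_axis k) (\<lambda>z. mt k z *\<^sub>R 1) z)"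
    unfolding AJ_def[abs_def]
    by (intro approx_sum core s1 smt et finite_class.finite_UNIV UNIV_not_empty) auto
  then have aJ: "approx steps ?w K AJ (\<lambda>z. \<Sum>k\<in>UNIV. d_xi k (metric_t S X k) z)"
    by (rule approx_cong) (use K t_d in auto)

  have "bounded (U ` K)"
    by (intro compact_imp_bounded compact_continuous_image K continuous_on_subset[OF smooth_on_continuous[OF U(1)]])
  then obtain b where b: "\<And>z. z \<in> K \<Longrightarrow> norm (U z) \<le> b" unfolding bounded_iff by auto
  have gb: "norm (grad_Phi \<Gamma> (U z)) \<le> 3 * \<bar>b\<bar> + 1" if "z \<in> K" for z
    using grad_Phi_bound[OF G adm[of z]] b[OF that] K that by auto
  obtain CF CB CJ where C: "\<forall>\<^sub>F \<Delta> in steps. \<forall>z\<in>K. norm (AF \<Delta> z - (\<Sum>k\<in>UNIV. d_xi k (curv_flux \<Gamma> S X U k) z)) \<le> CF * ?w \<Delta>"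
    "\<forall>\<^sub>F \<Delta> in steps. \<forall>z\<in>K. norm (AB \<Delta> z - (\<Sum>k\<in>UNIV. d_xi k (curv_mag S X U k) z)) \<le> CB * ?w \<Delta>"
    "\<forall>\<^sub>F \<Delta> in steps. \<forall>z\<in>K. norm (AJ \<Delta> z - (\<Sum>k\<in>UNIV. d_xi k (metric_t S X k) z)) \<le> CJ * ?w \<Delta>"
    using aF aB aJ unfolding approx_def by blast
  \<comment> \<open>One nonnegative constant for both bounds; the error of the magnetic divergence
    enters with the bound on \<open>grad_Phi\<close>.\<close>
  define C where "C = \<bar>CF\<bar> + \<bar>CB\<bar> * (3 * \<bar>b\<bar> + 1) + \<bar>CJ\<bar>"
  define Q where "Q \<Delta> z \<longleftrightarrow>
      norm ((- AF \<Delta> z - AB \<Delta> z *\<^sub>R grad_Phi \<Gamma> (U z)) - (- (\<Sum>k\<in>UNIV. d_xi k (curv_flux \<Gamma> S X U k) z)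
         - (\<Sum>k\<in>UNIV. d_xi k (curv_mag S X U k) z) *\<^sub>R grad_Phi \<Gamma> (U z))) \<le> C * ?w \<Delta>
      \<and> \<bar>- AJ \<Delta> z - (- (\<Sum>k\<in>UNIV. d_xi k (metric_t S X k) z))\<bar> \<le> C * ?w \<Delta>" for \<Delta> z
  have "\<forall>\<^sub>F \<Delta> in steps. \<forall>z\<in>K. Q \<Delta> z"
    using C
  proof eventually_elim
    case (elim \<Delta>)
    show ?case
    proof
      fix z assume z: "z \<in> K"
      let ?F = "\<Sum>k\<in>UNIV. d_xi k (curv_flux \<Gamma> S X U k) z"
      let ?B = "\<Sum>k\<in>UNIV. d_xi k (curv_mag S X U k) z"
      let ?J = "\<Sum>k\<in>UNIV. d_xi k (metric_t S X k) z"
      let ?g = "grad_Phi \<Gamma> (U z)"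
      have w: "0 \<le> ?w \<Delta>" by simp
      have le: "c * ?w \<Delta> \<le> \<bar>c\<bar> * ?w \<Delta>" for c by (rule mult_right_mono) auto
      have eF: "norm (AF \<Delta> z - ?F) \<le> \<bar>CF\<bar> * ?w \<Delta>" and eB: "\<bar>AB \<Delta> z - ?B\<bar> \<le> \<bar>CB\<bar> * ?w \<Delta>"
        and eJ: "\<bar>AJ \<Delta> z - ?J\<bar> \<le> \<bar>CJ\<bar> * ?w \<Delta>"
        using elim z le[of CF] le[of CB] le[of CJ] by (auto intro: order_trans)
      have "(- AF \<Delta> z - AB \<Delta> z *\<^sub>R ?g) - (- ?F - ?B *\<^sub>R ?g) = - (AF \<Delta> z - ?F) - (AB \<Delta> z - ?B) *\<^sub>R ?g"
        by (simp add: algebra_simps)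
      also have "norm \<dots> \<le> norm (- (AF \<Delta> z - ?F)) + norm ((AB \<Delta> z - ?B) *\<^sub>R ?g)" by (rule norm_triangle_ineq4)
      also have "\<dots> \<le> \<bar>CF\<bar> * ?w \<Delta> + (\<bar>CB\<bar> * ?w \<Delta>) * (3 * \<bar>b\<bar> + 1)"
        unfolding norm_minus_cancel norm_scaleR
        using eF eB gb[OF z] w by (intro add_mono mult_mono) auto
      also have "\<dots> \<le> C * ?w \<Delta>"
        using w by (simp add: C_def algebra_simps)
      finally have 1: "norm ((- AF \<Delta> z - AB \<Delta> z *\<^sub>R ?g) - (- ?F - ?B *\<^sub>R ?g)) \<le> C * ?w \<Delta>" .
      have "\<bar>CJ\<bar> * ?w \<Delta> \<le> C * ?w \<Delta>" unfolding C_def by (intro mult_right_mono w) simp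
      then have "\<bar>- AJ \<Delta> z - (- ?J)\<bar> \<le> C * ?w \<Delta>" using eJ by linarith
      then show "Q \<Delta> z" unfolding Q_def using 1 by blast
    qed
  qed
  then obtain d where d0: "d > 0"
    "\<forall>\<Delta>\<in>{\<Delta>. \<forall>k. 0 < \<Delta> $ k}. \<Delta> \<noteq> 0 \<and> dist \<Delta> 0 < d \<longrightarrow> (\<forall>z\<in>K. Q \<Delta> z)"
    unfolding steps_def eventually_at by blast
  have d: "d > 0" "Q \<Delta> z" if "\<forall>k. 0 < \<Delta> $ k" "norm \<Delta> < d" "z \<in> K" for \<Delta> z
  proof -
    have "\<Delta> \<noteq> 0" using that(1) by (metis less_irrefl zero_index)
    then show "d > 0" "Q \<Delta> z" using d0 that by auto
  qed
  show ?thesis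
  \<comment> \<open>The estimates so far use the Euclidean norm of the step vector, the claim its
    largest component. The norm is at most the sum of the three components, hence at most
    \<open>3 * h\<close>, which accounts for both factors 3.\<close>
  proof (rule exI[of _ "C * 3 ^ (2 * p)"], rule exI[of _ "d / 3"], intro conjI allI impI)
    show "d / 3 > 0" using d0 by simp
    fix \<Delta> :: "real^3" and \<xi>\<^sub>0 \<tau> i
    assume *: "(\<forall>k. 0 < \<Delta> $ k \<and> \<Delta> $ k < d / 3) \<and> (\<tau>, grid_point \<xi>\<^sub>0 \<Delta> i) \<in> K"
    let ?h = "Max (range (\<lambda>k. \<Delta> $ k))"
    let ?z = "\<lambda>l. (\<tau>, grid_point \<xi>\<^sub>0 \<Delta> l)"
    have nz: "\<Delta> $ k \<noteq> 0" for k using * by (metis less_irrefl)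
    have le_h: "\<Delta> $ k \<le> ?h" for k by (rule Max_ge) auto
    have pos: "\<bar>\<Delta> $ k\<bar> = \<Delta> $ k" "\<Delta> $ k < d / 3" for k using * by (auto simp: less_imp_le)
    have n3: "norm \<Delta> \<le> \<Delta> $ 1 + \<Delta> $ 2 + \<Delta> $ 3"
      using norm_le_l1_cart[of \<Delta>] by (simp add: sum_3 pos(1))
    have "norm \<Delta> < d" using n3 pos(2)[of 1] pos(2)[of 2] pos(2)[of 3] by linarith
    then have bnd: "Q \<Delta> (?z i)" using * by (intro d(2)) auto
    have "norm \<Delta> \<le> 3 * ?h" using n3 le_h[of 1] le_h[of 2] le_h[of 3] by linarith
    then have "?w \<Delta> \<le> (3 * ?h) ^ (2 * p)" by (intro power_mono) auto
    moreover have "C \<ge> 0" by (simp add: C_def)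
    ultimately have "C * ?w \<Delta> \<le> C * (3 * ?h) ^ (2 * p)" by (rule mult_left_mono)
    also have "\<dots> = C * 3 ^ (2 * p) * ?h ^ (2 * p)" by (simp add: power_mult_distrib)
    finally have Ch: "C * ?w \<Delta> \<le> C * 3 ^ (2 * p) * ?h ^ (2 * p)" .
    have rU: "rhs_U \<Gamma> Ut Ft p \<alpha> \<Delta> (\<lambda>l. X (?z l)) (\<lambda>l. d_tau X (?z l)) (\<lambda>l. U (?z l)) i
        = - AF \<Delta> (?z i) - AB \<Delta> (?z i) *\<^sub>R grad_Phi \<Gamma> (U (?z i))"
      unfolding rhs_U_def flux_sum_flux2(1,2)[OF nz] AF_def AB_def ..
    have rJ: "rhs_J p \<alpha> \<Delta> (\<lambda>l. X (?z l)) (\<lambda>l. d_tau X (?z l)) (\<lambda>l. U (?z l)) i = - AJ \<Delta> (?z i)"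
      unfolding rhs_J_def flux_sum_flux2(3)[OF nz] AJ_def ..
    show "let z = ?z; x = (\<lambda>l. X (z l)); x' = (\<lambda>l. d_tau X (z l)); u = (\<lambda>l. U (z l));
                 h = Max (range (\<lambda>k. \<Delta> $ k))
             in norm (rhs_U \<Gamma> Ut Ft p \<alpha> \<Delta> x x' u i
                      - (- (\<Sum>k\<in>UNIV. d_xi k (curv_flux \<Gamma> S X U k) (z i))
                         - (\<Sum>k\<in>UNIV. d_xi k (curv_mag S X U k) (z i)) *\<^sub>R grad_Phi \<Gamma> (U (z i))))
                  \<le> C * 3 ^ (2 * p) * h ^ (2 * p) \<and>
                \<bar>rhs_J p \<alpha> \<Delta> x x' u i - (- (\<Sum>k\<in>UNIV. d_xi k (metric_t S X k) (z i)))\<bar>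
                  \<le> C * 3 ^ (2 * p) * h ^ (2 * p)"
      unfolding Let_def rU rJ using bnd Ch unfolding Q_def by (meson order_trans)
  qed
qed

section \<open>Accuracy, entropy conservation and consistency combined\<close>

theorem theorem3p2:
  fixes \<Gamma> :: real and p :: nat and \<alpha> :: "nat \<Rightarrow> real"
    and Ut :: "state \<Rightarrow> state \<Rightarrow> state" and Ft :: "3 \<Rightarrow> state \<Rightarrow> state \<Rightarrow> state"
  assumes "1 < \<Gamma>" and "\<Gamma> \<le> 2" and "p \<ge> 1"
    and "order_coeffs p \<alpha>"
    and "two_point_fluxes \<Gamma> Ut Ft"
  shows
    "(\<forall>(S :: (real \<times> (real^3)) set) X U K.
       open S \<and> smooth_on S X \<and> inj_on (time_map X) S \<and> (\<forall>z\<in>S. jac_det X z > 0) \<and>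
       smooth_on S U \<and> U ` S \<subseteq> admissible \<Gamma> \<and> compact K \<and> K \<subseteq> S \<longrightarrow>
       (\<exists>C \<epsilon>. \<epsilon> > 0 \<and>
         (\<forall>(\<Delta> :: real^3) \<xi>\<^sub>0 \<tau> i.
            (\<forall>k. 0 < \<Delta> $ k \<and> \<Delta> $ k < \<epsilon>) \<and> (\<tau>, grid_point \<xi>\<^sub>0 \<Delta> i) \<in> K \<longrightarrow>
            (let z = (\<lambda>l. (\<tau>, grid_point \<xi>\<^sub>0 \<Delta> l));
                 x = (\<lambda>l. X (z l)); x' = (\<lambda>l. d_tau X (z l)); u = (\<lambda>l. U (z l));
                 h = Max (range (\<lambda>k. \<Delta> $ k))
             in norm (rhs_U \<Gamma> Ut Ft p \<alpha> \<Delta> x x' u i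
                      - (- (\<Sum>k\<in>UNIV. d_xi k (curv_flux \<Gamma> S X U k) (z i))
                         - (\<Sum>k\<in>UNIV. d_xi k (curv_mag S X U k) (z i)) *\<^sub>R grad_Phi \<Gamma> (U (z i))))
                  \<le> C * h ^ (2 * p) \<and>
                \<bar>rhs_J p \<alpha> \<Delta> x x' u i - (- (\<Sum>k\<in>UNIV. d_xi k (metric_t S X k) (z i)))\<bar>
                  \<le> C * h ^ (2 * p)))))
     \<and>
     (\<forall>(\<Delta> :: real^3) T J u x x'.
       (\<forall>k. \<Delta> $ k > 0) \<and> is_interval T \<and> scheme_solution \<Gamma> Ut Ft p \<alpha> \<Delta> T J u x x' \<longrightarrow>
       (\<forall>t\<in>T. \<forall>i. ((\<lambda>s. J s i * eta \<Gamma> (u s i)) has_real_derivative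
          - flux_sum p \<alpha> \<Delta> (ent_flux2 \<Gamma> Ut Ft) (node_data p \<alpha> \<Delta> (x t) (x' t) (u t)) i)
          (at t within T)))
     \<and>
     (\<forall>U\<in>admissible \<Gamma>. \<forall>m\<^sub>t (m\<^sub>x :: real^3).
       (let q = m\<^sub>t * eta \<Gamma> U + (\<Sum>j\<in>UNIV. m\<^sub>x $ j * ent_flux \<Gamma> j U) in
        ent_flux2 \<Gamma> Ut Ft (U, m\<^sub>t, m\<^sub>x) (U, m\<^sub>t, m\<^sub>x) = q \<and>
        (\<forall>k a i. (\<forall>n. - int p < n \<and> n \<le> int p \<longrightarrow> a (i + axis k n) = (U, m\<^sub>t, m\<^sub>x)) \<longrightarrow>
           flux2p p \<alpha> k (ent_flux2 \<Gamma> Ut Ft) a i = q)))"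
proof (intro conjI allI impI ballI)
  show "\<exists>C \<epsilon>. \<epsilon> > 0 \<and>
         (\<forall>(\<Delta> :: real^3) \<xi>\<^sub>0 \<tau> i.
            (\<forall>k. 0 < \<Delta> $ k \<and> \<Delta> $ k < \<epsilon>) \<and> (\<tau>, grid_point \<xi>\<^sub>0 \<Delta> i) \<in> K \<longrightarrow>
            (let z = (\<lambda>l. (\<tau>, grid_point \<xi>\<^sub>0 \<Delta> l));
                 x = (\<lambda>l. X (z l)); x' = (\<lambda>l. d_tau X (z l)); u = (\<lambda>l. U (z l));
                 h = Max (range (\<lambda>k. \<Delta> $ k))
             in norm (rhs_U \<Gamma> Ut Ft p \<alpha> \<Delta> x x' u i
                      - (- (\<Sum>k\<in>UNIV. d_xi k (curv_flux \<Gamma> S X U k) (z i))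
                         - (\<Sum>k\<in>UNIV. d_xi k (curv_mag S X U k) (z i)) *\<^sub>R grad_Phi \<Gamma> (U (z i))))
                  \<le> C * h ^ (2 * p) \<and>
                \<bar>rhs_J p \<alpha> \<Delta> x x' u i - (- (\<Sum>k\<in>UNIV. d_xi k (metric_t S X k) (z i)))\<bar>
                  \<le> C * h ^ (2 * p)))"
    if "open S \<and> smooth_on S X \<and> inj_on (time_map X) S \<and> (\<forall>z\<in>S. jac_det X z > 0) \<and>
       smooth_on S U \<and> U ` S \<subseteq> admissible \<Gamma> \<and> compact K \<and> K \<subseteq> S" for S X U K
    using that by (intro scheme_accuracy[OF assms(1,2,4,5)]) auto
next
  show "((\<lambda>s. J s i * eta \<Gamma> (u s i)) has_real_derivative
          - flux_sum p \<alpha> \<Delta> (ent_flux2 \<Gamma> Ut Ft) (node_data p \<alpha> \<Delta> (x t) (x' t) (u t)) i)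
          (at t within T)"
    if "(\<forall>k. \<Delta> $ k > 0) \<and> is_interval T \<and> scheme_solution \<Gamma> Ut Ft p \<alpha> \<Delta> T J u x x'" "t \<in> T"
    for \<Delta> T J u x x' t i
    using that by (intro entropy_conservation[OF assms(1,2,5)]) auto
next
  show "let q = m\<^sub>t * eta \<Gamma> U + (\<Sum>j\<in>UNIV. m\<^sub>x $ j * ent_flux \<Gamma> j U) in
        ent_flux2 \<Gamma> Ut Ft (U, m\<^sub>t, m\<^sub>x) (U, m\<^sub>t, m\<^sub>x) = q \<and>
        (\<forall>k a i. (\<forall>n. - int p < n \<and> n \<le> int p \<longrightarrow> a (i + axis k n) = (U, m\<^sub>t, m\<^sub>x)) \<longrightarrow>
           flux2p p \<alpha> k (ent_flux2 \<Gamma> Ut Ft) a i = q)"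
    if "U \<in> admissible \<Gamma>" for U m\<^sub>t and m\<^sub>x :: "real^3"
  proof -
    have "flux2p p \<alpha> k (ent_flux2 \<Gamma> Ut Ft) a i = ent_flux2 \<Gamma> Ut Ft (U, m\<^sub>t, m\<^sub>x) (U, m\<^sub>t, m\<^sub>x)"
      if "\<forall>n. - int p < n \<and> n \<le> int p \<longrightarrow> a (i + axis k n) = (U, m\<^sub>t, m\<^sub>x)" for k a i
      by (rule flux2p_constant) (use assms(4) that in \<open>auto simp: order_coeffs_def\<close>)
    then show ?thesis
      unfolding Let_def entropy_flux_consistent[OF assms(5) \<open>U \<in> admissible \<Gamma>\<close>] by blast
  qed
qed

end
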